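(* Let $m,n\ge3$. The following are equivalent: (a) there is a unique maximal (in the weak order) $K_{3,3}$-matroid on $K_{m,n}$; (b) ${\rm val}_{K_{3,3}}$ is submodular on $E(K_{m,n})$.
   Context: A $K_{3,3}$-matroid on $K_{m,n}$ is a matroid on $E(K_{m,n})$ in which the edge set of every subgraph isomorphic to $K_{3,3}$ is a circuit. Weak order: ${\mathcal M}_1\preceq{\mathcal M}_2$ if every independent set of ${\mathcal M}_1$ is independent in ${\mathcal M}_2$. With ${\mathcal X}$ the family of edge sets of copies of $K_{3,3}$ in $K_{m,n}$: a proper ${\mathcal X}$-sequence is $(X_1,\dots,X_k)$ in ${\mathcal X}$ with $X_i\not\subseteq\bigcup_{j<i}X_j$ for $i\ge2$; for $F\subseteq E(K_{m,n})$, ${\rm val}(F,{\mathcal S})=|F\cup\bigcup_iX_i|-k$, and ${\rm val}_{K_{3,3}}(F)=\min_{\mathcal S}{\rm val}(F,{\mathcal S})$. *)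

theory Defs
  imports Main
begin

type_synonym 'v graph = "'v set \<times> 'v set set"

abbreviation verts :: "'v graph \<Rightarrow> 'v set" where
  "verts \<equiv> fst"

abbreviation edges :: "'v graph \<Rightarrow> 'v set set" where
  "edges \<equiv> snd"

definition simple_graph :: "'v graph \<Rightarrow> bool" where
  "simple_graph G \<longleftrightarrow> (\<forall>e\<in>edges G. e \<subseteq> verts G \<and> card e = 2)"

definition subgraph :: "'v graph \<Rightarrow> 'v graph \<Rightarrow> bool" where
  "subgraph H G \<longleftrightarrow> simple_graph H \<and> verts H \<subseteq> verts G \<and> edges H \<subseteq> edges G"

definition graph_iso :: "'v graph \<Rightarrow> 'w graph \<Rightarrow> bool" where
  "graph_iso G H \<longleftrightarrow> (\<exists>f. bij_betw f (verts G) (verts H) \<and>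
     (\<forall>u\<in>verts G. \<forall>v\<in>verts G. {u, v} \<in> edges G \<longleftrightarrow> {f u, f v} \<in> edges H))"

definition complete_bipartite :: "nat \<Rightarrow> nat \<Rightarrow> (nat + nat) graph" where
  "complete_bipartite m n =
     (Inl ` {..<m} \<union> Inr ` {..<n}, {{Inl i, Inr j} | i j. i < m \<and> j < n})"

definition K33_copies :: "'v graph \<Rightarrow> 'v set set set" where
  "K33_copies G = {edges H | H. subgraph H G \<and> graph_iso H (complete_bipartite 3 3)}"

text \<open>A matroid on the ground set \<open>E\<close> is given by its family \<open>M\<close> of independent sets.\<close>

definition matroid_on :: "'e set \<Rightarrow> 'e set set \<Rightarrow> bool" where
  "matroid_on E M \<longleftrightarrow> finite E \<and> M \<subseteq> Pow E \<and> {} \<in> M \<and>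
     (\<forall>I J. J \<in> M \<and> I \<subseteq> J \<longrightarrow> I \<in> M) \<and>
     (\<forall>I J. I \<in> M \<and> J \<in> M \<and> card I < card J \<longrightarrow> (\<exists>e\<in>J - I. insert e I \<in> M))"

definition circuit :: "'e set \<Rightarrow> 'e set set \<Rightarrow> 'e set \<Rightarrow> bool" where
  "circuit E M C \<longleftrightarrow> C \<subseteq> E \<and> C \<notin> M \<and> (\<forall>D. D \<subset> C \<longrightarrow> D \<in> M)"

definition weak_le :: "'e set set \<Rightarrow> 'e set set \<Rightarrow> bool" where
  "weak_le M1 M2 \<longleftrightarrow> (\<forall>I. I \<in> M1 \<longrightarrow> I \<in> M2)"

definition K33_matroid :: "'v graph \<Rightarrow> 'v set set set \<Rightarrow> bool" where
  "K33_matroid G M \<longleftrightarrow> matroid_on (edges G) M \<and> (\<forall>X\<in>K33_copies G. circuit (edges G) M X)"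

definition maximal_K33_matroid :: "'v graph \<Rightarrow> 'v set set set \<Rightarrow> bool" where
  "maximal_K33_matroid G M \<longleftrightarrow> K33_matroid G M \<and>
     (\<forall>N. K33_matroid G N \<and> weak_le M N \<longrightarrow> N = M)"

text \<open>Sequences are lists, indexed from 0. The empty sequence is proper, so that
  the minimum below is at most \<open>card F\<close>.\<close>

definition proper_seq :: "'e set set \<Rightarrow> 'e set list \<Rightarrow> bool" where
  "proper_seq \<X> S \<longleftrightarrow> set S \<subseteq> \<X> \<and>
     (\<forall>i. 1 \<le> i \<and> i < length S \<longrightarrow> \<not> S ! i \<subseteq> (\<Union>j<i. S ! j))"

definition val_seq :: "'e set \<Rightarrow> 'e set list \<Rightarrow> int" where
  "val_seq F S = int (card (F \<union> \<Union>(set S))) - int (length S)"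

definition val_min :: "'e set set \<Rightarrow> 'e set \<Rightarrow> int" where
  "val_min \<X> F = Min {val_seq F S | S. proper_seq \<X> S}"

definition val_K33 :: "'v graph \<Rightarrow> 'v set set \<Rightarrow> int" where
  "val_K33 G F = val_min (K33_copies G) F"

definition submodular_on :: "'e set \<Rightarrow> ('e set \<Rightarrow> int) \<Rightarrow> bool" where
  "submodular_on E f \<longleftrightarrow>
     (\<forall>A B. A \<subseteq> E \<and> B \<subseteq> E \<longrightarrow> f (A \<union> B) + f (A \<inter> B) \<le> f A + f B)"

end

theory Submission
  imports Defs Complex_Main "HOL-Combinatorics.Transposition"
begin

text \<open>
  The interesting direction is that a greatest \<open>K\<^sub>3\<^sub>,\<^sub>3\<close>-matroid \<open>M\<close> has rank function \<open>val\<close>.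
  Call a maximal complete bipartite subgraph \<open>K\<^sub>a\<^sub>,\<^sub>b\<close> with \<open>a, b \<ge> 3\<close> of a flat \<open>F\<close> a blob of \<open>F\<close>;
  it has rank \<open>2(a + b) - 4\<close>, and two blobs share at most one vertex on each side.
  The core is the formula \<open>r(F) = |F| - (\<Sum> (a - 2)(b - 2))\<close>, summed over the blobs of \<open>F\<close>, proved by
  induction on \<open>r(F)\<close>. The function \<open>\<rho>(P) = |P| - (\<Sum> null(P \<inter> B))\<close> on subsets of \<open>F\<close> is submodular.
  If \<open>\<rho> \<ge> r\<close> and \<open>\<rho>(F) > r(F)\<close>, then \<open>\<rho>\<close> defines a larger \<open>K\<^sub>3\<^sub>,\<^sub>3\<close>-matroid of rank \<open>r(F) + 1\<close>
  (an erection of a truncation of \<open>M\<close>), which is impossible. That \<open>\<rho> \<ge> r\<close> follows from a counting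
  argument: invariance of \<open>M\<close> under permutations of the vertices bounds the blobs through a vertex,
  and a double count then yields a vertex lying in exactly one blob; deleting it reduces a minimal
  counterexample.
  The same vertex, removed repeatedly, produces a proper sequence showing \<open>val(F) \<le> r(F)\<close>.
\<close>

lemma unique_maximal_iff_greatest:
  fixes S :: "'a::order set"
  assumes "finite S"
  shows "(\<exists>!M. M \<in> S \<and> (\<forall>N\<in>S. M \<le> N \<longrightarrow> N = M)) \<longleftrightarrow> (\<exists>M\<in>S. \<forall>N\<in>S. N \<le> M)"
proof
  assume "\<exists>!M. M \<in> S \<and> (\<forall>N\<in>S. M \<le> N \<longrightarrow> N = M)"
  then obtain M where M: "M \<in> S"
    and unique: "\<And>K. K \<in> S \<Longrightarrow> (\<And>N. N \<in> S \<Longrightarrow> K \<le> N \<Longrightarrow> N = K) \<Longrightarrow> K = M"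
    by blast
  show "\<exists>M\<in>S. \<forall>N\<in>S. N \<le> M"
  proof (intro bexI ballI)
    fix N assume "N \<in> S"
    then obtain K where K: "K \<in> S" "N \<le> K" "\<forall>L\<in>S. K \<le> L \<longrightarrow> K = L"
      using finite_has_maximal2[OF assms] by blast
    then have "K = M" by (intro unique) auto
    with K show "N \<le> M" by simp
  qed (rule M)
next
  assume "\<exists>M\<in>S. \<forall>N\<in>S. N \<le> M"
  then show "\<exists>!M. M \<in> S \<and> (\<forall>N\<in>S. M \<le> N \<longrightarrow> N = M)"
    by (metis order_antisym)
qed

lemma card_ge_2E:
  assumes "2 \<le> card A"
  obtains a b where "a \<in> A" "b \<in> A" "a \<noteq> b"
proof -
  obtain T where "T \<subseteq> A" "card T = 2" using assms by (meson obtain_subset_with_card_n)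
  then show ?thesis using that by (auto simp: card_2_iff)
qed

lemma card_ge_2I:
  assumes "finite A" "a \<in> A" "b \<in> A" "a \<noteq> b"
  shows "2 \<le> card A"
  using card_mono[of A "{a, b}"] assms by simp

lemma card_3E:
  assumes "card A = 3" "x \<in> A"
  obtains a b where "A = {x, a, b}" "a \<noteq> b" "x \<noteq> a" "x \<noteq> b"
proof -
  have "card (A - {x}) = 2" using assms card_ge_0_finite[of A] by simp
  then obtain a b where "A - {x} = {a, b}" "a \<noteq> b" by (meson card_2_iff)
  then show ?thesis using that[of a b] assms(2) by blast
qed

section \<open>Matroids\<close>

locale matroid =
  fixes E :: "'e set" and M :: "'e set set"
  assumes matroid_on: "matroid_on E M"
begin

definition rank :: "'e set \<Rightarrow> nat" where
  "rank A = Max (card ` {I \<in> M. I \<subseteq> A})"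

definition nullity :: "'e set \<Rightarrow> nat" where
  "nullity A = card A - rank A"

definition closure :: "'e set \<Rightarrow> 'e set" where
  "closure A = {e \<in> E. rank (insert e A) = rank A}"

definition flat :: "'e set \<Rightarrow> bool" where
  "flat F \<longleftrightarrow> F \<subseteq> E \<and> closure F \<subseteq> F"

lemma finite_ground: "finite E"
  using matroid_on by (simp add: matroid_on_def)

lemma indep_subset_ground: "I \<in> M \<Longrightarrow> I \<subseteq> E"
  using matroid_on by (auto simp: matroid_on_def)

lemma empty_indep: "{} \<in> M"
  using matroid_on by (simp add: matroid_on_def)

lemma indep_subset: "J \<in> M \<Longrightarrow> I \<subseteq> J \<Longrightarrow> I \<in> M"
  using matroid_on unfolding matroid_on_def by blast

lemma augment: "I \<in> M \<Longrightarrow> J \<in> M \<Longrightarrow> card I < card J \<Longrightarrow> \<exists>e\<in>J - I. insert e I \<in> M"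
  using matroid_on by (simp add: matroid_on_def)

lemma finite_indep_family: "finite M"
  using finite_ground indep_subset_ground by (intro finite_subset[of M "Pow E"]) auto

lemma finite_subset_ground: "A \<subseteq> E \<Longrightarrow> finite A"
  using finite_ground finite_subset by blast

lemma finite_indep: "I \<in> M \<Longrightarrow> finite I"
  using indep_subset_ground finite_subset_ground by blast

lemma card_indep_le_rank: "I \<in> M \<Longrightarrow> I \<subseteq> A \<Longrightarrow> card I \<le> rank A"
  unfolding rank_def using finite_indep_family by (intro Max_ge) auto

lemma basis_exists: "\<exists>B\<in>M. B \<subseteq> A \<and> card B = rank A"
proof -
  have "rank A \<in> card ` {I \<in> M. I \<subseteq> A}"
    unfolding rank_def using finite_indep_family empty_indep by (intro Max_in) auto
  then show ?thesis by auto
qed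

lemma indep_extends_to_basis:
  assumes "I \<in> M" "I \<subseteq> A"
  shows "\<exists>B\<in>M. I \<subseteq> B \<and> B \<subseteq> A \<and> card B = rank A"
proof -
  have "finite {B \<in> M. B \<subseteq> A}" using finite_indep_family by simp
  then obtain B where B: "B \<in> M" "I \<subseteq> B" "B \<subseteq> A"
    and maximal: "\<And>C. C \<in> M \<Longrightarrow> C \<subseteq> A \<Longrightarrow> B \<subseteq> C \<Longrightarrow> B = C"
    using finite_has_maximal2[of "{B \<in> M. B \<subseteq> A}" I] assms by auto
  have "\<not> card B < rank A"
  proof
    assume "card B < rank A"
    then obtain C where C: "C \<in> M" "C \<subseteq> A" "card B < card C" using basis_exists by metis
    then obtain e where "e \<in> C - B" "insert e B \<in> M" using augment B by blast
    then show False using maximal[of "insert e B"] B C by blast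
  qed
  then show ?thesis using B card_indep_le_rank[of B A] by (meson le_neq_implies_less)
qed

lemma rank_le_card:
  assumes "finite A"
  shows "rank A \<le> card A"
  using basis_exists[of A] card_mono[OF assms] by metis

lemma rank_mono:
  assumes "A \<subseteq> B"
  shows "rank A \<le> rank B"
  using basis_exists[of A] card_indep_le_rank[of _ B] assms by (metis order_trans)

lemma rank_indep: "I \<in> M \<Longrightarrow> rank I = card I"
  by (simp add: card_indep_le_rank finite_indep order_antisym rank_le_card)

lemma indep_iff_rank:
  assumes "A \<subseteq> E"
  shows "A \<in> M \<longleftrightarrow> rank A = card A"
  using basis_exists[of A] card_subset_eq[OF finite_subset_ground[OF assms]] rank_indep by metis

lemma rank_submodular: "rank (A \<union> B) + rank (A \<inter> B) \<le> rank A + rank B"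
proof -
  obtain I where I: "I \<in> M" "I \<subseteq> A \<inter> B" "card I = rank (A \<inter> B)" using basis_exists by blast
  then obtain J where J: "J \<in> M" "I \<subseteq> J" "J \<subseteq> A \<union> B" "card J = rank (A \<union> B)"
    using indep_extends_to_basis[of I "A \<union> B"] by blast
  have "finite J" using J finite_indep by blast
  moreover have "J \<inter> A \<union> J \<inter> B = J" using J by auto
  ultimately have "card J + card (J \<inter> A \<inter> (J \<inter> B)) = card (J \<inter> A) + card (J \<inter> B)"
    using card_Un_Int[of "J \<inter> A" "J \<inter> B"] by simp
  moreover have "card I \<le> card (J \<inter> A \<inter> (J \<inter> B))" using I J \<open>finite J\<close> by (intro card_mono) auto
  moreover have "card (J \<inter> A) \<le> rank A" "card (J \<inter> B) \<le> rank B"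
    using J indep_subset by (auto intro!: card_indep_le_rank)
  ultimately show ?thesis using I J by linarith
qed

lemma rank_Un_le: "finite B \<Longrightarrow> rank (A \<union> B) \<le> rank A + card B"
  using rank_submodular[of A B] rank_le_card[of B] by linarith

lemma rank_insert_le: "rank (insert e A) \<le> Suc (rank A)"
  using rank_Un_le[of "{e}" A] by simp

lemma rank_insert_ge: "rank A \<le> rank (insert e A)"
  by (rule rank_mono) auto

lemma rank_plus_nullity: "finite A \<Longrightarrow> rank A + nullity A = card A"
  using rank_le_card[of A] unfolding nullity_def by simp

lemma nullity_supermodular:
  assumes "finite A" "finite B"
  shows "nullity A + nullity B \<le> nullity (A \<union> B) + nullity (A \<inter> B)"
  using rank_submodular[of A B] card_Un_Int[OF assms] assms
    rank_plus_nullity[of A] rank_plus_nullity[of B]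
    rank_plus_nullity[of "A \<union> B"] rank_plus_nullity[of "A \<inter> B"] by simp

lemma nullity_mono:
  assumes "finite B" "A \<subseteq> B"
  shows "nullity A \<le> nullity B"
proof -
  have "rank B \<le> rank A + card (B - A)"
    using rank_Un_le[of "B - A" A] assms by (simp add: Un_absorb1)
  moreover have "card B = card A + card (B - A)"
    using assms by (metis card_Diff_subset card_mono finite_subset le_add_diff_inverse)
  ultimately show ?thesis unfolding nullity_def by simp
qed

lemma nullity_indep: "I \<in> M \<Longrightarrow> nullity I = 0"
  by (simp add: nullity_def rank_indep)

lemma closure_subset_ground: "closure A \<subseteq> E"
  by (auto simp: closure_def)

lemma finite_closure: "finite (closure A)"
  using closure_subset_ground finite_subset_ground by blast

lemma subset_closure: "A \<subseteq> E \<Longrightarrow> A \<subseteq> closure A"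
  by (auto simp: closure_def insert_absorb)

lemma insert_indep:
  assumes "I \<in> M" "e \<in> E" "e \<notin> closure I"
  shows "insert e I \<in> M"
proof -
  have I: "I \<subseteq> E" "finite I" "e \<notin> I"
    using assms indep_subset_ground finite_indep subset_closure by blast+
  have "rank (insert e I) = Suc (rank I)"
    using assms(2,3) rank_insert_le[of e I] rank_insert_ge[of I e] by (auto simp: closure_def)
  then show ?thesis using assms I by (simp add: indep_iff_rank rank_indep)
qed

lemma rank_Un_subset_closure:
  assumes "B \<subseteq> closure A"
  shows "rank (A \<union> B) = rank A"
proof (rule order_antisym)
  obtain I where I: "I \<in> M" "I \<subseteq> A" "card I = rank A" using basis_exists by blast
  obtain J where J: "J \<in> M" "I \<subseteq> J" "J \<subseteq> A \<union> B" "card J = rank (A \<union> B)"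
    using indep_extends_to_basis[of I "A \<union> B"] I by blast
  have "J \<subseteq> I"
  proof (rule ccontr)
    assume "\<not> J \<subseteq> I"
    then obtain e where e: "e \<in> J" "e \<notin> I" by blast
    have "insert e I \<in> M" using indep_subset[of J "insert e I"] J e by auto
    then have "Suc (rank A) \<le> rank (insert e A)"
      using card_indep_le_rank[of "insert e I" "insert e A"] I e finite_indep[of I] by auto
    moreover have "rank (insert e A) = rank A"
      using e J assms by (cases "e \<in> A") (auto simp: closure_def insert_absorb)
    ultimately show False by simp
  qed
  then show "rank (A \<union> B) \<le> rank A" using I J by auto
qed (simp add: rank_mono)

lemma rank_closure: "A \<subseteq> E \<Longrightarrow> rank (closure A) = rank A"
  using rank_Un_subset_closure[of "closure A" A] subset_closure by (simp add: Un_absorb1)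

lemma closure_mono:
  assumes "A \<subseteq> B"
  shows "closure A \<subseteq> closure B"
proof
  fix e assume e: "e \<in> closure A"
  have "rank (insert e A \<union> B) + rank (insert e A \<inter> B) \<le> rank (insert e A) + rank B"
    by (rule rank_submodular)
  moreover have "insert e A \<union> B = insert e B" using assms by auto
  moreover have "rank A \<le> rank (insert e A \<inter> B)" using assms by (intro rank_mono) auto
  ultimately have "rank (insert e B) \<le> rank B" using e by (simp add: closure_def)
  then show "e \<in> closure B" using e rank_insert_ge[of B e] by (auto simp: closure_def)
qed

lemma flat_subset_ground: "flat F \<Longrightarrow> F \<subseteq> E"
  by (simp add: flat_def)

lemma finite_flat: "flat F \<Longrightarrow> finite F"
  using flat_subset_ground finite_subset_ground by blast

lemma closure_subset_flat: "flat F \<Longrightarrow> A \<subseteq> F \<Longrightarrow> closure A \<subseteq> F"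
  using closure_mono[of A F] by (auto simp: flat_def)

lemma flat_closure:
  assumes "A \<subseteq> E"
  shows "flat (closure A)"
proof -
  have "e \<in> closure A" if "e \<in> closure (closure A)" for e
  proof -
    have "rank (insert e (closure A)) = rank A" "e \<in> E"
      using that rank_closure assms by (auto simp: closure_def)
    moreover have "rank (insert e A) \<le> rank (insert e (closure A))"
      using subset_closure[OF assms] by (intro rank_mono) auto
    ultimately show ?thesis using rank_insert_ge[of A e] by (auto simp: closure_def)
  qed
  then show ?thesis using closure_subset_ground by (auto simp: flat_def)
qed

lemma flat_Int: "flat F \<Longrightarrow> flat G \<Longrightarrow> flat (F \<inter> G)"
  using closure_mono[of "F \<inter> G" F] closure_mono[of "F \<inter> G" G] by (auto simp: flat_def)

lemma subset_closure_if_rank_le: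
  assumes "A \<subseteq> B" "B \<subseteq> E" "rank B \<le> rank A"
  shows "B \<subseteq> closure A"
proof
  fix e assume e: "e \<in> B"
  then have "rank (insert e A) \<le> rank B" using assms by (intro rank_mono) auto
  then show "e \<in> closure A" using e assms rank_insert_ge[of A e] by (auto simp: closure_def)
qed

lemma flat_eqI_rank: "flat F \<Longrightarrow> F \<subseteq> B \<Longrightarrow> B \<subseteq> E \<Longrightarrow> rank B \<le> rank F \<Longrightarrow> F = B"
  using subset_closure_if_rank_le[of F B] by (auto simp: flat_def)

lemma finite_circuit: "circuit E M C \<Longrightarrow> finite C"
  using finite_subset_ground by (simp add: circuit_def)

lemma circuit_nonempty: "circuit E M C \<Longrightarrow> C \<noteq> {}"
  using empty_indep by (auto simp: circuit_def)

lemma circuitI: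
  assumes "C \<subseteq> E" "C \<notin> M" "\<And>e. e \<in> C \<Longrightarrow> C - {e} \<in> M"
  shows "circuit E M C"
  unfolding circuit_def
proof (intro conjI allI impI)
  fix D assume "D \<subset> C"
  then obtain e where "e \<in> C" "D \<subseteq> C - {e}" by blast
  then show "D \<in> M" using assms(3) indep_subset by blast
qed (use assms in auto)

lemma rank_circuit_Diff:
  assumes "circuit E M C" "e \<in> C"
  shows "Suc (rank (C - {e})) = card C"
proof -
  have "C - {e} \<in> M" using assms by (auto simp: circuit_def)
  then show ?thesis
    using assms finite_circuit card_Suc_Diff1 by (metis rank_indep)
qed

lemma rank_circuit:
  assumes "circuit E M C"
  shows "Suc (rank C) = card C"
proof -
  obtain e where e: "e \<in> C" using circuit_nonempty[OF assms] by blast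
  have "rank C \<noteq> card C" using assms indep_iff_rank by (auto simp: circuit_def)
  moreover have "rank (C - {e}) \<le> rank C" by (rule rank_mono) auto
  ultimately show ?thesis
    using rank_circuit_Diff[OF assms e] rank_le_card[OF finite_circuit[OF assms]] by simp
qed

lemma nullity_circuit: "circuit E M C \<Longrightarrow> nullity C = 1"
  using rank_circuit[of C] by (simp add: nullity_def)

lemma circuit_in_closure:
  assumes "circuit E M C" "e \<in> C" "C - {e} \<subseteq> A"
  shows "e \<in> closure A"
proof -
  have "rank (insert e (C - {e})) = rank (C - {e})"
    using rank_circuit[OF assms(1)] rank_circuit_Diff[OF assms(1,2)] assms(2)
    by (simp add: insert_absorb)
  then have "e \<in> closure (C - {e})" using assms by (auto simp: closure_def circuit_def)
  then show ?thesis using closure_mono[OF assms(3)] by blast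
qed

lemma nullity_Un_circuit:
  assumes "circuit E M C" "\<not> C \<subseteq> A" "A \<subseteq> E"
  shows "Suc (nullity A) \<le> nullity (A \<union> C)"
proof -
  have "A \<inter> C \<subset> C" using assms(2) by blast
  then have "A \<inter> C \<in> M" using assms(1) by (auto simp: circuit_def)
  then have "nullity (A \<inter> C) = 0" by (rule nullity_indep)
  then show ?thesis
    using nullity_supermodular[of A C] nullity_circuit[OF assms(1)]
      finite_circuit[OF assms(1)] finite_subset_ground[OF assms(3)] by simp
qed

lemma matroid_on_image:
  assumes inj: "inj_on \<phi> E" and surj: "\<phi> ` E = E"
  shows "matroid_on E ((`) \<phi> ` M)"
  unfolding matroid_on_def
proof (intro conjI allI impI)
  show "(`) \<phi> ` M \<subseteq> Pow E" using indep_subset_ground surj by blast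
  show "{} \<in> (`) \<phi> ` M" using empty_indep by force
next
  fix I J assume "J \<in> (`) \<phi> ` M \<and> I \<subseteq> J"
  then obtain J' I' where "J' \<in> M" "I' \<subseteq> J'" "I = \<phi> ` I'" by (auto elim!: subset_imageE)
  then show "I \<in> (`) \<phi> ` M" using indep_subset by blast
next
  fix I J assume lt: "I \<in> (`) \<phi> ` M \<and> J \<in> (`) \<phi> ` M \<and> card I < card J"
  then obtain I' J' where M: "I' \<in> M" "J' \<in> M" and eq: "I = \<phi> ` I'" "J = \<phi> ` J'" by blast
  note sub = M[THEN indep_subset_ground]
  have "card I = card I'" "card J = card J'"
    unfolding eq using sub by (auto intro!: card_image inj_on_subset[OF inj])
  then obtain e where e: "e \<in> J' - I'" "insert e I' \<in> M" using augment[OF M] lt by auto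
  have "\<phi> e \<in> J - I" using inj_on_image_mem_iff[OF inj, of e I'] e sub eq by auto
  moreover have "insert (\<phi> e) I \<in> (`) \<phi> ` M" using e(2) eq(1) by (metis image_eqI image_insert)
  ultimately show "\<exists>e\<in>J - I. insert e I \<in> (`) \<phi> ` M" by blast
qed (rule finite_ground)

lemma circuit_image:
  assumes inj: "inj_on \<phi> E" and surj: "\<phi> ` E = E" and C: "circuit E M C"
  shows "circuit E ((`) \<phi> ` M) (\<phi> ` C)"
  unfolding circuit_def
proof (intro conjI allI impI)
  have CE: "C \<subseteq> E" using C by (simp add: circuit_def)
  then show "\<phi> ` C \<subseteq> E" using surj by blast
  show "\<phi> ` C \<notin> (`) \<phi> ` M"
  proof
    assume "\<phi> ` C \<in> (`) \<phi> ` M"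
    then obtain I where "I \<in> M" "\<phi> ` C = \<phi> ` I" by blast
    then have "C \<in> M"
      using inj_on_image_eq_iff[OF inj CE indep_subset_ground] by metis
    then show False using C by (simp add: circuit_def)
  qed
next
  fix D assume "D \<subset> \<phi> ` C"
  then obtain D' where "D' \<subset> C" "D = \<phi> ` D'" by (metis psubset_eq subset_imageE)
  then show "D \<in> (`) \<phi> ` M" using C by (simp add: circuit_def)
qed

lemma rank_image:
  assumes inj: "inj_on \<phi> E" and invariant: "(`) \<phi> ` M = M" and A: "A \<subseteq> E"
  shows "rank (\<phi> ` A) = rank A"
proof -
  have "{I \<in> M. I \<subseteq> \<phi> ` A} = (`) \<phi> ` {I \<in> M. I \<subseteq> A}"
  proof (intro equalityI subsetI)
    fix I assume "I \<in> {I \<in> M. I \<subseteq> \<phi> ` A}"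
    then have I: "I \<in> (`) \<phi> ` M" "I \<subseteq> \<phi> ` A" using invariant by auto
    then obtain I' where I': "I' \<in> M" "I = \<phi> ` I'" by blast
    then have "I' \<subseteq> A"
      using I(2) inj_on_image_mem_iff[OF inj _ A] indep_subset_ground[OF I'(1)] by blast
    then show "I \<in> (`) \<phi> ` {I \<in> M. I \<subseteq> A}" using I' by blast
  next
    fix I assume "I \<in> (`) \<phi> ` {I \<in> M. I \<subseteq> A}"
    then obtain I' where "I' \<in> M" "I' \<subseteq> A" "I = \<phi> ` I'" by blast
    then show "I \<in> {I \<in> M. I \<subseteq> \<phi> ` A}" using imageI[of I' M "(`) \<phi>"] invariant by auto
  qed
  moreover have "card (\<phi> ` I) = card I" if "I \<in> M" for I
    using indep_subset_ground[OF that] by (intro card_image inj_on_subset[OF inj])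
  then have "(\<lambda>I. card (\<phi> ` I)) ` {I \<in> M. I \<subseteq> A} = card ` {I \<in> M. I \<subseteq> A}"
    by (intro image_cong) auto
  ultimately show ?thesis by (simp add: rank_def image_image)
qed

lemma image_in_closure:
  assumes inj: "inj_on \<phi> E" and surj: "\<phi> ` E = E" and invariant: "(`) \<phi> ` M = M"
    and A: "A \<subseteq> E" and e: "e \<in> closure A"
  shows "\<phi> e \<in> closure (\<phi> ` A)"
proof -
  have "e \<in> E" using e by (simp add: closure_def)
  then have "rank (\<phi> ` insert e A) = rank (insert e A)" "rank (\<phi> ` A) = rank A"
    using A by (simp_all only: rank_image[OF inj invariant] insert_subset)
  then show ?thesis using e surj \<open>e \<in> E\<close> by (auto simp: closure_def)
qed

end

definition matroid_with_circuits :: "'e set \<Rightarrow> 'e set set \<Rightarrow> 'e set set \<Rightarrow> bool" where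
  "matroid_with_circuits E \<X> M \<longleftrightarrow> matroid_on E M \<and> (\<forall>X\<in>\<X>. circuit E M X)"

definition greatest_matroid_with_circuits :: "'e set \<Rightarrow> 'e set set \<Rightarrow> 'e set set \<Rightarrow> bool" where
  "greatest_matroid_with_circuits E \<X> M \<longleftrightarrow>
    matroid_with_circuits E \<X> M \<and> (\<forall>N. matroid_with_circuits E \<X> N \<longrightarrow> N \<subseteq> M)"

lemma unique_maximal_matroid_iff_greatest:
  assumes "finite E"
  shows "(\<exists>!M. matroid_with_circuits E \<X> M \<and>
      (\<forall>N. matroid_with_circuits E \<X> N \<and> M \<subseteq> N \<longrightarrow> N = M)) \<longleftrightarrow>
    (\<exists>M. greatest_matroid_with_circuits E \<X> M)"
proof -
  have "finite {M. matroid_with_circuits E \<X> M}"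
    by (rule finite_subset[of _ "Pow (Pow E)"])
      (use assms in \<open>auto simp: matroid_with_circuits_def matroid_on_def\<close>)
  from unique_maximal_iff_greatest[OF this] show ?thesis
    by (simp add: greatest_matroid_with_circuits_def Bex_def imp_conjL)
qed

lemma greatest_matroid_invariant:
  assumes M: "greatest_matroid_with_circuits E \<X> M"
    and inj: "inj_on \<phi> E" and surj: "\<phi> ` E = E" and \<X>: "\<X> \<subseteq> (`) \<phi> ` \<X>"
  shows "(`) \<phi> ` M = M"
proof -
  have "matroid_on E M" "\<forall>X\<in>\<X>. circuit E M X"
    using M by (auto simp: greatest_matroid_with_circuits_def matroid_with_circuits_def)
  then interpret matroid E M by unfold_locales
  have "circuit E ((`) \<phi> ` M) X" if "X \<in> \<X>" for X
    using circuit_image[OF inj surj] \<open>\<forall>X\<in>\<X>. circuit E M X\<close> that \<X> by blast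
  then have "(`) \<phi> ` M \<subseteq> M"
    using M matroid_on_image[OF inj surj]
    by (auto simp: greatest_matroid_with_circuits_def matroid_with_circuits_def)
  moreover have "inj_on ((`) \<phi>) M"
    using inj_on_image_eq_iff[OF inj] indep_subset_ground by (intro inj_onI) blast
  ultimately show ?thesis using endo_inj_surj finite_indep_family by blast
qed

section \<open>Matroids from rank functions\<close>

locale rank_function =
  fixes E :: "'e set" and f :: "'e set \<Rightarrow> nat"
  assumes finite_ground: "finite E"
    and empty: "f {} = 0"
    and insert_ge: "A \<subseteq> E \<Longrightarrow> x \<in> E \<Longrightarrow> f A \<le> f (insert x A)"
    and insert_le: "A \<subseteq> E \<Longrightarrow> x \<in> E \<Longrightarrow> f (insert x A) \<le> Suc (f A)"
    and insert_insert_eq: "A \<subseteq> E \<Longrightarrow> x \<in> E \<Longrightarrow> y \<in> E \<Longrightarrow>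
      f (insert x A) = f A \<Longrightarrow> f (insert y A) = f A \<Longrightarrow> f (insert x (insert y A)) = f A"
begin

definition indep_sets :: "'e set set" where
  "indep_sets = {I. I \<subseteq> E \<and> f I = card I}"

lemma Un_bounds:
  assumes "A \<subseteq> E" "B \<subseteq> E"
  shows "f A \<le> f (A \<union> B)" "f (A \<union> B) \<le> f A + card B"
proof -
  have "finite B" using assms finite_ground finite_subset by blast
  then have "f A \<le> f (A \<union> B) \<and> f (A \<union> B) \<le> f A + card B" using assms(2)
  proof (induction B)
    case (insert b B)
    then show ?case using insert_ge[of "A \<union> B" b] insert_le[of "A \<union> B" b] assms(1) by auto
  qed simp
  then show "f A \<le> f (A \<union> B)" "f (A \<union> B) \<le> f A + card B" by simp_all
qed

lemma mono: "A \<subseteq> B \<Longrightarrow> B \<subseteq> E \<Longrightarrow> f A \<le> f B"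
  using Un_bounds(1)[of A B] by (simp add: Un_absorb1)

lemma le_card: "A \<subseteq> E \<Longrightarrow> f A \<le> card A"
  using Un_bounds(2)[of "{}" A] empty by simp

lemma Un_eq:
  assumes A: "A \<subseteq> E" and B: "B \<subseteq> E" and eq: "\<And>e. e \<in> B \<Longrightarrow> f (insert e A) = f A"
  shows "f (A \<union> B) = f A"
proof -
  define Z where "Z = {e \<in> E. f (insert e A) = f A}"
  have "finite B" using B finite_ground finite_subset by blast
  moreover have "B \<subseteq> Z" using B eq by (auto simp: Z_def)
  ultimately have "f (A \<union> B) = f A \<and> (\<forall>e\<in>Z. f (insert e (A \<union> B)) = f A)"
  proof (induction B)
    case (insert b B)
    then have IH: "f (A \<union> B) = f A" "\<forall>e\<in>Z. f (insert e (A \<union> B)) = f A" by auto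
    have "A \<union> B \<subseteq> E" "b \<in> Z" using A insert.prems by (auto simp: Z_def)
    then have "f (insert e (insert b (A \<union> B))) = f A" if "e \<in> Z" for e
      using insert_insert_eq[of "A \<union> B" e b] IH that by (simp add: Z_def)
    then show ?case using IH(2) \<open>b \<in> Z\<close> by simp
  qed (simp add: Z_def)
  then show ?thesis ..
qed

lemma augment:
  assumes "I \<in> indep_sets" "J \<subseteq> E" "card I < f J"
  shows "\<exists>e\<in>J - I. insert e I \<in> indep_sets"
proof (rule ccontr)
  assume no: "\<not> ?thesis"
  have I: "I \<subseteq> E" "f I = card I" "finite I"
    using assms(1) finite_ground finite_subset by (auto simp: indep_sets_def)
  have "f (insert e I) = f I" if "e \<in> J" for e
  proof (cases "e \<in> I")
    case False
    then have "f (insert e I) \<noteq> card (insert e I)"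
      using no that I assms(2) by (auto simp: indep_sets_def)
    then show ?thesis
      using insert_ge[of I e] insert_le[of I e] I False that assms(2) by fastforce
  qed (simp add: insert_absorb)
  then have "f (I \<union> J) = f I" using Un_eq I assms(2) by blast
  moreover have "f J \<le> f (I \<union> J)" using mono[of J "I \<union> J"] I assms(2) by blast
  ultimately show False using assms(3) I by simp
qed

lemma indep_sets_subset:
  assumes "J \<in> indep_sets" "I \<subseteq> J"
  shows "I \<in> indep_sets"
proof -
  have J: "J \<subseteq> E" "f J = card J" "finite J"
    using assms(1) finite_ground finite_subset by (auto simp: indep_sets_def)
  have "I \<union> (J - I) = J" using assms(2) by blast
  then have "f J \<le> f I + card (J - I)" using Un_bounds(2)[of I "J - I"] J assms(2) by auto
  moreover have "card J = card I + card (J - I)"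
    using J assms(2) by (metis card_Diff_subset card_mono finite_subset le_add_diff_inverse)
  ultimately show ?thesis using le_card[of I] J assms(2) by (auto simp: indep_sets_def)
qed

lemma matroid_on_indep_sets: "matroid_on E indep_sets"
  unfolding matroid_on_def
proof (intro conjI allI impI)
  show "{} \<in> indep_sets" using empty by (simp add: indep_sets_def)
next
  fix I J assume "I \<in> indep_sets \<and> J \<in> indep_sets \<and> card I < card J"
  then show "\<exists>e\<in>J - I. insert e I \<in> indep_sets"
    using augment[of I J] by (auto simp: indep_sets_def)
next
  fix I J assume "J \<in> indep_sets \<and> I \<subseteq> J"
  then show "I \<in> indep_sets" using indep_sets_subset by blast
qed (use finite_ground in \<open>auto simp: indep_sets_def\<close>)

sublocale induced: matroid E indep_sets
  by unfold_locales (rule matroid_on_indep_sets)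

lemma rank_induced:
  assumes "A \<subseteq> E"
  shows "induced.rank A = f A"
proof (rule order_antisym)
  obtain B where B: "B \<in> indep_sets" "B \<subseteq> A" "card B = induced.rank A"
    using induced.basis_exists by blast
  then show "induced.rank A \<le> f A" using mono[OF B(2) assms] by (simp add: indep_sets_def)
  show "f A \<le> induced.rank A"
  proof (rule ccontr)
    assume "\<not> ?thesis"
    then obtain e where "e \<in> A - B" "insert e B \<in> indep_sets"
      using augment[OF B(1) assms] B(3) by auto
    then show False
      using induced.card_indep_le_rank[of "insert e B" A] B induced.finite_indep[of B] by auto
  qed
qed

end

text \<open>If \<open>s\<close> falls short of the nullity of the flat \<open>F\<close> itself, the matroid constructed here is
  an erection of the truncation of \<open>M\<close> to rank \<open>rank F\<close> in which \<open>F\<close> gains rank.\<close>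

locale erection = matroid E M for E :: "'e set" and M +
  fixes F :: "'e set" and s :: "'e set \<Rightarrow> nat"
  assumes flat_F: "flat F"
    and s_mono: "A \<subseteq> B \<Longrightarrow> B \<subseteq> F \<Longrightarrow> s A \<le> s B"
    and s_supermodular: "A \<subseteq> F \<Longrightarrow> B \<subseteq> F \<Longrightarrow> s A + s B \<le> s (A \<union> B) + s (A \<inter> B)"
    and s_le_nullity: "A \<subseteq> F \<Longrightarrow> s A \<le> nullity A"
    and s_flat: "flat G \<Longrightarrow> G \<subseteq> F \<Longrightarrow> rank G < rank F \<Longrightarrow> s G = nullity G"
begin

definition tight :: "'e set \<Rightarrow> bool" where
  "tight A \<longleftrightarrow> (\<exists>U. A \<subseteq> U \<and> U \<subseteq> F \<and> card U \<le> rank F + s U)"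

definition erected_rank :: "'e set \<Rightarrow> nat" where
  "erected_rank A = (if rank A < rank F then rank A
     else if rank A = rank F \<and> (A \<subseteq> F \<longrightarrow> tight A) then rank F else Suc (rank F))"

lemma tight_subset: "tight B \<Longrightarrow> A \<subseteq> B \<Longrightarrow> tight A"
  unfolding tight_def by (meson order_trans)

lemma tight_Un:
  assumes A: "tight A" "tight B" and C: "C \<subseteq> A" "C \<subseteq> B" "rank C = rank F"
  shows "tight (A \<union> B)"
proof -
  obtain U V where U: "A \<subseteq> U" "U \<subseteq> F" "card U \<le> rank F + s U"
    and V: "B \<subseteq> V" "V \<subseteq> F" "card V \<le> rank F + s V"
    using A unfolding tight_def by blast
  have fin: "finite U" "finite V" using U V finite_flat[OF flat_F] finite_subset by blast+
  have "C \<subseteq> U \<inter> V" "U \<inter> V \<subseteq> F" using U V C by blast+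
  then have "rank (U \<inter> V) = rank F"
    using rank_mono[of C "U \<inter> V"] rank_mono[of "U \<inter> V" F] C(3) by simp
  then have "rank F + s (U \<inter> V) \<le> card (U \<inter> V)"
    using s_le_nullity[OF \<open>U \<inter> V \<subseteq> F\<close>] rank_plus_nullity[of "U \<inter> V"] fin by simp
  then have "card (U \<union> V) \<le> rank F + s (U \<union> V)"
    using s_supermodular[OF U(2) V(2)] card_Un_Int[OF fin] U(3) V(3) by linarith
  then show ?thesis unfolding tight_def using U V by (intro exI[of _ "U \<union> V"]) auto
qed

lemma tight_insert:
  assumes A: "insert x A \<subseteq> F" "rank A < rank F" "rank (insert x A) = rank F"
  shows "tight (insert x A)"
proof -
  have AE: "A \<subseteq> E" using A(1) flat_F flat_subset_ground by blast
  have fin: "finite (closure A)" by (rule finite_closure)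
  have sub: "insert x (closure A) \<subseteq> F" using closure_subset_flat[OF flat_F, of A] A(1) by simp
  then have "s (closure A) = nullity (closure A)"
    using s_flat[OF flat_closure[OF AE]] rank_closure[OF AE] A(2) by simp
  then have "card (closure A) = rank A + s (closure A)"
    using rank_plus_nullity[OF fin] rank_closure[OF AE] by simp
  moreover have "s (closure A) \<le> s (insert x (closure A))" using sub by (intro s_mono) auto
  moreover have "card (insert x (closure A)) \<le> Suc (card (closure A))"
    using fin by (simp add: card_insert_if)
  ultimately have "card (insert x (closure A)) \<le> rank F + s (insert x (closure A))"
    using A(2) by simp
  then show ?thesis
    unfolding tight_def using sub subset_closure[OF AE]
    by (intro exI[of _ "insert x (closure A)"]) auto
qed

lemma erected_rank_less_iff: "erected_rank A < rank F \<longleftrightarrow> rank A < rank F"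
  by (simp add: erected_rank_def)

lemma erected_rank_eq_iff:
  "erected_rank A = rank F \<longleftrightarrow> rank A = rank F \<and> (A \<subseteq> F \<longrightarrow> tight A)"
  by (simp add: erected_rank_def)

lemma erected_rank_le: "erected_rank A \<le> Suc (rank F)"
  by (simp add: erected_rank_def)

lemma erected_rank_eq_rank:
  "rank A \<le> rank F \<Longrightarrow> (rank A = rank F \<Longrightarrow> A \<subseteq> F \<Longrightarrow> tight A) \<Longrightarrow> erected_rank A = rank A"
  by (auto simp: erected_rank_def)

lemma erected_rank_insert_ge:
  assumes A: "A \<subseteq> E" "x \<in> E"
  shows "erected_rank A \<le> erected_rank (insert x A)"
proof -
  consider (below) "rank (insert x A) < rank F" | (level) "erected_rank (insert x A) = rank F"
    | (above) "erected_rank (insert x A) = Suc (rank F)"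
    using erected_rank_less_iff[of "insert x A"] erected_rank_le[of "insert x A"] by linarith
  then show ?thesis
  proof cases
    case below
    then show ?thesis using rank_insert_ge[of A x] by (simp add: erected_rank_def)
  next
    case level
    then have rank: "rank (insert x A) = rank F" and tight: "insert x A \<subseteq> F \<Longrightarrow> tight (insert x A)"
      by (simp_all add: erected_rank_eq_iff)
    have "tight A" if "A \<subseteq> F" "rank A = rank F"
    proof -
      have "x \<in> closure A" using A rank that by (simp add: closure_def)
      then have "insert x A \<subseteq> F" using closure_subset_flat[OF flat_F that(1)] that(1) by blast
      then show ?thesis using tight tight_subset by blast
    qed
    then have "erected_rank A = rank A"
      using rank_insert_ge[of A x] rank by (intro erected_rank_eq_rank) simp_all
    then show ?thesis using level rank rank_insert_ge[of A x] by simp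
  next
    case above
    then show ?thesis by (simp add: erected_rank_le)
  qed
qed

lemma erected_rank_insert_le:
  assumes A: "A \<subseteq> E" "x \<in> E"
  shows "erected_rank (insert x A) \<le> Suc (erected_rank A)"
proof (cases "rank A < rank F")
  case True
  have "erected_rank (insert x A) = rank (insert x A)"
    using True rank_insert_le[of x A] tight_insert[of x A] by (intro erected_rank_eq_rank) auto
  then show ?thesis using True rank_insert_le[of x A] by (simp add: erected_rank_def)
next
  case False
  then show ?thesis using erected_rank_less_iff[of A] erected_rank_le[of "insert x A"] by simp
qed

lemma erected_rank_insert_insert_eq:
  assumes A: "A \<subseteq> E" "x \<in> E" "y \<in> E"
    and x: "erected_rank (insert x A) = erected_rank A"
    and y: "erected_rank (insert y A) = erected_rank A"
  shows "erected_rank (insert x (insert y A)) = erected_rank A"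
proof -
  have rank_eq: "rank (insert x (insert y A)) = rank A"
    if "rank (insert x A) = rank A" "rank (insert y A) = rank A"
    using rank_Un_subset_closure[of "{x, y}" A] that A by (simp add: closure_def insert_commute)
  consider (below) "erected_rank A < rank F" | (level) "erected_rank A = rank F"
    | (above) "erected_rank A = Suc (rank F)"
    using erected_rank_le[of A] by linarith
  then show ?thesis
  proof cases
    case below
    then have "rank A < rank F" "rank (insert x A) < rank F" "rank (insert y A) < rank F"
      using x y by (simp_all flip: erected_rank_less_iff)
    then show ?thesis using rank_eq x y by (simp add: erected_rank_def)
  next
    case level
    then have "erected_rank (insert x A) = rank F" "erected_rank (insert y A) = rank F"
      using x y by simp_all
    with level have
      rank: "rank A = rank F" "rank (insert x A) = rank F" "rank (insert y A) = rank F"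
      and tight: "insert x A \<subseteq> F \<Longrightarrow> tight (insert x A)" "insert y A \<subseteq> F \<Longrightarrow> tight (insert y A)"
      by (simp_all add: erected_rank_eq_iff)
    have "tight (insert x (insert y A))" if "insert x (insert y A) \<subseteq> F"
      using tight_Un[of "insert x A" "insert y A" A] tight that rank(1)
      by (auto simp: insert_commute)
    then have "erected_rank (insert x (insert y A)) = rank F"
      using rank rank_eq by (simp add: erected_rank_eq_iff)
    then show ?thesis using level by simp
  next
    case above
    then have "Suc (rank F) \<le> erected_rank (insert x (insert y A))"
      using erected_rank_insert_ge[of "insert y A" x] A y by simp
    then show ?thesis using erected_rank_le[of "insert x (insert y A)"] above by simp
  qed
qed

sublocale erected: rank_function E erected_rank
proof
  have "tight {}" if "rank F = 0" using that unfolding tight_def by (intro exI[of _ "{}"]) simp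
  then show "erected_rank {} = 0"
    using rank_indep[OF empty_indep] by (simp add: erected_rank_def)
qed (simp_all only: finite_ground erected_rank_insert_ge erected_rank_insert_le
  erected_rank_insert_insert_eq)

lemma circuit_erected:
  assumes C: "circuit E M C" and card: "card C \<le> Suc (rank F)" and s: "C \<subseteq> F \<Longrightarrow> 0 < s C"
  shows "circuit E erected.indep_sets C"
proof (rule erected.induced.circuitI)
  have rank_C: "Suc (rank C) = card C" by (rule rank_circuit[OF C])
  have tight_C: "tight C" if "C \<subseteq> F"
    unfolding tight_def using that s card by (intro exI[of _ C]) auto
  show "C \<subseteq> E" using C by (simp add: circuit_def)
  have "erected_rank C = rank C" using rank_C card tight_C by (intro erected_rank_eq_rank) auto
  then show "C \<notin> erected.indep_sets" using rank_C by (simp add: erected.indep_sets_def)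
  fix e assume e: "e \<in> C"
  have "tight (C - {e})" if "C - {e} \<subseteq> F"
  proof -
    have "e \<in> F" using circuit_in_closure[OF C e that] flat_F by (auto simp: flat_def)
    then show ?thesis using that tight_C tight_subset[of C "C - {e}"] by blast
  qed
  then have "erected_rank (C - {e}) = rank (C - {e})"
    using rank_circuit_Diff[OF C e] card by (intro erected_rank_eq_rank) auto
  moreover have "Suc (card (C - {e})) = card C"
    using finite_circuit[OF C] e by (rule card_Suc_Diff1)
  ultimately show "C - {e} \<in> erected.indep_sets"
    using rank_circuit_Diff[OF C e] C by (auto simp: erected.indep_sets_def circuit_def)
qed

lemma erected_rank_F:
  assumes "s F < nullity F"
  shows "erected_rank F = Suc (rank F)"
proof -
  have "\<not> tight F"
  proof
    assume "tight F"
    then have "card F \<le> rank F + s F" unfolding tight_def by (metis subset_antisym)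
    then show False using assms rank_plus_nullity[OF finite_flat[OF flat_F]] by simp
  qed
  then show ?thesis by (simp add: erected_rank_def)
qed

end

section \<open>Uniform matroids and matroids of linear relations\<close>

lemma matroid_on_uniform:
  assumes "finite E"
  shows "matroid_on E {I. I \<subseteq> E \<and> card I \<le> k}" (is "matroid_on E ?U")
  unfolding matroid_on_def
proof (intro conjI allI impI)
  fix I J assume "J \<in> ?U \<and> I \<subseteq> J"
  then show "I \<in> ?U" using card_mono[of J I] assms finite_subset[of J E] by auto
next
  fix I J assume IJ: "I \<in> ?U \<and> J \<in> ?U \<and> card I < card J"
  then have "finite I" using assms finite_subset by blast
  then obtain e where "e \<in> J - I" using IJ by (metis Diff_eq_empty_iff card_mono ex_in_conv leD)
  then show "\<exists>e\<in>J - I. insert e I \<in> ?U" using IJ \<open>finite I\<close> by auto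
qed (use assms in auto)

lemma circuit_uniform:
  assumes "finite E" "C \<subseteq> E" "card C = Suc k"
  shows "circuit E {I. I \<subseteq> E \<and> card I \<le> k} C"
proof -
  have "card D < card C" if "D \<subset> C" for D
    using that assms(1,2) by (meson finite_subset psubset_card_mono)
  then show ?thesis using assms(2,3) by (auto simp: circuit_def less_Suc_eq_le)
qed

lemma back_substitution:
  fixes c :: "'a \<Rightarrow> 'b \<Rightarrow> 'f::field"
  assumes B: "finite B" "p \<notin> B" and pivot: "c a p \<noteq> 0"
    and reduced: "\<And>a'. a' \<in> A \<Longrightarrow> (\<Sum>b\<in>B. (c a' b - c a' p / c a p * c a b) * x b) = 0"
  defines "y \<equiv> x(p := - (\<Sum>b\<in>B. c a b * x b) / c a p)"
  shows "\<forall>a'\<in>insert a A. (\<Sum>b\<in>insert p B. c a' b * y b) = 0"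
proof -
  have "(\<Sum>b\<in>B. c a' b * y b) = (\<Sum>b\<in>B. c a' b * x b)" for a'
    using B(2) by (intro sum.cong) (auto simp: y_def)
  then have split: "(\<Sum>b\<in>insert p B. c a' b * y b) = c a' p * y p + (\<Sum>b\<in>B. c a' b * x b)" for a'
    using B by simp
  have "(\<Sum>b\<in>insert p B. c a b * y b) = 0" unfolding split using pivot by (simp add: y_def)
  moreover have "(\<Sum>b\<in>insert p B. c a' b * y b) = 0" if "a' \<in> A" for a'
  proof -
    have "(\<Sum>b\<in>B. c a' b * x b) - c a' p / c a p * (\<Sum>b\<in>B. c a b * x b) = 0"
      using reduced[OF that]
      by (simp add: left_diff_distrib sum_subtractf sum_distrib_left mult.assoc)
    then show ?thesis unfolding split by (simp add: y_def)
  qed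
  ultimately show ?thesis by blast
qed

lemma underdetermined_system_solvable:
  fixes c :: "'a \<Rightarrow> 'b \<Rightarrow> 'f::field"
  assumes "finite A" "finite B" "card A < card B"
  shows "\<exists>x. (\<exists>b\<in>B. x b \<noteq> 0) \<and> (\<forall>a\<in>A. (\<Sum>b\<in>B. c a b * x b) = 0)"
  using assms
proof (induction A arbitrary: B c)
  case empty
  then have "B \<noteq> {}" by auto
  then show ?case by (intro exI[of _ "\<lambda>_. 1"]) auto
next
  case (insert a A)
  show ?case
  proof (cases "\<forall>b\<in>B. c a b = 0")
    case True
    obtain x where "\<exists>b\<in>B. x b \<noteq> 0" "\<forall>a\<in>A. (\<Sum>b\<in>B. c a b * x b) = 0"
      using insert.IH[of B c] insert.prems insert.hyps by auto
    then show ?thesis using True by (intro exI[of _ x]) simp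
  next
    case False
    then obtain p where p: "p \<in> B" "c a p \<noteq> 0" by blast
    define B' where "B' = B - {p}"
    have B': "finite B'" "p \<notin> B'" "insert p B' = B" "card A < card B'"
      using insert.prems insert.hyps p by (auto simp: B'_def)
    obtain x where x: "\<exists>b\<in>B'. x b \<noteq> 0"
      and reduced: "\<forall>a'\<in>A. (\<Sum>b\<in>B'. (c a' b - c a' p / c a p * c a b) * x b) = 0"
      using insert.IH[OF B'(1,4), of "\<lambda>a' b. c a' b - c a' p / c a p * c a b"] by blast
    let ?y = "x(p := - (\<Sum>b\<in>B'. c a b * x b) / c a p)"
    have "\<exists>b\<in>B. ?y b \<noteq> 0" using x B'(2,3) by auto
    moreover have "\<forall>a'\<in>insert a A. (\<Sum>b\<in>B. c a' b * ?y b) = 0"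
      using back_substitution[where c = c and x = x, OF B'(1,2) p(2)] reduced
      unfolding B'(3) by blast
    ultimately show ?thesis by blast
  qed
qed

definition relation_free :: "('e \<Rightarrow> 'f::zero) set \<Rightarrow> 'e set \<Rightarrow> bool" where
  "relation_free C I \<longleftrightarrow> (\<forall>w\<in>C. (\<forall>e. e \<notin> I \<longrightarrow> w e = 0) \<longrightarrow> (\<forall>e. w e = 0))"

lemma relation_through_new_element:
  assumes "relation_free C I" "\<not> relation_free C (insert e I)"
  shows "\<exists>w\<in>C. (\<forall>f. f \<notin> insert e I \<longrightarrow> w f = 0) \<and> w e \<noteq> 0"
proof -
  obtain w where w: "w \<in> C" "\<forall>f. f \<notin> insert e I \<longrightarrow> w f = 0" "\<exists>f. w f \<noteq> 0"
    using assms(2) unfolding relation_free_def by blast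
  then have "w e \<noteq> 0" using assms(1) unfolding relation_free_def by (metis insert_iff)
  with w show ?thesis by blast
qed

lemma relation_free_augment:
  fixes C :: "('e \<Rightarrow> 'f::field) set"
  assumes zero: "(\<lambda>e. 0) \<in> C"
    and add: "\<And>v w. v \<in> C \<Longrightarrow> w \<in> C \<Longrightarrow> (\<lambda>e. v e + w e) \<in> C"
    and scale: "\<And>a w. w \<in> C \<Longrightarrow> (\<lambda>e. a * w e) \<in> C"
    and I: "finite I" "relation_free C I" and J: "finite J" "relation_free C J"
    and less: "card I < card J"
  shows "\<exists>e\<in>J - I. relation_free C (insert e I)"
proof (rule ccontr)
  assume no: "\<not> ?thesis"
  have "\<exists>w\<in>C. (\<forall>f. f \<notin> insert e I \<longrightarrow> w f = 0) \<and> w e \<noteq> 0" if "e \<in> J - I" for e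
    using relation_through_new_element[OF I(2)] no that by blast
  then obtain w where w: "\<And>e. e \<in> J - I \<Longrightarrow> w e \<in> C"
    "\<And>e f. e \<in> J - I \<Longrightarrow> f \<notin> insert e I \<Longrightarrow> w e f = 0" "\<And>e. e \<in> J - I \<Longrightarrow> w e e \<noteq> 0"
    by metis
  have "card (I - J) < card (J - I)" by (rule card_less_sym_Diff[OF I(1) J(1) less])
  then obtain x where x: "\<exists>e\<in>J - I. x e \<noteq> 0" "\<forall>f\<in>I - J. (\<Sum>e\<in>J - I. w e f * x e) = 0"
    using underdetermined_system_solvable[of "I - J" "J - I" "\<lambda>f e. w e f"] I J by auto
  define v where "v f = (\<Sum>e\<in>J - I. x e * w e f)" for f
  have "(\<lambda>f. \<Sum>e\<in>D. x e * w e f) \<in> C" if "finite D" "D \<subseteq> J - I" for D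
    using that by (induction D) (auto intro!: zero add scale w(1))
  then have "v \<in> C" unfolding v_def using J(1) by simp
  moreover have "v f = 0" if "f \<notin> J" for f
  proof (cases "f \<in> I")
    case True
    then show ?thesis using x(2) that by (auto simp: v_def mult.commute)
  next
    case False
    then show ?thesis using that by (auto simp: v_def intro!: sum.neutral w(2))
  qed
  ultimately have v_zero: "v f = 0" for f using J(2) unfolding relation_free_def by blast
  obtain e where e: "e \<in> J - I" "x e \<noteq> 0" using x(1) by blast
  have "v e = (\<Sum>f\<in>J - I. if f = e then x e * w e e else 0)"
    unfolding v_def using e w(2) by (intro sum.cong) auto
  also have "\<dots> = x e * w e e" using e J(1) by simp
  finally show False using v_zero e w(3) by simp
qed

lemma matroid_on_relation_free:
  fixes C :: "('e \<Rightarrow> 'f::field) set"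
  assumes E: "finite E" and zero: "(\<lambda>e. 0) \<in> C"
    and add: "\<And>v w. v \<in> C \<Longrightarrow> w \<in> C \<Longrightarrow> (\<lambda>e. v e + w e) \<in> C"
    and scale: "\<And>a w. w \<in> C \<Longrightarrow> (\<lambda>e. a * w e) \<in> C"
  shows "matroid_on E {I. I \<subseteq> E \<and> relation_free C I}" (is "matroid_on E ?N")
  unfolding matroid_on_def
proof (intro conjI allI impI)
  fix I J assume IJ: "I \<in> ?N \<and> J \<in> ?N \<and> card I < card J"
  then have "finite I" "finite J" using E finite_subset by blast+
  then show "\<exists>e\<in>J - I. insert e I \<in> ?N"
    using relation_free_augment[OF zero add scale, of I J] IJ by blast
next
  fix I J assume "J \<in> ?N \<and> I \<subseteq> J"
  then show "I \<in> ?N" unfolding relation_free_def by blast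
qed (use E in \<open>auto simp: relation_free_def\<close>)

section \<open>Proper sequences and submodularity\<close>

fun proper_over :: "'e set \<Rightarrow> 'e set list \<Rightarrow> bool" where
  "proper_over V [] \<longleftrightarrow> True"
| "proper_over V (X # S) \<longleftrightarrow> \<not> X \<subseteq> V \<and> proper_over (V \<union> X) S"

lemma proper_over_append: "proper_over V (S @ T) \<longleftrightarrow> proper_over V S \<and> proper_over (V \<union> \<Union>(set S)) T"
  by (induction S arbitrary: V) (auto simp: Un_assoc)

lemma proper_over_antimono: "V \<subseteq> W \<Longrightarrow> proper_over W S \<Longrightarrow> proper_over V S"
proof (induction S arbitrary: V W)
  case (Cons X S)
  have "V \<union> X \<subseteq> W \<union> X" using Cons.prems(1) by blast
  then show ?case using Cons.IH[of "V \<union> X" "W \<union> X"] Cons.prems by auto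
qed simp

lemma proper_over_iff_nth:
  "proper_over V S \<longleftrightarrow> (\<forall>i<length S. \<not> S ! i \<subseteq> V \<union> (\<Union>j<i. S ! j))"
proof (induction S arbitrary: V)
  case (Cons X S)
  have "(\<Union>j<Suc i. (X # S) ! j) = X \<union> (\<Union>j<i. S ! j)" for i
    by (simp add: lessThan_Suc_eq_insert_0)
  then show ?case using Cons.IH[of "V \<union> X"] by (simp add: All_less_Suc2 Un_assoc)
qed simp

lemma proper_seq_iff_proper_over:
  assumes "{} \<notin> \<X>"
  shows "proper_seq \<X> S \<longleftrightarrow> set S \<subseteq> \<X> \<and> proper_over {} S"
proof -
  have "S ! 0 \<noteq> {}" if "set S \<subseteq> \<X>" "0 < length S"
    using nth_mem[OF that(2)] that(1) assms by auto
  then have "(\<forall>i. 1 \<le> i \<and> i < length S \<longrightarrow> \<not> S ! i \<subseteq> (\<Union>j<i. S ! j)) \<longleftrightarrow>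
      (\<forall>i<length S. \<not> S ! i \<subseteq> (\<Union>j<i. S ! j))" if "set S \<subseteq> \<X>"
    using that by (metis One_nat_def Suc_leI UN_empty lessThan_0 not_gr_zero subset_empty)
  then show ?thesis unfolding proper_seq_def proper_over_iff_nth by auto
qed

lemma (in matroid) length_proper_over_le_nullity:
  assumes "\<And>X. X \<in> set S \<Longrightarrow> circuit E M X" "A \<subseteq> E" "proper_over A S"
  shows "nullity A + length S \<le> nullity (A \<union> \<Union>(set S))"
  using assms
proof (induction S arbitrary: A)
  case (Cons X S)
  have X: "circuit E M X" "\<not> X \<subseteq> A" using Cons.prems by auto
  have "nullity (A \<union> X) + length S \<le> nullity (A \<union> X \<union> \<Union>(set S))"
    using Cons.prems X(1) by (intro Cons.IH) (auto simp: circuit_def)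
  then show ?case using nullity_Un_circuit[OF X Cons.prems(2)] by (simp add: Un_assoc)
qed simp

context
  fixes E :: "'e set" and \<X> N :: "'e set set"
  assumes N: "matroid_with_circuits E \<X> N"
begin

interpretation matroid E N
  using N by unfold_locales (simp add: matroid_with_circuits_def)

lemma circuit_member: "X \<in> \<X> \<Longrightarrow> circuit E N X"
  using N by (simp add: matroid_with_circuits_def)

lemma proper_seq_iff: "proper_seq \<X> S \<longleftrightarrow> set S \<subseteq> \<X> \<and> proper_over {} S"
  using circuit_member circuit_nonempty by (intro proper_seq_iff_proper_over) blast

lemma Union_proper_seq_subset: "proper_seq \<X> S \<Longrightarrow> \<Union>(set S) \<subseteq> E"
  using circuit_member by (auto simp: proper_seq_def circuit_def)

lemma rank_le_val_seq:
  assumes S: "proper_seq \<X> S" and A: "A \<subseteq> E"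
  shows "int (rank A) \<le> val_seq A S"
proof -
  have fin: "finite (A \<union> \<Union>(set S))"
    using finite_subset_ground A Union_proper_seq_subset[OF S] by blast
  have "set S \<subseteq> \<X>" "proper_over {} S" using S by (simp_all add: proper_seq_iff)
  then have "nullity {} + length S \<le> nullity ({} \<union> \<Union>(set S))"
    using circuit_member by (intro length_proper_over_le_nullity) auto
  then have "length S \<le> nullity (\<Union>(set S))" by simp
  also have "\<dots> \<le> nullity (A \<union> \<Union>(set S))" using fin by (intro nullity_mono) auto
  finally show ?thesis
    using rank_plus_nullity[OF fin] rank_mono[of A "A \<union> \<Union>(set S)"] unfolding val_seq_def by simp
qed

lemma finite_vals:
  assumes A: "A \<subseteq> E"
  shows "finite {val_seq A S | S. proper_seq \<X> S}"
proof (rule finite_subset)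
  show "{val_seq A S | S. proper_seq \<X> S} \<subseteq> {0..int (card E)}"
  proof
    fix x assume "x \<in> {val_seq A S | S. proper_seq \<X> S}"
    then obtain S where S: "x = val_seq A S" "proper_seq \<X> S" by blast
    have "card (A \<union> \<Union>(set S)) \<le> card E"
      using A Union_proper_seq_subset[OF S(2)] finite_ground by (intro card_mono) auto
    then show "x \<in> {0..int (card E)}"
      using rank_le_val_seq[OF S(2) A] S(1) unfolding val_seq_def by simp
  qed
qed simp

lemma val_min_le_val_seq: "A \<subseteq> E \<Longrightarrow> proper_seq \<X> S \<Longrightarrow> val_min \<X> A \<le> val_seq A S"
  unfolding val_min_def using finite_vals by (intro Min_le) auto

lemma proper_seq_Nil: "proper_seq \<X> []"
  by (simp add: proper_seq_def)

lemma val_min_attained: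
  assumes "A \<subseteq> E"
  shows "\<exists>S. proper_seq \<X> S \<and> val_min \<X> A = val_seq A S"
proof -
  have "val_min \<X> A \<in> {val_seq A S | S. proper_seq \<X> S}"
    unfolding val_min_def using finite_vals[OF assms] proper_seq_Nil by (intro Min_in) auto
  then show ?thesis by blast
qed

lemma rank_le_val_min:
  assumes "A \<subseteq> E"
  shows "int (rank A) \<le> val_min \<X> A"
  using val_min_attained[OF assms] rank_le_val_seq[OF _ assms] by auto

lemma val_min_nonneg: "A \<subseteq> E \<Longrightarrow> 0 \<le> val_min \<X> A"
  using rank_le_val_min[of A] by simp

lemma val_min_le_card: "A \<subseteq> E \<Longrightarrow> val_min \<X> A \<le> int (card A)"
  using val_min_le_val_seq[OF _ proper_seq_Nil] by (simp add: val_seq_def)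

lemma val_min_indep:
  assumes "I \<in> N"
  shows "val_min \<X> I = int (card I)"
proof (rule order_antisym)
  note IE = indep_subset_ground[OF assms]
  show "val_min \<X> I \<le> int (card I)" by (rule val_min_le_card[OF IE])
  show "int (card I) \<le> val_min \<X> I" using rank_le_val_min[OF IE] rank_indep[OF assms] by simp
qed

lemma val_min_insert:
  assumes A: "A \<subseteq> E" "x \<in> E"
  shows "val_min \<X> A \<le> val_min \<X> (insert x A)" "val_min \<X> (insert x A) \<le> val_min \<X> A + 1"
proof -
  have xA: "insert x A \<subseteq> E" using A by simp
  have val_seq: "val_seq A S \<le> val_seq (insert x A) S" "val_seq (insert x A) S \<le> val_seq A S + 1"
    if "proper_seq \<X> S" for S
  proof -
    have "finite (A \<union> \<Union>(set S))"
      using finite_subset_ground A(1) Union_proper_seq_subset[OF that] by blast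
    then show "val_seq A S \<le> val_seq (insert x A) S" "val_seq (insert x A) S \<le> val_seq A S + 1"
      by (simp_all add: val_seq_def card_insert_if)
  qed
  show "val_min \<X> A \<le> val_min \<X> (insert x A)"
    using val_min_attained[OF xA] val_min_le_val_seq[OF A(1)] val_seq(1) by (metis order_trans)
  obtain S where "proper_seq \<X> S" "val_min \<X> A = val_seq A S"
    using val_min_attained[OF A(1)] by blast
  then show "val_min \<X> (insert x A) \<le> val_min \<X> A + 1"
    using val_min_le_val_seq[OF xA] val_seq(2) by (metis order_trans)
qed

lemma val_min_insert_insert:
  assumes sub: "submodular_on E (val_min \<X>)" and A: "A \<subseteq> E" "x \<in> E" "y \<in> E"
    and eq: "val_min \<X> (insert x A) = val_min \<X> A" "val_min \<X> (insert y A) = val_min \<X> A"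
  shows "val_min \<X> (insert x (insert y A)) = val_min \<X> A"
proof (cases "x = y")
  case False
  then have "insert x A \<union> insert y A = insert x (insert y A)" "insert x A \<inter> insert y A = A" by auto
  moreover have "insert x A \<subseteq> E" "insert y A \<subseteq> E" using A by simp_all
  then have "val_min \<X> (insert x A \<union> insert y A) + val_min \<X> (insert x A \<inter> insert y A)
      \<le> val_min \<X> (insert x A) + val_min \<X> (insert y A)"
    using sub unfolding submodular_on_def by blast
  moreover have "val_min \<X> A \<le> val_min \<X> (insert x (insert y A))"
    using val_min_insert(1)[of "insert y A" x] eq A by simp
  ultimately show ?thesis using eq by simp
qed (simp add: eq)

lemma rank_function_val_min:
  assumes sub: "submodular_on E (val_min \<X>)"
  shows "rank_function E (\<lambda>A. nat (val_min \<X> A))"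
proof
  show "nat (val_min \<X> {}) = 0" using val_min_le_card[of "{}"] by simp
  show "nat (val_min \<X> A) \<le> nat (val_min \<X> (insert x A))" if "A \<subseteq> E" "x \<in> E" for A x
    using val_min_insert(1)[OF that] by (rule nat_mono)
  show "nat (val_min \<X> (insert x A)) \<le> Suc (nat (val_min \<X> A))" if "A \<subseteq> E" "x \<in> E" for A x
    using val_min_insert(2)[OF that] val_min_nonneg[OF that(1)] by simp
  show "nat (val_min \<X> (insert x (insert y A))) = nat (val_min \<X> A)"
    if "A \<subseteq> E" "x \<in> E" "y \<in> E" "nat (val_min \<X> (insert x A)) = nat (val_min \<X> A)"
      "nat (val_min \<X> (insert y A)) = nat (val_min \<X> A)" for A x y
  proof -
    have "insert x A \<subseteq> E" "insert y A \<subseteq> E" using that(1-3) by simp_all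
    then have "val_min \<X> (insert x A) = val_min \<X> A" "val_min \<X> (insert y A) = val_min \<X> A"
      using that(4,5) val_min_nonneg that(1) by (simp_all add: eq_nat_nat_iff)
    then show ?thesis using val_min_insert_insert[OF sub that(1-3)] by simp
  qed
qed (rule finite_ground)

end

lemma greatest_matroid_if_submodular:
  assumes N: "matroid_with_circuits E \<X> N" and sub: "submodular_on E (val_min \<X>)"
  shows "\<exists>M. greatest_matroid_with_circuits E \<X> M"
proof -
  interpret val: rank_function E "\<lambda>A. nat (val_min \<X> A)" by (rule rank_function_val_min[OF N sub])
  have indep: "I \<in> val.indep_sets" if K: "matroid_with_circuits E \<X> K" "I \<in> K" for I K
  proof -
    have "I \<subseteq> E" using K by (auto simp: matroid_with_circuits_def matroid_on_def)
    then show ?thesis using val_min_indep[OF K] by (simp add: val.indep_sets_def)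
  qed
  have "circuit E val.indep_sets X" if X: "X \<in> \<X>" for X
  proof (rule val.induced.circuitI)
    have circuit: "circuit E N X" by (rule circuit_member[OF N X])
    then show XE: "X \<subseteq> E" by (simp add: circuit_def)
    interpret N: matroid E N using N by unfold_locales (simp add: matroid_with_circuits_def)
    have "0 < card X"
      using N.circuit_nonempty[OF circuit] N.finite_circuit[OF circuit] by (simp add: card_gt_0_iff)
    moreover have "val_min \<X> X \<le> val_seq X [X]"
      using X by (intro val_min_le_val_seq[OF N XE]) (simp add: proper_seq_def)
    ultimately show "X \<notin> val.indep_sets" by (auto simp: val.indep_sets_def val_seq_def)
    show "X - {e} \<in> val.indep_sets" if "e \<in> X" for e
      using circuit that by (intro indep[OF N]) (auto simp: circuit_def)
  qed
  then have "matroid_with_circuits E \<X> val.indep_sets"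
    using val.matroid_on_indep_sets by (simp add: matroid_with_circuits_def)
  moreover have "K \<subseteq> val.indep_sets" if "matroid_with_circuits E \<X> K" for K
    using indep[OF that] by (rule subsetI)
  ultimately show ?thesis by (metis greatest_matroid_with_circuits_def)
qed

section \<open>Edge sets of complete bipartite graphs\<close>

lemma finite_if_subset_lessThan: "A \<subseteq> {..<k :: nat} \<Longrightarrow> finite A"
  by (rule finite_subset) auto

lemma three_term_affine_relation:
  assumes A: "A \<subseteq> {..<k}" "card A = 3"
  obtains \<alpha> :: "nat \<Rightarrow> real" where "\<And>i. i \<notin> A \<Longrightarrow> \<alpha> i = 0" "\<And>i. i \<in> A \<Longrightarrow> \<alpha> i \<noteq> 0"
    "(\<Sum>i<k. \<alpha> i) = 0" "(\<Sum>i<k. real i * \<alpha> i) = 0"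
proof -
  obtain a b c where abc: "A = {a, b, c}" "a \<noteq> b" "b \<noteq> c" "a \<noteq> c"
    using A(2) by (auto simp: card_3_iff)
  define \<alpha> :: "nat \<Rightarrow> real" where
    "\<alpha> = (\<lambda>_. 0)(a := real b - real c, b := real c - real a, c := real a - real b)"
  have zero: "\<alpha> i = 0" if "i \<notin> A" for i using that abc by (auto simp: \<alpha>_def)
  have sum: "(\<Sum>i<k. f i * \<alpha> i) = f a * \<alpha> a + f b * \<alpha> b + f c * \<alpha> c" for f
  proof -
    have "(\<Sum>i<k. f i * \<alpha> i) = (\<Sum>i\<in>A. f i * \<alpha> i)"
      using A(1) zero by (intro sum.mono_neutral_right) auto
    then show ?thesis using abc by simp
  qed
  have \<alpha>: "\<alpha> a = real b - real c" "\<alpha> b = real c - real a" "\<alpha> c = real a - real b"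
    using abc by (simp_all add: \<alpha>_def)
  show ?thesis
  proof
    show "\<alpha> i \<noteq> 0" if "i \<in> A" for i using that abc \<alpha> by auto
    show "(\<Sum>i<k. \<alpha> i) = 0" using sum[of "\<lambda>_. 1"] \<alpha> by simp
    show "(\<Sum>i<k. real i * \<alpha> i) = 0" unfolding sum \<alpha> by (simp add: algebra_simps)
  qed (rule zero)
qed

lemma two_term_affine_relation_trivial:
  fixes \<alpha> :: "nat \<Rightarrow> real"
  assumes "a < k" "b < k" "a \<noteq> b" and zero: "\<And>i. i < k \<Longrightarrow> i \<notin> {a, b} \<Longrightarrow> \<alpha> i = 0"
    and sum: "(\<Sum>i<k. \<alpha> i) = 0" "(\<Sum>i<k. real i * \<alpha> i) = 0" and "i < k"
  shows "\<alpha> i = 0"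
proof -
  have "(\<Sum>i<k. f i * \<alpha> i) = f a * \<alpha> a + f b * \<alpha> b" for f
  proof -
    have "(\<Sum>i<k. f i * \<alpha> i) = (\<Sum>i\<in>{a, b}. f i * \<alpha> i)"
      using assms(1,2) zero by (intro sum.mono_neutral_right) auto
    then show ?thesis using assms(3) by simp
  qed
  from this[of "\<lambda>_. 1"] this[of real] have b: "\<alpha> b = - \<alpha> a" and "real a * \<alpha> a + real b * \<alpha> b = 0"
    using sum by (simp_all add: eq_neg_iff_add_eq_0 add.commute)
  then have "(real a - real b) * \<alpha> a = 0" by (simp add: algebra_simps)
  then have "\<alpha> a = 0" "\<alpha> b = 0" using assms(3) b by simp_all
  then show ?thesis using zero[OF \<open>i < k\<close>] assms(3) by auto
qed

locale edge_grid =
  fixes edge :: "nat \<Rightarrow> nat \<Rightarrow> 'e" and m n :: nat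
  assumes edge_eq_iff [simp]: "edge i j = edge i' j' \<longleftrightarrow> i = i' \<and> j = j'"
    and three_le_m: "3 \<le> m" and three_le_n: "3 \<le> n"
begin

definition K :: "nat set \<Rightarrow> nat set \<Rightarrow> 'e set" where
  "K A B = {edge i j | i j. i \<in> A \<and> j \<in> B}"

definition E :: "'e set" where
  "E = K {..<m} {..<n}"

definition K33s :: "'e set set" where
  "K33s = {K A B | A B. A \<subseteq> {..<m} \<and> B \<subseteq> {..<n} \<and> card A = 3 \<and> card B = 3}"

definition biclique :: "'e set \<Rightarrow> nat set \<Rightarrow> nat set \<Rightarrow> bool" where
  "biclique P A B \<longleftrightarrow> A \<subseteq> {..<m} \<and> B \<subseteq> {..<n} \<and> K A B \<subseteq> P"

definition coords :: "'e \<Rightarrow> nat \<times> nat" where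
  "coords = inv (case_prod edge)"

lemma coords_edge [simp]: "coords (edge i j) = (i, j)"
  using inv_f_f[of "case_prod edge" "(i, j)"] by (simp add: coords_def inj_def)

lemma edge_in_K [simp]: "edge i j \<in> K A B \<longleftrightarrow> i \<in> A \<and> j \<in> B"
  by (auto simp: K_def)

lemma K_edgeE:
  assumes "e \<in> K A B"
  obtains i j where "e = edge i j" "i \<in> A" "j \<in> B"
  using assms that by (auto simp: K_def)

lemma K_subsetI: "(\<And>i j. i \<in> A \<Longrightarrow> j \<in> B \<Longrightarrow> edge i j \<in> P) \<Longrightarrow> K A B \<subseteq> P"
  by (auto simp: K_def)

lemma K_subsetD: "K A B \<subseteq> P \<Longrightarrow> i \<in> A \<Longrightarrow> j \<in> B \<Longrightarrow> edge i j \<in> P"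
  by (auto simp: K_def)

lemma K_mono: "A \<subseteq> C \<Longrightarrow> B \<subseteq> D \<Longrightarrow> K A B \<subseteq> K C D"
  by (auto simp: K_def)

lemma K_Int: "K A B \<inter> K C D = K (A \<inter> C) (B \<inter> D)"
  by (auto simp: K_def)

lemma K_empty [simp]: "K {} B = {}" "K A {} = {}"
  by (simp_all add: K_def)

lemma K_eq_image: "K A B = case_prod edge ` (A \<times> B)"
  by (auto simp: K_def)

lemma finite_K: "finite A \<Longrightarrow> finite B \<Longrightarrow> finite (K A B)"
  by (simp add: K_eq_image)

lemma card_K: "card (K A B) = card A * card B"
  unfolding K_eq_image by (subst card_image) (auto simp: inj_on_def card_cartesian_product)

lemma K_subset_K_D:
  assumes "K A B \<subseteq> K C D" "A \<noteq> {}" "B \<noteq> {}"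
  shows "A \<subseteq> C" "B \<subseteq> D"
proof -
  have "i \<in> C \<and> j \<in> D" if "i \<in> A" "j \<in> B" for i j
    using K_subsetD[OF assms(1) that] by simp
  then show "A \<subseteq> C" "B \<subseteq> D" using assms(2,3) by blast+
qed

lemma edge_in_E [simp]: "edge i j \<in> E \<longleftrightarrow> i < m \<and> j < n"
  by (simp add: E_def)

lemma E_edgeE:
  assumes "e \<in> E"
  obtains i j where "e = edge i j" "i < m" "j < n"
  using assms that by (auto simp: E_def elim: K_edgeE)

lemma finite_E: "finite E"
  by (simp add: E_def finite_K)

lemma K_subset_E: "A \<subseteq> {..<m} \<Longrightarrow> B \<subseteq> {..<n} \<Longrightarrow> K A B \<subseteq> E"
  unfolding E_def by (rule K_mono)

lemma bicliqueD:
  assumes "biclique P A B"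
  shows "A \<subseteq> {..<m}" "B \<subseteq> {..<n}" "K A B \<subseteq> P" "finite A" "finite B"
  using assms by (auto simp: biclique_def intro: finite_subset[OF _ finite_lessThan])

lemma biclique_edge: "biclique P A B \<Longrightarrow> i \<in> A \<Longrightarrow> j \<in> B \<Longrightarrow> edge i j \<in> P"
  using K_subsetD by (auto simp: biclique_def)

lemma biclique_mono: "biclique P A B \<Longrightarrow> P \<subseteq> Q \<Longrightarrow> biclique Q A B"
  by (auto simp: biclique_def)

lemma biclique_subset: "biclique P C D \<Longrightarrow> A \<subseteq> C \<Longrightarrow> B \<subseteq> D \<Longrightarrow> biclique P A B"
  unfolding biclique_def by (meson K_mono order_trans)

lemma K33sI: "A \<subseteq> {..<m} \<Longrightarrow> B \<subseteq> {..<n} \<Longrightarrow> card A = 3 \<Longrightarrow> card B = 3 \<Longrightarrow> K A B \<in> K33s"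
  unfolding K33s_def by blast

lemma K33sE:
  assumes "X \<in> K33s"
  obtains A B where "X = K A B" "A \<subseteq> {..<m}" "B \<subseteq> {..<n}" "card A = 3" "card B = 3"
  using assms that unfolding K33s_def by blast

lemma K33_subset_E: "X \<in> K33s \<Longrightarrow> X \<subseteq> E"
  using K_subset_E by (auto elim!: K33sE)

lemma card_K33: "X \<in> K33s \<Longrightarrow> card X = 9"
  by (auto elim!: K33sE simp: card_K)

lemma uniform_with_K33_circuits: "matroid_with_circuits E K33s {I. I \<subseteq> E \<and> card I \<le> 8}"
  unfolding matroid_with_circuits_def
  using matroid_on_uniform[OF finite_E] circuit_uniform[OF finite_E] K33_subset_E card_K33
  by simp

text \<open>The supports of these relations are the dependent sets of a completion matroid of matrices
  of rank two, which supplies the lower bound on the rank of the greatest matroid.\<close>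

definition affine_relations :: "('e \<Rightarrow> real) set" where
  "affine_relations = {w.
     (\<forall>i. (\<Sum>j<n. w (edge i j)) = 0 \<and> (\<Sum>j<n. real j * w (edge i j)) = 0) \<and>
     (\<forall>j. (\<Sum>i<m. w (edge i j)) = 0 \<and> (\<Sum>i<m. real i * w (edge i j)) = 0)}"

definition relation_matroid :: "'e set set" where
  "relation_matroid = {I. I \<subseteq> E \<and> relation_free affine_relations I}"

lemma matroid_on_relation_matroid: "matroid_on E relation_matroid"
  unfolding relation_matroid_def
  by (rule matroid_on_relation_free[OF finite_E])
    (auto simp: affine_relations_def distrib_left sum.distrib mult.left_commute
      simp flip: sum_distrib_left)

lemma relation_free_cross:
  assumes "a < m" "a' < m" "a \<noteq> a'" "b < n" "b' < n" "b \<noteq> b'"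
    and I: "I \<subseteq> E" "\<And>i j. edge i j \<in> I \<Longrightarrow> i \<in> {a, a'} \<or> j \<in> {b, b'}"
  shows "relation_free affine_relations I"
  unfolding relation_free_def
proof (intro ballI impI allI)
  fix w e assume w: "w \<in> affine_relations" and zero: "\<forall>e. e \<notin> I \<longrightarrow> w e = 0"
  have row: "(\<Sum>j<n. w (edge i j)) = 0" "(\<Sum>j<n. real j * w (edge i j)) = 0"
    and column: "(\<Sum>i<m. w (edge i j)) = 0" "(\<Sum>i<m. real i * w (edge i j)) = 0" for i j
    using w by (simp_all add: affine_relations_def)
  have other_row: "w (edge i j) = 0" if i: "i \<notin> {a, a'}" and j: "j < n" for i j
  proof (rule two_term_affine_relation_trivial[OF assms(4-6) _ row j])
    show "w (edge i j') = 0" if "j' \<notin> {b, b'}" for j' using zero I(2)[of i j'] i that by blast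
  qed
  have "w (edge i j) = 0" if i: "i < m" and j: "j < n" for i j
    by (rule two_term_affine_relation_trivial[OF assms(1-3) _ column i]) (rule other_row[OF _ j])
  moreover have "w e = 0" if "e \<notin> E" using zero I(1) that by blast
  ultimately show "w e = 0" by (cases "e \<in> E") (auto elim!: E_edgeE)
qed

lemma K33_not_in_relation_matroid:
  assumes "X \<in> K33s"
  shows "X \<notin> relation_matroid"
proof
  obtain A B where X: "X = K A B" "A \<subseteq> {..<m}" "B \<subseteq> {..<n}" "card A = 3" "card B = 3"
    using assms by (rule K33sE)
  obtain \<alpha> where \<alpha>: "\<And>i. i \<notin> A \<Longrightarrow> \<alpha> i = 0" "\<And>i. i \<in> A \<Longrightarrow> \<alpha> i \<noteq> 0"
    "(\<Sum>i<m. \<alpha> i) = 0" "(\<Sum>i<m. real i * \<alpha> i) = 0"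
    using three_term_affine_relation[OF X(2,4)] by metis
  obtain \<beta> where \<beta>: "\<And>i. i \<notin> B \<Longrightarrow> \<beta> i = 0" "\<And>i. i \<in> B \<Longrightarrow> \<beta> i \<noteq> 0"
    "(\<Sum>i<n. \<beta> i) = 0" "(\<Sum>i<n. real i * \<beta> i) = 0"
    using three_term_affine_relation[OF X(3,5)] by metis
  define w where "w e = (if e \<in> X then \<alpha> (fst (coords e)) * \<beta> (snd (coords e)) else 0)" for e
  have w: "w (edge i j) = \<alpha> i * \<beta> j" for i j using \<alpha>(1) \<beta>(1) by (auto simp: w_def X(1))
  have "(\<Sum>i<m. w (edge i j)) = (\<Sum>i<m. \<alpha> i) * \<beta> j"
    "(\<Sum>i<m. real i * w (edge i j)) = (\<Sum>i<m. real i * \<alpha> i) * \<beta> j"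
    "(\<Sum>j<n. w (edge i j)) = \<alpha> i * (\<Sum>j<n. \<beta> j)"
    "(\<Sum>j<n. real j * w (edge i j)) = \<alpha> i * (\<Sum>j<n. real j * \<beta> j)" for i j
    unfolding w sum_distrib_left sum_distrib_right by (simp_all add: mult_ac)
  then have "w \<in> affine_relations" using \<alpha>(3,4) \<beta>(3,4) by (simp add: affine_relations_def)
  moreover assume "X \<in> relation_matroid"
  moreover have "\<forall>e. e \<notin> X \<longrightarrow> w e = 0" by (simp add: w_def)
  ultimately have "\<forall>e. w e = 0" by (simp add: relation_matroid_def relation_free_def)
  then have "\<alpha> i * \<beta> j = 0" for i j using w by metis
  moreover obtain x y where "x \<in> A" "y \<in> B" using X(4,5) by fastforce
  ultimately show False using \<alpha>(2) \<beta>(2) by (metis mult_eq_0_iff)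
qed

lemma relation_matroid_with_K33_circuits: "matroid_with_circuits E K33s relation_matroid"
  unfolding matroid_with_circuits_def
proof (intro conjI ballI)
  show "matroid_on E relation_matroid" by (rule matroid_on_relation_matroid)
  then interpret N: matroid E relation_matroid by unfold_locales
  fix X assume "X \<in> K33s"
  then obtain A B where X: "X = K A B" "A \<subseteq> {..<m}" "B \<subseteq> {..<n}" "card A = 3" "card B = 3"
    by (rule K33sE)
  show "circuit E relation_matroid X"
  proof (rule N.circuitI)
    show "X \<subseteq> E" "X \<notin> relation_matroid"
      using \<open>X \<in> K33s\<close> K33_subset_E K33_not_in_relation_matroid by simp_all
    fix e assume "e \<in> X"
    then obtain x y where e: "e = edge x y" "x \<in> A" "y \<in> B" unfolding X(1) by (rule K_edgeE)
    obtain a a' where A: "A = {x, a, a'}" "a \<noteq> a'" "x \<noteq> a" "x \<noteq> a'" by (rule card_3E[OF X(4) e(2)])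
    obtain b b' where B: "B = {y, b, b'}" "b \<noteq> b'" "y \<noteq> b" "y \<noteq> b'" by (rule card_3E[OF X(5) e(3)])
    have "relation_free affine_relations (X - {e})"
      using X(2,3) A B e \<open>X \<subseteq> E\<close> by (intro relation_free_cross[of a a' b b']) (auto simp: X(1))
    then show "X - {e} \<in> relation_matroid" using \<open>X \<subseteq> E\<close> by (auto simp: relation_matroid_def)
  qed
qed

lemma large_set_in_relation_matroid: "\<exists>I\<in>relation_matroid. card I + 4 = 2 * (m + n)"
proof
  let ?I = "K {0, 1} {..<n} \<union> K {2..<m} {0, 1}"
  have "?I \<subseteq> E" using three_le_m three_le_n by (auto simp: K_def E_def)
  then have "relation_free affine_relations ?I"
    using three_le_m three_le_n by (intro relation_free_cross[of 0 1 0 1]) auto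
  then show "?I \<in> relation_matroid" using \<open>?I \<subseteq> E\<close> by (simp add: relation_matroid_def)
  have "K {0, 1} {..<n} \<inter> K {2..<m} {0, 1} = {}" by (auto simp: K_Int K_def)
  then have "card ?I = card (K {0, 1} {..<n}) + card (K {2..<m} {0, 1})"
    by (intro card_Un_disjoint finite_K) auto
  then show "card ?I + 4 = 2 * (m + n)" using three_le_m by (simp add: card_K)
qed

lemma edge_grid_flip: "edge_grid (\<lambda>i j. edge j i) n m"
  by unfold_locales (use three_le_m three_le_n in auto)

interpretation flip: edge_grid "\<lambda>i j. edge j i" n m
  by (rule edge_grid_flip)

lemma flip_K: "flip.K A B = K B A"
  by (auto simp: flip.K_def K_def)

lemma flip_E: "flip.E = E"
  by (simp add: flip.E_def E_def flip_K)

lemma flip_K33s: "flip.K33s = K33s"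
  unfolding flip.K33s_def K33s_def flip_K by blast

lemma flip_biclique: "flip.biclique P A B = biclique P B A"
  by (auto simp: flip.biclique_def biclique_def flip_K)

end

section \<open>The greatest matroid\<close>

locale greatest_K33_matroid = edge_grid edge m n for edge :: "nat \<Rightarrow> nat \<Rightarrow> 'e" and m n +
  fixes M :: "'e set set"
  assumes greatest: "greatest_matroid_with_circuits E K33s M"
begin

lemma with_K33_circuits: "matroid_with_circuits E K33s M"
  using greatest by (simp add: greatest_matroid_with_circuits_def)

lemma with_K33_circuits_subset: "matroid_with_circuits E K33s N \<Longrightarrow> N \<subseteq> M"
  using greatest by (simp add: greatest_matroid_with_circuits_def)

sublocale matroid E M
  by unfold_locales (use with_K33_circuits in \<open>simp add: matroid_with_circuits_def\<close>)

text \<open>Exchanging the two sides changes neither the ground set nor the matroid, so interpreting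
  the locale with the sides exchanged transfers statements about left vertices to right vertices.\<close>

lemma greatest_K33_matroid_flip: "greatest_K33_matroid (\<lambda>i j. edge j i) n m M"
  using greatest edge_grid_flip
  by (simp add: greatest_K33_matroid_def greatest_K33_matroid_axioms_def flip_E flip_K33s)

lemma circuit_K33: "X \<in> K33s \<Longrightarrow> circuit E M X"
  using with_K33_circuits by (simp add: matroid_with_circuits_def)

lemma indep_if_card_le_8:
  assumes "I \<subseteq> E" "card I \<le> 8"
  shows "I \<in> M"
  using with_K33_circuits_subset[OF uniform_with_K33_circuits] assms by blast

lemma rank_dependent_ge:
  assumes A: "A \<subseteq> E" "A \<notin> M"
  shows "8 \<le> rank A"
proof -
  have "\<not> card A \<le> 8" using indep_if_card_le_8 assms by blast
  then obtain I where I: "I \<subseteq> A" "card I = 8" by (metis nat_le_linear obtain_subset_with_card_n)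
  then have "I \<in> M" using indep_if_card_le_8[of I] A(1) by auto
  then show ?thesis using card_indep_le_rank[of I A] I by simp
qed

lemma rank_E_ge: "2 * (m + n) \<le> rank E + 4"
proof -
  obtain I where I: "I \<in> relation_matroid" "card I + 4 = 2 * (m + n)"
    using large_set_in_relation_matroid by blast
  have "I \<in> M" using with_K33_circuits_subset[OF relation_matroid_with_K33_circuits] I(1) by blast
  then show ?thesis using card_indep_le_rank[of I E] indep_subset_ground[of I] I(2) by simp
qed

lemma star_subset_closure:
  assumes P: "P \<subseteq> E" and AB: "biclique P A B" "2 \<le> card A" and v: "v < m"
    and y: "y \<in> B" "y' \<in> B" "y \<noteq> y'" "edge v y \<in> P" "edge v y' \<in> P"
  shows "K {v} B \<subseteq> closure P"
proof (rule K_subsetI)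
  fix u z assume u: "u \<in> {v}" and z: "z \<in> B"
  show "edge u z \<in> closure P"
  proof (cases "edge v z \<in> P")
    case True
    then show ?thesis using subset_closure[OF P] u by blast
  next
    case False
    then have "v \<notin> A" "z \<noteq> y" "z \<noteq> y'" using biclique_edge[OF AB(1)] z y by auto
    obtain a a' where a: "a \<in> A" "a' \<in> A" "a \<noteq> a'" by (rule card_ge_2E[OF AB(2)])
    then have "v \<noteq> a" "v \<noteq> a'" using \<open>v \<notin> A\<close> by auto
    let ?X = "K {v, a, a'} {z, y, y'}"
    have "?X \<in> K33s"
      using a z y v \<open>v \<noteq> a\<close> \<open>v \<noteq> a'\<close> \<open>z \<noteq> y\<close> \<open>z \<noteq> y'\<close> bicliqueD(1,2)[OF AB(1)]
      by (intro K33sI) auto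
    moreover have "?X - {edge v z} \<subseteq> P"
      using biclique_edge[OF AB(1)] a y z by (auto simp: K_def)
    ultimately show ?thesis
      using circuit_in_closure[OF circuit_K33, of ?X "edge v z" P] u by simp
  qed
qed

lemma rank_Un_star_le:
  assumes P: "P \<subseteq> E" and AB: "biclique P A B" "2 \<le> card A" and v: "v < m"
  shows "rank (P \<union> K {v} B) \<le> rank P + 2"
proof (cases "2 \<le> card B")
  case False
  have "rank (P \<union> K {v} B) \<le> rank P + card (K {v} B)"
    using bicliqueD(5)[OF AB(1)] by (intro rank_Un_le finite_K) auto
  then show ?thesis using False by (simp add: card_K)
next
  case True
  then obtain y y' where y: "y \<in> B" "y' \<in> B" "y \<noteq> y'" by (rule card_ge_2E)
  let ?P = "P \<union> {edge v y, edge v y'}"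
  have "biclique ?P A B" using AB(1) by (rule biclique_mono) auto
  moreover have "?P \<subseteq> E" using P v y bicliqueD(2)[OF AB(1)] by auto
  ultimately have "K {v} B \<subseteq> closure ?P"
    using AB(2) v y by (intro star_subset_closure[of _ A B v y y']) auto
  then have "rank (?P \<union> K {v} B) = rank ?P" by (rule rank_Un_subset_closure)
  moreover have "rank (P \<union> K {v} B) \<le> rank (?P \<union> K {v} B)" by (rule rank_mono) auto
  moreover have "rank ?P \<le> rank P + 2"
    using rank_Un_le[of "{edge v y, edge v y'}" P] y by simp
  ultimately show ?thesis by simp
qed

lemma rank_K_Un_left_le:
  assumes A: "A \<subseteq> {..<m}" "2 \<le> card A" and B: "B \<subseteq> {..<n}" and C: "C \<subseteq> {..<m}"
  shows "rank (K (A \<union> C) B) \<le> rank (K A B) + 2 * card C"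
proof -
  have "finite C" using C by (rule finite_if_subset_lessThan)
  then show ?thesis using C
  proof (induction C)
    case (insert v C)
    have "K (A \<union> insert v C) B = K (A \<union> C) B \<union> K {v} B" by (auto simp: K_def)
    moreover have "biclique (K (A \<union> C) B) A B"
      using A(1) B K_mono[of A "A \<union> C" B B] by (simp add: biclique_def)
    then have "rank (K (A \<union> C) B \<union> K {v} B) \<le> rank (K (A \<union> C) B) + 2"
      using A B insert.prems by (intro rank_Un_star_le[of _ A] K_subset_E) auto
    ultimately show ?case using insert by auto
  qed simp
qed

lemma rank_K_Un_right_le:
  assumes "A \<subseteq> {..<m}" and B: "B \<subseteq> {..<n}" "2 \<le> card B" and D: "D \<subseteq> {..<n}"
  shows "rank (K A (B \<union> D)) \<le> rank (K A B) + 2 * card D"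
proof -
  interpret flip: greatest_K33_matroid "\<lambda>i j. edge j i" n m M by (rule greatest_K33_matroid_flip)
  show ?thesis using flip.rank_K_Un_left_le[of B A D] assms by (simp add: flip_K)
qed

lemma rank_K_le:
  assumes A: "A \<subseteq> {..<m}" "2 \<le> card A" and B: "B \<subseteq> {..<n}"
  shows "rank (K A B) + 4 \<le> 2 * (card A + card B)"
proof -
  obtain a a' where a: "a \<in> A" "a' \<in> A" "a \<noteq> a'" by (rule card_ge_2E[OF A(2)])
  have "rank (K ({a, a'} \<union> (A - {a, a'})) B) \<le> rank (K {a, a'} B) + 2 * card (A - {a, a'})"
    using a A B by (intro rank_K_Un_left_le) auto
  moreover have "{a, a'} \<union> (A - {a, a'}) = A" using a by auto
  moreover have "rank (K {a, a'} B) \<le> 2 * card B"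
    using rank_le_card[of "K {a, a'} B"] finite_K[of "{a, a'}" B] finite_if_subset_lessThan[OF B] a
    by (simp add: card_K)
  moreover have "card (A - {a, a'}) + 2 = card A" using a A by (simp add: card_Diff_subset)
  ultimately show ?thesis by simp
qed

text \<open>Adding the remaining vertices one by one raises the rank of \<open>K A B\<close> by at most two each,
  but has to reach the rank of \<open>E\<close>.\<close>

lemma rank_K:
  assumes A: "A \<subseteq> {..<m}" "2 \<le> card A" and B: "B \<subseteq> {..<n}" "2 \<le> card B"
  shows "rank (K A B) + 4 = 2 * (card A + card B)"
proof -
  have union: "A \<union> ({..<m} - A) = {..<m}" "B \<union> ({..<n} - B) = {..<n}" using A B by auto
  have "rank E \<le> rank (K A {..<n}) + 2 * card ({..<m} - A)"
    using rank_K_Un_left_le[OF A, of "{..<n}" "{..<m} - A"] unfolding union E_def by simp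
  moreover have "rank (K A {..<n}) \<le> rank (K A B) + 2 * card ({..<n} - B)"
    using rank_K_Un_right_le[OF A(1) B, of "{..<n} - B"] unfolding union by simp
  moreover have "card ({..<m} - A) + card A = m" "card ({..<n} - B) + card B = n"
    using A(1) B(1) card_mono[of "{..<m}" A] card_mono[of "{..<n}" B]
      finite_if_subset_lessThan[OF A(1)] finite_if_subset_lessThan[OF B(1)]
    by (simp_all add: card_Diff_subset)
  ultimately have "2 * (card A + card B) \<le> rank (K A B) + 4" using rank_E_ge by presburger
  then show ?thesis using rank_K_le[OF A B(1)] by simp
qed

lemma nullity_K:
  assumes A: "A \<subseteq> {..<m}" "2 \<le> card A" and B: "B \<subseteq> {..<n}" "2 \<le> card B"
  shows "nullity (K A B) = (card A - 2) * (card B - 2)"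
proof -
  have "rank (K A B) + nullity (K A B) = card A * card B"
    using rank_plus_nullity[OF finite_K[OF A(1)[THEN finite_if_subset_lessThan]
      B(1)[THEN finite_if_subset_lessThan]]] by (simp add: card_K)
  moreover obtain a b where "card A = a + 2" "card B = b + 2"
    using A(2) B(2) by (metis add.commute le_Suc_ex)
  ultimately show ?thesis using rank_K[OF A B] by (simp add: algebra_simps)
qed

lemma star_edge_notin_closure:
  assumes P: "P \<subseteq> E" "P \<inter> K {v} {..<n} = {}" and v: "v < m" and y: "y < n"
  shows "edge v y \<notin> closure P"
proof
  define Q where "Q = K ({..<m} - {v}) {..<n}"
  have "P \<subseteq> Q"
  proof
    fix e assume "e \<in> P"
    then have "e \<in> E" using P(1) by blast
    then obtain i j where "e = edge i j" "i < m" "j < n" by (rule E_edgeE)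
    then show "e \<in> Q" using P(2) \<open>e \<in> P\<close> by (auto simp: Q_def)
  qed
  moreover assume "edge v y \<in> closure P"
  ultimately have "edge v y \<in> closure Q" using closure_mono by blast
  then have "rank (insert (edge v y) Q) = rank Q" by (simp add: closure_def)
  have "\<exists>y'. y' < n \<and> y' \<noteq> y" using three_le_n by presburger
  then obtain y' where y': "y' < n" "y' \<noteq> y" by blast
  let ?Q = "insert (edge v y') (insert (edge v y) Q)"
  have "K {v} {..<n} \<subseteq> closure ?Q"
  proof (rule star_subset_closure[of _ "{..<m} - {v}"])
    show "?Q \<subseteq> E" using v y y' by (auto simp: Q_def E_def K_def)
    show "biclique ?Q ({..<m} - {v}) {..<n}" by (auto simp: biclique_def Q_def)
    show "2 \<le> card ({..<m} - {v})" using three_le_m v by simp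
  qed (use v y y' in auto)
  then have "rank (?Q \<union> K {v} {..<n}) = rank ?Q" by (rule rank_Un_subset_closure)
  moreover have "E = ?Q \<union> K {v} {..<n}" using v y y' by (auto simp: Q_def K_def E_def)
  ultimately have "rank E \<le> Suc (rank Q)"
    using rank_insert_le[of "edge v y'" "insert (edge v y) Q"]
      \<open>rank (insert (edge v y) Q) = rank Q\<close> by simp
  moreover have "rank Q + 4 \<le> 2 * ((m - 1) + n)"
    using rank_K_le[of "{..<m} - {v}" "{..<n}"] three_le_m v by (simp add: Q_def)
  ultimately show False using rank_E_ge three_le_m by presburger
qed

lemma star_edge_notin_closure_right:
  assumes "P \<subseteq> E" "P \<inter> K {..<m} {y} = {}" "v < m" "y < n"
  shows "edge v y \<notin> closure P"
proof -
  interpret flip: greatest_K33_matroid "\<lambda>i j. edge j i" n m M by (rule greatest_K33_matroid_flip)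
  show ?thesis using flip.star_edge_notin_closure[of P y v] assms by (simp add: flip_K flip_E)
qed

lemma flat_K:
  assumes A: "A \<subseteq> {..<m}" and B: "B \<subseteq> {..<n}"
  shows "flat (K A B)"
proof -
  have KE: "K A B \<subseteq> E" using A B by (rule K_subset_E)
  have "e \<in> K A B" if e: "e \<in> closure (K A B)" for e
  proof -
    have "e \<in> E" using e closure_subset_ground by blast
    then obtain x y where xy: "e = edge x y" "x < m" "y < n" by (rule E_edgeE)
    have "x \<in> A"
      using star_edge_notin_closure[OF KE _ xy(2,3)] e xy(1) by (cases "x \<in> A") (auto simp: K_Int)
    moreover have "y \<in> B"
      using star_edge_notin_closure_right[OF KE _ xy(2,3)] e xy(1)
      by (cases "y \<in> B") (auto simp: K_Int)
    ultimately show ?thesis using xy by simp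
  qed
  then show ?thesis using KE by (auto simp: flat_def)
qed

lemma star_indep:
  assumes v: "v < m" and N: "N \<subseteq> {..<n}"
  shows "K {v} N \<in> M"
proof -
  have "finite N" using N by (rule finite_if_subset_lessThan)
  then show ?thesis using N
  proof (induction N)
    case empty
    then show ?case using empty_indep by (simp add: K_def)
  next
    case (insert y N)
    have "edge v y \<notin> closure (K {v} N)"
      using insert.prems insert.hyps v
      by (intro star_edge_notin_closure_right K_subset_E) (auto simp: K_def)
    then have "insert (edge v y) (K {v} N) \<in> M" using insert v by (intro insert_indep) auto
    moreover have "insert (edge v y) (K {v} N) = K {v} (insert y N)" by (auto simp: K_def)
    ultimately show ?case by simp
  qed
qed

end

section \<open>Blobs\<close>

definition rect_weight :: "'a set \<times> 'b set \<Rightarrow> nat" where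
  "rect_weight p = (card (fst p) - 2) * (card (snd p) - 2)"

context edge_grid
begin

text \<open>Closure under the weak saturation steps that complete a \<open>K\<^sub>3\<^sub>,\<^sub>3\<close> minus an edge.\<close>

definition saturated :: "'e set \<Rightarrow> bool" where
  "saturated P \<longleftrightarrow> P \<subseteq> E \<and> (\<forall>X\<in>K33s. \<forall>e. X - {e} \<subseteq> P \<longrightarrow> X \<subseteq> P)"

definition blobs :: "'e set \<Rightarrow> (nat set \<times> nat set) set" where
  "blobs P = {(A, B). biclique P A B \<and> 3 \<le> card A \<and> 3 \<le> card B \<and>
     (\<forall>C D. biclique P C D \<longrightarrow> A \<subseteq> C \<longrightarrow> B \<subseteq> D \<longrightarrow> C = A \<and> D = B)}"

definition weight :: "'e set \<Rightarrow> nat" where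
  "weight P = (\<Sum>p\<in>blobs P. rect_weight p)"

lemma saturated_subset_E: "saturated P \<Longrightarrow> P \<subseteq> E"
  by (simp add: saturated_def)

lemma saturated_edge_completion:
  assumes P: "saturated P" and AB: "biclique P A B" and CD: "biclique P C D"
    and card: "2 \<le> card (A \<inter> C)" "2 \<le> card B" and xy: "x \<in> A" "y \<in> D"
  shows "edge x y \<in> P"
proof (cases "x \<in> C \<or> y \<in> B")
  case True
  then show ?thesis using biclique_edge[OF AB] biclique_edge[OF CD] xy by blast
next
  case False
  obtain u u' where u: "u \<in> A \<inter> C" "u' \<in> A \<inter> C" "u \<noteq> u'" by (rule card_ge_2E[OF card(1)])
  obtain b b' where b: "b \<in> B" "b' \<in> B" "b \<noteq> b'" by (rule card_ge_2E[OF card(2)])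
  let ?X = "K {x, u, u'} {y, b, b'}"
  have distinct: "x \<noteq> u" "x \<noteq> u'" "y \<noteq> b" "y \<noteq> b'" using False u b by auto
  have "?X \<in> K33s"
    using bicliqueD(1,2)[OF AB] bicliqueD(1,2)[OF CD] xy u b distinct by (intro K33sI) auto
  moreover have "?X - {edge x y} \<subseteq> P"
    using biclique_edge[OF AB] biclique_edge[OF CD] xy u b by (auto simp: K_def)
  ultimately have "?X \<subseteq> P" using P unfolding saturated_def by blast
  then show ?thesis by (rule K_subsetD) simp_all
qed

lemma biclique_Un:
  assumes P: "saturated P" and AB: "biclique P A B" and CD: "biclique P C D"
    and card: "2 \<le> card (A \<inter> C)" "2 \<le> card B" "2 \<le> card D"
  shows "biclique P (A \<union> C) (B \<union> D)"
proof -
  have card': "2 \<le> card (C \<inter> A)" using card(1) by (simp add: Int_commute)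
  have "edge x y \<in> P" if xy: "x \<in> A \<union> C" "y \<in> B \<union> D" for x y
  proof -
    consider (in_AB) "x \<in> A" "y \<in> B" | (in_AD) "x \<in> A" "y \<in> D"
      | (in_CB) "x \<in> C" "y \<in> B" | (in_CD) "x \<in> C" "y \<in> D"
      using xy by blast
    then show ?thesis
    proof cases
      case in_AB
      then show ?thesis by (rule biclique_edge[OF AB])
    next
      case in_AD
      then show ?thesis by (rule saturated_edge_completion[OF P AB CD card(1,2)])
    next
      case in_CB
      then show ?thesis by (rule saturated_edge_completion[OF P CD AB card' card(3)])
    next
      case in_CD
      then show ?thesis by (rule biclique_edge[OF CD])
    qed
  qed
  then have "K (A \<union> C) (B \<union> D) \<subseteq> P" by (rule K_subsetI)
  then show ?thesis using AB CD by (simp add: biclique_def)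
qed

lemma blobD:
  assumes "(A, B) \<in> blobs P"
  shows "biclique P A B" "3 \<le> card A" "3 \<le> card B"
  using assms by (simp_all add: blobs_def)

lemma blob_sidesD:
  assumes "(A, B) \<in> blobs P"
  shows "A \<subseteq> {..<m}" "B \<subseteq> {..<n}" "K A B \<subseteq> P" "finite A" "finite B" "A \<noteq> {}" "B \<noteq> {}"
  using bicliqueD[OF blobD(1)[OF assms]] blobD(2,3)[OF assms] by auto

lemma blob_maximal:
  assumes "(A, B) \<in> blobs P" "biclique P C D" "A \<subseteq> C" "B \<subseteq> D"
  shows "C = A" "D = B"
  using assms unfolding blobs_def by blast+

lemma blobI:
  assumes "biclique P A B" "3 \<le> card A" "3 \<le> card B"
    "\<And>C D. biclique P C D \<Longrightarrow> A \<subseteq> C \<Longrightarrow> B \<subseteq> D \<Longrightarrow> C \<subseteq> A \<and> D \<subseteq> B"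
  shows "(A, B) \<in> blobs P"
  unfolding blobs_def using assms by (simp add: subset_antisym)

lemma finite_blobs: "finite (blobs P)"
proof (rule finite_subset)
  show "blobs P \<subseteq> Pow {..<m} \<times> Pow {..<n}" by (auto dest: blob_sidesD)
qed simp

lemma biclique_extends_to_blob:
  assumes AB: "biclique P A B" and card: "3 \<le> card A" "3 \<le> card B"
  obtains C D where "(C, D) \<in> blobs P" "A \<subseteq> C" "B \<subseteq> D"
proof -
  let ?S = "{K C D | C D. biclique P C D \<and> A \<subseteq> C \<and> B \<subseteq> D}"
  have "?S \<subseteq> (\<lambda>(C, D). K C D) ` (Pow {..<m} \<times> Pow {..<n})" by (auto simp: biclique_def)
  then have "finite ?S" by (rule finite_subset) simp
  moreover have "K A B \<in> ?S" using AB by blast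
  ultimately obtain X where X: "X \<in> ?S" and maximal: "\<forall>Y\<in>?S. X \<subseteq> Y \<longrightarrow> X = Y"
    by (rule finite_has_maximal2[elim_format]) blast
  obtain C D where CD: "X = K C D" "biclique P C D" "A \<subseteq> C" "B \<subseteq> D" using X by blast
  have "3 \<le> card C" "3 \<le> card D"
    using order_trans[OF card(1) card_mono[OF bicliqueD(4)[OF CD(2)] CD(3)]]
      order_trans[OF card(2) card_mono[OF bicliqueD(5)[OF CD(2)] CD(4)]] .
  moreover have "C' \<subseteq> C \<and> D' \<subseteq> D" if CD': "biclique P C' D'" "C \<subseteq> C'" "D \<subseteq> D'" for C' D'
  proof -
    have "K C' D' \<in> ?S" using CD(3,4) CD' by blast
    then have "K C' D' \<subseteq> K C D" using maximal CD(1) K_mono[OF CD'(2,3)] by blast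
    moreover have "C' \<noteq> {}" "D' \<noteq> {}" using CD(3,4) CD'(2,3) card by auto
    ultimately show ?thesis using K_subset_K_D[of C' D' C D] by simp
  qed
  ultimately have "(C, D) \<in> blobs P" using CD(2) by (intro blobI)
  then show ?thesis using that CD(3,4) by blast
qed

lemma blob_absorbs_biclique:
  assumes P: "saturated P" and AB: "(A, B) \<in> blobs P" and CD: "biclique P C D" "2 \<le> card D"
    and card: "2 \<le> card (A \<inter> C)"
  shows "C \<subseteq> A" "D \<subseteq> B"
proof -
  have "biclique P (A \<union> C) (B \<union> D)"
    using biclique_Un[OF P blobD(1)[OF AB] CD(1) card _ CD(2)] blobD(3)[OF AB] by simp
  then have "A \<union> C = A" "B \<union> D = B" using blob_maximal[OF AB] by blast+
  then show "C \<subseteq> A" "D \<subseteq> B" by blast+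
qed

lemma blob_eqI:
  assumes P: "saturated P" and p: "p \<in> blobs P" and q: "q \<in> blobs P"
    and u: "u \<in> fst p" "u \<in> fst q" "u' \<in> fst p" "u' \<in> fst q" "u \<noteq> u'"
  shows "p = q"
proof -
  have sub: "fst q \<subseteq> fst p \<and> snd q \<subseteq> snd p"
    if p: "p \<in> blobs P" "u \<in> fst p" "u' \<in> fst p"
      and q: "q \<in> blobs P" "u \<in> fst q" "u' \<in> fst q" for p q
  proof -
    have pq: "(fst p, snd p) \<in> blobs P" "(fst q, snd q) \<in> blobs P" using p(1) q(1) by simp_all
    have "2 \<le> card (fst p \<inter> fst q)"
      using blob_sidesD(4)[OF pq(1)] p q u(5) by (intro card_ge_2I[of _ u u']) auto
    then show ?thesis
      using blob_absorbs_biclique[OF P pq(1) blobD(1)[OF pq(2)]] blobD(3)[OF pq(2)] by simp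
  qed
  show ?thesis using sub[of p q] sub[of q p] p q u(1-4) by (simp add: prod_eq_iff subset_antisym)
qed

lemma blob_trace_subset:
  assumes "(A, B) \<in> blobs (P \<inter> K C D)"
  shows "A \<subseteq> C" "B \<subseteq> D"
  using K_subset_K_D[of A B C D] blob_sidesD[OF assms] by auto

lemma blob_is_trace_blob:
  assumes "P \<subseteq> F" and AB: "(A, B) \<in> blobs P"
  shows "\<exists>(C, D)\<in>blobs F. (A, B) \<in> blobs (P \<inter> K C D)"
proof -
  obtain C D where CD: "(C, D) \<in> blobs F" "A \<subseteq> C" "B \<subseteq> D"
    using biclique_extends_to_blob[OF biclique_mono[OF blobD(1)[OF AB] \<open>P \<subseteq> F\<close>] blobD(2,3)[OF AB]] .
  have "(A, B) \<in> blobs (P \<inter> K C D)"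
  proof (rule blobI)
    show "biclique (P \<inter> K C D) A B"
      using blobD(1)[OF AB] K_mono[OF CD(2,3)] by (auto simp: biclique_def)
    show "C' \<subseteq> A \<and> D' \<subseteq> B" if "biclique (P \<inter> K C D) C' D'" "A \<subseteq> C'" "B \<subseteq> D'" for C' D'
      using blob_maximal[OF AB _ that(2,3)] biclique_mono[OF that(1)] by auto
  qed (use blobD[OF AB] in auto)
  then show ?thesis using CD(1) by blast
qed

lemma trace_blob_is_blob:
  assumes F: "saturated F" "P \<subseteq> F" and CD: "(C, D) \<in> blobs F"
    and AB: "(A, B) \<in> blobs (P \<inter> K C D)"
  shows "(A, B) \<in> blobs P"
proof (rule blobI)
  show "biclique P A B" using blobD(1)[OF AB] by (rule biclique_mono) auto
  fix C' D' assume C'D': "biclique P C' D'" "A \<subseteq> C'" "B \<subseteq> D'"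
  have "card A \<le> card (C \<inter> C')"
    using blob_trace_subset(1)[OF AB] C'D'(2) blob_sidesD(4)[OF CD] by (intro card_mono) auto
  then have "2 \<le> card (C \<inter> C')" using blobD(2)[OF AB] by linarith
  moreover have "card B \<le> card D'" using bicliqueD(5)[OF C'D'(1)] C'D'(3) by (rule card_mono)
  then have "2 \<le> card D'" using blobD(3)[OF AB] by linarith
  ultimately have "C' \<subseteq> C" "D' \<subseteq> D"
    using blob_absorbs_biclique[OF F(1) CD biclique_mono[OF C'D'(1) F(2)]] by simp_all
  then have "biclique (P \<inter> K C D) C' D'" using C'D'(1) K_mono by (auto simp: biclique_def)
  then show "C' \<subseteq> A \<and> D' \<subseteq> B" using blob_maximal[OF AB _ C'D'(2,3)] by simp
qed (use blobD[OF AB] in auto)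

lemma blobs_eq_Union_traces:
  assumes F: "saturated F" "P \<subseteq> F"
  shows "blobs P = (\<Union>p\<in>blobs F. blobs (P \<inter> K (fst p) (snd p)))"
proof (intro equalityI subsetI)
  fix p assume "p \<in> blobs P"
  then show "p \<in> (\<Union>q\<in>blobs F. blobs (P \<inter> K (fst q) (snd q)))"
    using blob_is_trace_blob[OF F(2), of "fst p" "snd p"] by force
next
  fix p assume "p \<in> (\<Union>q\<in>blobs F. blobs (P \<inter> K (fst q) (snd q)))"
  then show "p \<in> blobs P"
    using trace_blob_is_blob[OF F, of _ _ "fst p" "snd p"] by force
qed

lemma blobs_traces_disjoint:
  assumes F: "saturated F" and pq: "p \<in> blobs F" "q \<in> blobs F" "p \<noteq> q"
  shows "blobs (P \<inter> K (fst p) (snd p)) \<inter> blobs (P \<inter> K (fst q) (snd q)) = {}"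
proof (rule equals0I)
  fix s assume s: "s \<in> blobs (P \<inter> K (fst p) (snd p)) \<inter> blobs (P \<inter> K (fst q) (snd q))"
  then have "fst s \<subseteq> fst p" "fst s \<subseteq> fst q" "2 \<le> card (fst s)"
    using blob_trace_subset[of "fst s" "snd s"] blobD(2)[of "fst s" "snd s"] by fastforce+
  then obtain u u' where "u \<in> fst p \<inter> fst q" "u' \<in> fst p \<inter> fst q" "u \<noteq> u'"
    by (meson IntI card_ge_2E subsetD)
  then show False using blob_eqI[OF F pq(1,2), of u u'] pq(3) by blast
qed

lemma weight_eq_sum_traces:
  assumes F: "saturated F" "P \<subseteq> F"
  shows "weight P = (\<Sum>p\<in>blobs F. weight (P \<inter> K (fst p) (snd p)))"
  unfolding weight_def blobs_eq_Union_traces[OF F]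
  using finite_blobs blobs_traces_disjoint[OF F(1)] by (intro sum.UNION_disjoint) auto

lemma blob_remove_other_vertex:
  assumes AB: "(A, B) \<in> blobs P" and v: "v \<notin> A"
  shows "(A, B) \<in> blobs (P - K {v} {..<n})"
proof (rule blobI)
  show "biclique (P - K {v} {..<n}) A B"
    using blobD(1)[OF AB] v by (auto simp: biclique_def K_def)
  show "C \<subseteq> A \<and> D \<subseteq> B" if "biclique (P - K {v} {..<n}) C D" "A \<subseteq> C" "B \<subseteq> D" for C D
    using blob_maximal[OF AB biclique_mono[OF that(1)] that(2,3)] by auto
qed (use blobD[OF AB] in auto)

lemma blob_remove_vertex:
  assumes P: "saturated P" and AB: "(A, B) \<in> blobs P" and v: "v \<in> A" and card: "4 \<le> card A"
  shows "(A - {v}, B) \<in> blobs (P - K {v} {..<n})"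
proof (rule blobI)
  show "biclique (P - K {v} {..<n}) (A - {v}) B"
    using blobD(1)[OF AB] by (auto simp: biclique_def K_def)
  show "3 \<le> card (A - {v})" "3 \<le> card B" using card v blobD(3)[OF AB] by simp_all
  fix C D assume CD: "biclique (P - K {v} {..<n}) C D" "A - {v} \<subseteq> C" "B \<subseteq> D"
  have "card (A - {v}) \<le> card (A \<inter> C)" "card B \<le> card D"
    using CD blob_sidesD(4)[OF AB] bicliqueD(5)[OF CD(1)] by (auto intro!: card_mono)
  moreover have "biclique P C D" using CD(1) by (rule biclique_mono) auto
  ultimately have "C \<subseteq> A" "D \<subseteq> B"
    using blob_absorbs_biclique[OF P AB] card v blobD(3)[OF AB] by simp_all
  moreover have "v \<notin> C"
  proof
    assume "v \<in> C"
    moreover obtain y where "y \<in> B" using blob_sidesD(7)[OF AB] by blast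
    ultimately have "edge v y \<in> P - K {v} {..<n}" using biclique_edge[OF CD(1)] CD(3) by blast
    then show False using \<open>y \<in> B\<close> blob_sidesD(2)[OF AB] by auto
  qed
  ultimately show "C \<subseteq> A - {v} \<and> D \<subseteq> B" by blast
qed

lemma weight_remove_vertex_ge:
  assumes P: "saturated P" and AB: "(A, B) \<in> blobs P" "v \<in> A"
    and only: "\<And>p. p \<in> blobs P \<Longrightarrow> v \<in> fst p \<Longrightarrow> p = (A, B)"
  shows "rect_weight (A - {v}, B) + (\<Sum>p\<in>blobs P - {(A, B)}. rect_weight p)
    \<le> weight (P - K {v} {..<n})"
proof -
  let ?P = "P - K {v} {..<n}" and ?rest = "blobs P - {(A, B)}"
  have rest: "?rest \<subseteq> blobs ?P"
  proof
    fix p assume p: "p \<in> ?rest"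
    then have "v \<notin> fst p" using only by blast
    then show "p \<in> blobs ?P" using p blob_remove_other_vertex[of "fst p" "snd p" P v] by simp
  qed
  have "rect_weight (A - {v}, B) + (\<Sum>p\<in>?rest. rect_weight p) \<le> (\<Sum>p\<in>blobs ?P. rect_weight p)"
  proof (cases "4 \<le> card A")
    case True
    have "(A - {v}, B) \<notin> blobs P"
      using blob_maximal(1)[OF _ blobD(1)[OF AB(1)], of "A - {v}" B] AB(2) by blast
    then have "rect_weight (A - {v}, B) + (\<Sum>p\<in>?rest. rect_weight p)
        = (\<Sum>p\<in>insert (A - {v}, B) ?rest. rect_weight p)"
      using finite_blobs by simp
    also have "\<dots> \<le> (\<Sum>p\<in>blobs ?P. rect_weight p)"
      using finite_blobs rest blob_remove_vertex[OF P AB True] by (intro sum_mono2) auto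
    finally show ?thesis .
  next
    case False
    then have "rect_weight (A - {v}, B) = 0"
      using AB(2) by (simp add: rect_weight_def card_Diff_singleton)
    then show ?thesis
      using sum_mono2[OF finite_blobs rest, of rect_weight] by (simp only: add_0_left)
  qed
  then show ?thesis by (simp add: weight_def)
qed

lemma weight_remove_vertex:
  assumes P: "saturated P" and AB: "(A, B) \<in> blobs P" "v \<in> A"
    and only: "\<And>p. p \<in> blobs P \<Longrightarrow> v \<in> fst p \<Longrightarrow> p = (A, B)"
  shows "weight P \<le> weight (P - K {v} {..<n}) + (card B - 2)"
proof -
  have "weight P = rect_weight (A, B) + (\<Sum>p\<in>blobs P - {(A, B)}. rect_weight p)"
    unfolding weight_def using finite_blobs AB by (intro sum.remove) auto
  moreover have "rect_weight (A, B) = rect_weight (A - {v}, B) + (card B - 2)"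
  proof -
    obtain a where "card A = 3 + a" using blobD(2)[OF AB(1)] le_Suc_ex by blast
    then show ?thesis using AB(2) by (simp add: rect_weight_def card_Diff_singleton)
  qed
  ultimately show ?thesis using weight_remove_vertex_ge[OF P AB only] by simp
qed

end

section \<open>Counting pairs covered by rectangles\<close>

definition star :: "('a set \<times> 'b set) set \<Rightarrow> 'a \<Rightarrow> ('a set \<times> 'b set) set" where
  "star \<B> v = {p \<in> \<B>. v \<in> fst p}"

definition sparse_star :: "('a set \<times> 'b set) set \<Rightarrow> 'a \<Rightarrow> bool" where
  "sparse_star \<B> v \<longleftrightarrow> (\<Sum>p\<in>star \<B> v. card (snd p) - 2) + 3 \<le> card (\<Union>p\<in>star \<B> v. snd p)"

lemma star_iff [simp]: "p \<in> star \<B> v \<longleftrightarrow> p \<in> \<B> \<and> v \<in> fst p"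
  by (simp add: star_def)

definition private_vertex :: "('a set \<times> 'a set) set \<Rightarrow> 'a \<Rightarrow> bool" where
  "private_vertex \<B> v \<longleftrightarrow> card (star \<B> v) = 1 \<or> card (star (prod.swap ` \<B>) v) = 1"

lemma finite_star: "finite \<B> \<Longrightarrow> finite (star \<B> v)"
  by (simp add: star_def)

lemma sum_sparse_stars_le:
  fixes \<B> :: "('a set \<times> 'b set) set"
  assumes fin: "finite \<B>" "\<And>p. p \<in> \<B> \<Longrightarrow> finite (fst p) \<and> finite (snd p)"
    and sparse: "\<And>v. v \<in> (\<Union>p\<in>\<B>. fst p) \<Longrightarrow> sparse_star \<B> v"
  shows "(\<Sum>p\<in>\<B>. card (fst p) * (card (snd p) - 2)) + 3 * card (\<Union>p\<in>\<B>. fst p)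
    \<le> card (\<Union>p\<in>\<B>. fst p \<times> snd p)"
proof -
  define V where "V = (\<Union>p\<in>\<B>. fst p)"
  have fin_V: "finite V" using fin by (simp add: V_def)
  have "(\<Union>p\<in>\<B>. fst p \<times> snd p) = (SIGMA v:V. \<Union>p\<in>star \<B> v. snd p)" by (force simp: V_def)
  then have card: "card (\<Union>p\<in>\<B>. fst p \<times> snd p) = (\<Sum>v\<in>V. card (\<Union>p\<in>star \<B> v. snd p))"
    using fin fin_V by (simp add: card_SigmaI finite_star)
  have "(\<Sum>v\<in>V. \<Sum>p\<in>star \<B> v. card (snd p) - 2) = (\<Sum>p\<in>\<B>. \<Sum>v\<in>{v \<in> V. v \<in> fst p}. card (snd p) - 2)"
    unfolding star_def using fin_V fin(1) by (rule sum.swap_restrict)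
  also have "\<dots> = (\<Sum>p\<in>\<B>. card (fst p) * (card (snd p) - 2))"
  proof (rule sum.cong)
    fix p assume "p \<in> \<B>"
    then have "{v \<in> V. v \<in> fst p} = fst p" by (auto simp: V_def)
    then show "(\<Sum>v\<in>{v \<in> V. v \<in> fst p}. card (snd p) - 2) = card (fst p) * (card (snd p) - 2)"
      by simp
  qed simp
  finally have "(\<Sum>p\<in>\<B>. card (fst p) * (card (snd p) - 2)) + 3 * card V
      = (\<Sum>v\<in>V. (\<Sum>p\<in>star \<B> v. card (snd p) - 2) + 3)"
    unfolding sum.distrib by simp
  also have "\<dots> \<le> (\<Sum>v\<in>V. card (\<Union>p\<in>star \<B> v. snd p))"
    using sparse by (intro sum_mono) (simp add: sparse_star_def V_def)
  finally show ?thesis unfolding card V_def .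
qed

lemma rectangle_side_inequality:
  fixes a b :: nat
  assumes "3 \<le> a" "3 \<le> b"
  shows "a * b + 3 * ((a - 2) * (b - 2)) \<le> 2 * (a * (b - 2)) + 2 * (b * (a - 2))"
proof -
  obtain x y where "a = 3 + x" "b = 3 + y" using assms le_Suc_ex by metis
  then show ?thesis by (simp add: algebra_simps)
qed

lemma sparse_stars_cover_large:
  fixes \<B> :: "('a set \<times> 'b set) set"
  assumes fin: "finite \<B>"
    and \<B>: "\<And>p. p \<in> \<B> \<Longrightarrow> finite (fst p) \<and> finite (snd p) \<and> 3 \<le> card (fst p) \<and> 3 \<le> card (snd p)"
    and left: "\<And>v. v \<in> (\<Union>p\<in>\<B>. fst p) \<Longrightarrow> sparse_star \<B> v"
    and right: "\<And>v. v \<in> (\<Union>p\<in>\<B>. snd p) \<Longrightarrow> sparse_star (prod.swap ` \<B>) v"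
  shows "(\<Sum>p\<in>\<B>. rect_weight p)
      + 2 * (card (\<Union>p\<in>\<B>. fst p) + card (\<Union>p\<in>\<B>. snd p)) < card (\<Union>p\<in>\<B>. fst p \<times> snd p) + 4"
proof -
  let ?T = "\<Union>p\<in>\<B>. fst p \<times> snd p"
  let ?L = "\<Sum>p\<in>\<B>. card (fst p) * (card (snd p) - 2)"
  let ?R = "\<Sum>p\<in>\<B>. card (snd p) * (card (fst p) - 2)"
  let ?W = "\<Sum>p\<in>\<B>. rect_weight p"
  have L: "?L + 3 * card (\<Union>p\<in>\<B>. fst p) \<le> card ?T"
    using \<B> by (intro sum_sparse_stars_le fin left) auto
  have "(\<Union>p\<in>prod.swap ` \<B>. fst p \<times> snd p) = prod.swap ` ?T" by force
  then have "card (\<Union>p\<in>prod.swap ` \<B>. fst p \<times> snd p) = card ?T" by (simp add: card_image)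
  then have R: "?R + 3 * card (\<Union>p\<in>\<B>. snd p) \<le> card ?T"
    using sum_sparse_stars_le[of "prod.swap ` \<B>"] fin \<B> right by (auto simp: sum.reindex)
  have T: "card ?T \<le> (\<Sum>p\<in>\<B>. card (fst p) * card (snd p))"
    using card_UN_le[OF fin, of "\<lambda>p. fst p \<times> snd p"] by (simp add: card_cartesian_product)
  have "(\<Sum>p\<in>\<B>. card (fst p) * card (snd p)) + 3 * ?W
      = (\<Sum>p\<in>\<B>. card (fst p) * card (snd p) + 3 * rect_weight p)"
    by (simp add: sum.distrib sum_distrib_left)
  also have "\<dots> \<le> (\<Sum>p\<in>\<B>. 2 * (card (fst p) * (card (snd p) - 2))
      + 2 * (card (snd p) * (card (fst p) - 2)))"
    unfolding rect_weight_def using \<B> by (intro sum_mono rectangle_side_inequality) auto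
  also have "\<dots> = 2 * ?L + 2 * ?R" by (simp add: sum.distrib sum_distrib_left)
  finally show ?thesis using L R T by simp
qed

context edge_grid
begin

interpretation flip: edge_grid "\<lambda>i j. edge j i" n m
  by (rule edge_grid_flip)

lemma flip_saturated: "flip.saturated P \<longleftrightarrow> saturated P"
  by (simp add: flip.saturated_def saturated_def flip_E flip_K33s)

lemma flip_blobs: "flip.blobs P = prod.swap ` blobs P"
proof -
  have "(B, A) \<in> flip.blobs P \<longleftrightarrow> (A, B) \<in> blobs P" for A B
    unfolding flip.blobs_def blobs_def flip_biclique by blast
  then show ?thesis by (auto simp: image_iff) force
qed

lemma flip_weight: "flip.weight P = weight P"
  unfolding flip.weight_def weight_def flip_blobs
  by (simp add: sum.reindex rect_weight_def mult.commute)

definition relabel :: "(nat \<Rightarrow> nat) \<Rightarrow> 'e \<Rightarrow> 'e" where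
  "relabel \<sigma> e = (case coords e of (i, j) \<Rightarrow> edge (\<sigma> i) j)"

lemma relabel_edge [simp]: "relabel \<sigma> (edge i j) = edge (\<sigma> i) j"
  by (simp add: relabel_def)

lemma relabel_K: "relabel \<sigma> ` K A B = K (\<sigma> ` A) B"
  by (force simp: K_def image_iff)

lemma relabel_E: "\<sigma> ` {..<m} = {..<m} \<Longrightarrow> relabel \<sigma> ` E = E"
  by (simp add: E_def relabel_K)

lemma inj_on_relabel: "inj_on \<sigma> {..<m} \<Longrightarrow> inj_on (relabel \<sigma>) E"
  by (rule inj_onI) (auto elim!: E_edgeE dest: inj_onD)

lemma K33s_subset_relabel:
  assumes "bij_betw \<sigma> {..<m} {..<m}"
  shows "K33s \<subseteq> (`) (relabel \<sigma>) ` K33s"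
proof
  have \<sigma>: "inj_on \<sigma> {..<m}" "\<sigma> ` {..<m} = {..<m}" using assms by (simp_all add: bij_betw_def)
  fix X assume "X \<in> K33s"
  then obtain A B where X: "X = K A B" "A \<subseteq> {..<m}" "B \<subseteq> {..<n}" "card A = 3" "card B = 3"
    by (rule K33sE)
  have "A \<subseteq> \<sigma> ` {..<m}" using X(2) \<sigma>(2) by simp
  then obtain C where C: "C \<subseteq> {..<m}" "A = \<sigma> ` C" by (rule subset_imageE)
  then have "card C = 3" using X(4) card_image[OF inj_on_subset[OF \<sigma>(1)]] by metis
  then have "K C B \<in> K33s" using C(1) X(3,5) by (intro K33sI)
  moreover have "X = relabel \<sigma> ` K C B" by (simp add: relabel_K X(1) C(2))
  ultimately show "X \<in> (`) (relabel \<sigma>) ` K33s" by blast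
qed

end

section \<open>The nullity formula\<close>

context greatest_K33_matroid
begin

text \<open>The bipartite counterpart of the rank formula conjectured by Dress for rigidity matroids.\<close>

definition nullity_formula :: "'e set \<Rightarrow> bool" where
  "nullity_formula P \<longleftrightarrow> nullity P = weight P"

definition blob_nullity :: "'e set \<Rightarrow> 'e set \<Rightarrow> nat" where
  "blob_nullity F P = (\<Sum>p\<in>blobs F. nullity (P \<inter> K (fst p) (snd p)))"

interpretation flip: greatest_K33_matroid "\<lambda>i j. edge j i" n m M
  by (rule greatest_K33_matroid_flip)

lemma flip_nullity_formula: "flip.nullity_formula P \<longleftrightarrow> nullity_formula P"
  by (simp add: flip.nullity_formula_def nullity_formula_def flip_weight)

lemma flip_blob_nullity: "flip.blob_nullity F P = blob_nullity F P"
  unfolding flip.blob_nullity_def blob_nullity_def flip_blobs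
  by (simp add: sum.reindex flip_K)

lemma saturated_flat:
  assumes "flat F"
  shows "saturated F"
  unfolding saturated_def
proof (intro conjI ballI allI impI)
  show "F \<subseteq> E" using assms by (rule flat_subset_ground)
  fix X e assume X: "X \<in> K33s" "X - {e} \<subseteq> F"
  have "e \<in> F" if "e \<in> X"
    using circuit_in_closure[OF circuit_K33[OF X(1)] that X(2)] assms by (auto simp: flat_def)
  then show "X \<subseteq> F" using X(2) by blast
qed

lemma nullity_blob: "p \<in> blobs P \<Longrightarrow> nullity (K (fst p) (snd p)) = rect_weight p"
  using blobD(2,3)[of "fst p" "snd p" P] blob_sidesD(1,2)[of "fst p" "snd p" P]
  unfolding rect_weight_def by (intro nullity_K) auto

lemma blob_nullity_self: "blob_nullity F F = weight F"
  unfolding blob_nullity_def weight_def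
proof (rule sum.cong)
  fix p assume p: "p \<in> blobs F"
  then have "F \<inter> K (fst p) (snd p) = K (fst p) (snd p)"
    using blob_sidesD(3)[of "fst p" "snd p" F] by (simp add: Int_absorb1)
  then show "nullity (F \<inter> K (fst p) (snd p)) = rect_weight p" using nullity_blob[OF p] by simp
qed simp

lemma blob_nullity_eq_weight:
  assumes "saturated F" "P \<subseteq> F" "\<And>A B. (A, B) \<in> blobs F \<Longrightarrow> nullity_formula (P \<inter> K A B)"
  shows "blob_nullity F P = weight P"
  unfolding blob_nullity_def weight_eq_sum_traces[OF assms(1,2)]
  using assms(3) by (intro sum.cong) (auto simp: nullity_formula_def)

lemma blob_nullity_mono: "P \<subseteq> Q \<Longrightarrow> finite Q \<Longrightarrow> blob_nullity F P \<le> blob_nullity F Q"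
  unfolding blob_nullity_def by (intro sum_mono) (auto intro!: nullity_mono)

lemma blob_nullity_supermodular:
  assumes "finite P" "finite Q"
  shows "blob_nullity F P + blob_nullity F Q \<le> blob_nullity F (P \<union> Q) + blob_nullity F (P \<inter> Q)"
proof -
  have "nullity (P \<inter> X) + nullity (Q \<inter> X) \<le> nullity ((P \<union> Q) \<inter> X) + nullity ((P \<inter> Q) \<inter> X)" for X
    using nullity_supermodular[of "P \<inter> X" "Q \<inter> X"] assms
    by (simp add: Int_Un_distrib2 Int_assoc Int_left_commute)
  then show ?thesis
    unfolding blob_nullity_def sum.distrib[symmetric] by (intro sum_mono) auto
qed

lemma blob_nullity_flat:
  assumes F: "flat F" and smaller: "\<And>G. flat G \<Longrightarrow> rank G < k \<Longrightarrow> nullity_formula G"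
    and G: "flat G" "G \<subseteq> F" "rank G < k"
  shows "blob_nullity F G = nullity G"
proof -
  have "nullity_formula (G \<inter> K A B)" if "(A, B) \<in> blobs F" for A B
  proof (rule smaller)
    show "flat (G \<inter> K A B)" using flat_Int[OF G(1) flat_K] blob_sidesD(1,2)[OF that] .
    show "rank (G \<inter> K A B) < k" using rank_mono[of "G \<inter> K A B" G] G(3) by simp
  qed
  then have "blob_nullity F G = weight G"
    by (rule blob_nullity_eq_weight[OF saturated_flat[OF F] G(2)])
  then show ?thesis using smaller[OF G(1,3)] by (simp add: nullity_formula_def)
qed

lemma sum_nullity_traces_le:
  assumes v: "v < m" and P: "P \<subseteq> E" and fin: "finite \<B>"
    and \<B>: "\<And>p. p \<in> \<B> \<Longrightarrow> snd p \<subseteq> {..<n}"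
    and meet: "\<And>p q. p \<in> \<B> \<Longrightarrow> q \<in> \<B> \<Longrightarrow> p \<noteq> q \<Longrightarrow> fst p \<inter> fst q \<subseteq> {v}"
  shows "(\<Sum>p\<in>\<B>. nullity (P \<inter> K (fst p) (snd p))) \<le> nullity P"
proof -
  have "(\<Sum>p\<in>\<B>. nullity (P \<inter> K (fst p) (snd p))) \<le> nullity (P \<inter> (\<Union>p\<in>\<B>. K (fst p) (snd p)))"
    using fin \<B> meet
  proof (induction \<B>)
    case (insert p \<B>)
    let ?T = "P \<inter> K (fst p) (snd p)" and ?U = "P \<inter> (\<Union>q\<in>\<B>. K (fst q) (snd q))"
    have "K (fst p) (snd p) \<inter> K (fst q) (snd q) \<subseteq> K {v} {..<n}" if "q \<in> \<B>" for q
    proof -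
      have "fst p \<inter> fst q \<subseteq> {v}" using insert.prems(2)[of p q] insert.hyps(2) that by blast
      moreover have "snd p \<inter> snd q \<subseteq> {..<n}" using insert.prems(1)[of p] by auto
      ultimately show ?thesis unfolding K_Int by (rule K_mono)
    qed
    then have "?T \<inter> ?U \<subseteq> K {v} {..<n}" by blast
    then have "?T \<inter> ?U \<in> M" by (rule indep_subset[OF star_indep[OF v subset_refl]])
    then have "nullity ?T + nullity ?U \<le> nullity (?T \<union> ?U)"
      using nullity_supermodular[of ?T ?U] finite_subset_ground[OF P] by (simp add: nullity_indep)
    moreover have "(\<Sum>q\<in>\<B>. nullity (P \<inter> K (fst q) (snd q))) \<le> nullity ?U"
      by (rule insert.IH) (use insert.prems in blast)+
    moreover have "?T \<union> ?U = P \<inter> (\<Union>q\<in>insert p \<B>. K (fst q) (snd q))" by blast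
    ultimately show ?case using insert.hyps by simp
  qed simp
  also have "\<dots> \<le> nullity P" using finite_subset_ground[OF P] by (intro nullity_mono) auto
  finally show ?thesis .
qed

lemma K_image_subset_closure:
  assumes \<sigma>: "bij_betw \<sigma> {..<m} {..<m}" and Y: "Y \<subseteq> E" "relabel \<sigma> ` Y \<subseteq> Y"
    and K: "K A B \<subseteq> closure Y"
  shows "K (\<sigma> ` A) B \<subseteq> closure Y"
proof -
  have \<sigma>': "inj_on \<sigma> {..<m}" "\<sigma> ` {..<m} = {..<m}" using \<sigma> by (simp_all add: bij_betw_def)
  note relabel = inj_on_relabel[OF \<sigma>'(1)] relabel_E[OF \<sigma>'(2)]
  have "(`) (relabel \<sigma>) ` M = M"
    by (rule greatest_matroid_invariant[OF greatest relabel K33s_subset_relabel[OF \<sigma>]])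
  then have "relabel \<sigma> ` closure Y \<subseteq> closure (relabel \<sigma> ` Y)"
    using image_in_closure[OF relabel _ Y(1)] by blast
  also have "\<dots> \<subseteq> closure Y" using Y(2) by (rule closure_mono)
  finally show ?thesis using K unfolding relabel_K[symmetric] by blast
qed

end

section \<open>Stars of blobs\<close>

text \<open>The vertices \<open>x p\<close> and \<open>x' p\<close> are twins in the skeleton below; the symmetry of the greatest
  matroid therefore confines the blobs of its closure.\<close>

locale star_system = greatest_K33_matroid edge m n M
  for edge :: "nat \<Rightarrow> nat \<Rightarrow> 'e" and m n M +
  fixes P :: "'e set" and v :: nat and x x' :: "nat set \<times> nat set \<Rightarrow> nat"
  assumes saturated_P: "saturated P" and v_less: "v < m"
    and twins: "p \<in> star (blobs P) v \<Longrightarrow>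
      x p \<in> fst p - {v} \<and> x' p \<in> fst p - {v} \<and> x p \<noteq> x' p"
begin

abbreviation star_blobs :: "(nat set \<times> nat set) set" where
  "star_blobs \<equiv> star (blobs P) v"

abbreviation triple :: "nat set \<times> nat set \<Rightarrow> nat set" where
  "triple p \<equiv> {v, x p, x' p}"

definition left_part :: "nat set" where
  "left_part = insert v (\<Union>p\<in>star_blobs. {x p, x' p})"

definition right_part :: "nat set" where
  "right_part = (\<Union>p\<in>star_blobs. snd p)"

definition skeleton :: "'e set" where
  "skeleton = (\<Union>p\<in>star_blobs. K (triple p) (snd p))"

lemma finite_star_blobs: "finite star_blobs"
  by (simp add: finite_star finite_blobs)

lemma star_blobD: "p \<in> star_blobs \<Longrightarrow> (fst p, snd p) \<in> blobs P"
  by simp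

lemma triple_subset: "p \<in> star_blobs \<Longrightarrow> triple p \<subseteq> fst p"
  using twins[of p] by auto

lemma card_triple: "p \<in> star_blobs \<Longrightarrow> card (triple p) = 3"
  using twins[of p] by auto

lemma star_blob_eqI: "p \<in> star_blobs \<Longrightarrow> q \<in> star_blobs \<Longrightarrow> u \<in> fst p \<Longrightarrow> u \<in> fst q \<Longrightarrow> u \<noteq> v \<Longrightarrow> p = q"
  using blob_eqI[OF saturated_P, of p q u v] by simp

lemma skeleton_subset: "skeleton \<subseteq> P"
proof -
  have "K (triple p) (snd p) \<subseteq> P" if "p \<in> star_blobs" for p
    using K_mono[OF triple_subset[OF that] subset_refl] blob_sidesD(3)[OF star_blobD[OF that]]
    by (rule order_trans)
  then show ?thesis unfolding skeleton_def by (rule UN_least)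
qed

lemma skeleton_subset_E: "skeleton \<subseteq> E"
  using skeleton_subset saturated_subset_E[OF saturated_P] by (rule order_trans)

lemma left_part_subset: "left_part \<subseteq> {..<m}"
proof -
  have "triple p \<subseteq> {..<m}" if "p \<in> star_blobs" for p
    using triple_subset[OF that] blob_sidesD(1)[OF star_blobD[OF that]] by (rule order_trans)
  then show ?thesis using v_less by (auto simp: left_part_def)
qed

lemma right_part_subset: "right_part \<subseteq> {..<n}"
  unfolding right_part_def using blob_sidesD(2)[OF star_blobD] by (rule UN_least)

lemma closure_skeleton_subset: "closure skeleton \<subseteq> K left_part right_part"
proof (rule closure_subset_flat[OF flat_K[OF left_part_subset right_part_subset]])
  show "skeleton \<subseteq> K left_part right_part"
    unfolding skeleton_def left_part_def right_part_def by (intro UN_least K_mono) blast+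
qed

lemma biclique_closure_sides:
  assumes "biclique (closure skeleton) C D" "C \<noteq> {}" "D \<noteq> {}"
  shows "C \<subseteq> left_part" "D \<subseteq> right_part"
  using K_subset_K_D[OF order_trans[OF bicliqueD(3)[OF assms(1)] closure_skeleton_subset]
    assms(2,3)] .

lemma biclique_closure_meets_twins:
  assumes CD: "biclique (closure skeleton) C D" "2 \<le> card C" "D \<noteq> {}"
  shows "\<exists>p\<in>star_blobs. x p \<in> C \<or> x' p \<in> C"
proof -
  obtain a b where "a \<in> C" "b \<in> C" "a \<noteq> b" by (rule card_ge_2E[OF CD(2)])
  then obtain z where "z \<in> C" "z \<noteq> v" by blast
  then show ?thesis using biclique_closure_sides(1)[OF CD(1) _ CD(3)] by (auto simp: left_part_def)
qed

lemma relabel_skeleton: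
  assumes "p \<in> star_blobs"
  shows "relabel (transpose (x p) (x' p)) ` skeleton \<subseteq> skeleton"
proof -
  have "transpose (x p) (x' p) i \<in> triple q" if q: "q \<in> star_blobs" and i: "i \<in> triple q" for q i
  proof (cases "i = x p \<or> i = x' p")
    case True
    then have "i \<in> fst p" "i \<in> fst q" "i \<noteq> v"
      using twins[OF assms] triple_subset[OF q] i by auto
    then have "q = p" using star_blob_eqI[OF q assms] by blast
    then show ?thesis using True by auto
  next
    case False
    then show ?thesis using i by simp
  qed
  then have "transpose (x p) (x' p) ` triple q \<subseteq> triple q" if "q \<in> star_blobs" for q
    using that by blast
  then have "K (transpose (x p) (x' p) ` triple q) (snd q) \<subseteq> skeleton" if "q \<in> star_blobs" for q
    using K_mono[of "transpose (x p) (x' p) ` triple q" "triple q" "snd q" "snd q"] that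
    unfolding skeleton_def by blast
  then show ?thesis unfolding skeleton_def image_UN relabel_K by blast
qed

lemma biclique_absorbs_twins:
  assumes Q: "saturated Q" "closure skeleton \<subseteq> Q"
    and CD: "biclique (closure skeleton) C D" "3 \<le> card C" "2 \<le> card D"
    and p: "p \<in> star_blobs" "x p \<in> C \<or> x' p \<in> C"
  shows "biclique Q (C \<union> {x p, x' p}) D"
proof (cases "x p \<in> C \<and> x' p \<in> C")
  case True
  then have "C \<union> {x p, x' p} = C" by blast
  then show ?thesis using biclique_mono[OF CD(1) Q(2)] by simp
next
  case False
  let ?t = "transpose (x p) (x' p)"
  have xm: "x p < m" "x' p < m"
    using twins[OF p(1)] blob_sidesD(1)[OF star_blobD[OF p(1)]] by auto
  have "K (?t ` C) D \<subseteq> closure skeleton"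
    using xm bicliqueD(3)[OF CD(1)]
    by (intro K_image_subset_closure skeleton_subset_E relabel_skeleton[OF p(1)]) simp_all
  moreover have "?t ` C \<subseteq> {..<m}" using bicliqueD(1)[OF CD(1)] xm by (auto simp: transpose_def)
  ultimately have tCD: "biclique (closure skeleton) (?t ` C) D"
    using CD(1) by (simp add: biclique_def)
  have "C - {x p, x' p} \<subseteq> C \<inter> ?t ` C"
  proof
    fix i assume "i \<in> C - {x p, x' p}"
    then show "i \<in> C \<inter> ?t ` C" by (auto intro!: image_eqI[of _ _ i])
  qed
  then have "card (C - {x p, x' p}) \<le> card (C \<inter> ?t ` C)"
    using bicliqueD(4)[OF CD(1)] by (intro card_mono) auto
  moreover obtain z where "z \<in> C" "C - {x p, x' p} = C - {z}" using p(2) False by blast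
  ultimately have "2 \<le> card (C \<inter> ?t ` C)" using CD(2) by simp
  then have "biclique Q (C \<union> ?t ` C) (D \<union> D)"
    using biclique_Un[OF Q(1) biclique_mono[OF CD(1) Q(2)] biclique_mono[OF tCD Q(2)]] CD(3) by simp
  moreover have "C \<union> {x p, x' p} \<subseteq> C \<union> ?t ` C"
    using p(2) False by (auto intro: image_eqI[of _ _ "x p"] image_eqI[of _ _ "x' p"])
  ultimately show ?thesis by (rule biclique_subset) simp
qed

lemma closure_blob_sides:
  assumes P: "closure skeleton \<subseteq> P" and CD: "(C, D) \<in> blobs (closure skeleton)"
  shows "\<exists>p\<in>star_blobs. C = triple p \<and> D = snd p"
proof -
  have card: "2 \<le> card C" "2 \<le> card D" using blobD(2,3)[OF CD] by simp_all
  obtain p where p: "p \<in> star_blobs" "x p \<in> C \<or> x' p \<in> C"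
    using biclique_closure_meets_twins[OF blobD(1)[OF CD] card(1) blob_sidesD(7)[OF CD]] by blast
  have "biclique P (C \<union> {x p, x' p}) D"
    using biclique_absorbs_twins[OF saturated_P P blobD(1,2)[OF CD] card(2) p] .
  moreover have "2 \<le> card (fst p \<inter> (C \<union> {x p, x' p}))"
    using twins[OF p(1)] blob_sidesD(4)[OF star_blobD[OF p(1)]]
    by (intro card_ge_2I[of _ "x p" "x' p"]) auto
  ultimately have sub: "C \<union> {x p, x' p} \<subseteq> fst p" "D \<subseteq> snd p"
    using blob_absorbs_biclique[OF saturated_P star_blobD[OF p(1)] _ card(2)] by blast+
  have "C \<subseteq> triple p"
  proof
    fix u assume u: "u \<in> C"
    show "u \<in> triple p"
    proof (cases "u = v")
      case False
      then obtain q where q: "q \<in> star_blobs" "u \<in> {x q, x' q}"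
        using biclique_closure_sides(1)[OF blobD(1) blob_sidesD(6,7), OF CD CD CD] u
        by (auto simp: left_part_def)
      then have "u \<in> fst q" using twins[OF q(1)] by auto
      then have "q = p" using star_blob_eqI[OF q(1) p(1)] sub(1) u False by blast
      then show ?thesis using q(2) by blast
    qed simp
  qed
  then have C: "C = triple p"
    using card_triple[OF p(1)] blobD(2)[OF CD] by (intro card_seteq) auto
  have "K C (snd p) \<subseteq> closure skeleton"
    using subset_closure[OF skeleton_subset_E] p(1) unfolding C skeleton_def by blast
  then have "biclique (closure skeleton) C (snd p)"
    using blob_sidesD(1)[OF CD] blob_sidesD(2)[OF star_blobD[OF p(1)]] by (simp add: biclique_def)
  then have "snd p = D" using blob_maximal(2)[OF CD _ subset_refl sub(2)] by blast
  then show ?thesis using C p(1) by blast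
qed

lemma weight_closure_skeleton_le:
  assumes "closure skeleton \<subseteq> P"
  shows "weight (closure skeleton) \<le> (\<Sum>p\<in>star_blobs. card (snd p) - 2)"
proof -
  have "blobs (closure skeleton) \<subseteq> (\<lambda>p. (triple p, snd p)) ` star_blobs"
    using closure_blob_sides[OF assms] by (auto simp: image_iff)
  then have "weight (closure skeleton) \<le> (\<Sum>q\<in>(\<lambda>p. (triple p, snd p)) ` star_blobs. rect_weight q)"
    unfolding weight_def using finite_star_blobs by (intro sum_mono2) auto
  also have "\<dots> \<le> (\<Sum>p\<in>star_blobs. rect_weight (triple p, snd p))"
    using sum_image_le[OF finite_star_blobs, of rect_weight "\<lambda>p. (triple p, snd p)"]
    by (simp add: comp_def)
  also have "\<dots> = (\<Sum>p\<in>star_blobs. card (snd p) - 2)"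
    using card_triple by (intro sum.cong) (simp_all add: rect_weight_def)
  finally show ?thesis .
qed

lemma twins_disjoint:
  assumes "p \<in> star_blobs" "q \<in> star_blobs" "p \<noteq> q"
  shows "{x p, x' p} \<inter> {x q, x' q} = {}"
  using star_blob_eqI[OF assms(1,2)] twins[OF assms(1)] twins[OF assms(2)] assms(3) by auto

lemma card_left_part: "card left_part = 1 + 2 * card star_blobs"
proof -
  have "card (\<Union>p\<in>star_blobs. {x p, x' p}) = (\<Sum>p\<in>star_blobs. card {x p, x' p})"
    using twins_disjoint by (intro card_UN_disjoint finite_star_blobs) auto
  also have "\<dots> = (\<Sum>p\<in>star_blobs. 2)" using twins by (intro sum.cong) simp_all
  finally have "card (\<Union>p\<in>star_blobs. {x p, x' p}) = 2 * card star_blobs" by simp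
  moreover have "v \<notin> (\<Union>p\<in>star_blobs. {x p, x' p})" using twins by blast
  moreover have "finite (\<Union>p\<in>star_blobs. {x p, x' p})" using finite_star_blobs by simp
  ultimately show ?thesis unfolding left_part_def by simp
qed

lemma card_skeleton: "card skeleton = card right_part + 2 * (\<Sum>p\<in>star_blobs. card (snd p))"
proof -
  let ?U = "\<Union>p\<in>star_blobs. K {x p, x' p} (snd p)"
  have fin: "finite (K {x p, x' p} (snd p))" if "p \<in> star_blobs" for p
    using blob_sidesD(5)[OF star_blobD[OF that]] by (simp add: finite_K)
  have "card ?U = (\<Sum>p\<in>star_blobs. card (K {x p, x' p} (snd p)))"
    using fin twins_disjoint by (intro card_UN_disjoint finite_star_blobs) (auto simp: K_Int)
  also have "\<dots> = (\<Sum>p\<in>star_blobs. 2 * card (snd p))"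
    using twins by (intro sum.cong) (simp_all add: card_K)
  finally have card_U: "card ?U = 2 * (\<Sum>p\<in>star_blobs. card (snd p))" by (simp add: sum_distrib_left)
  have "K {v} right_part \<inter> K {x p, x' p} (snd p) = {}" if "p \<in> star_blobs" for p
    using twins[OF that] by (simp add: K_Int)
  then have disjoint: "K {v} right_part \<inter> ?U = {}" by blast
  have "finite (K {v} right_part)"
    using finite_if_subset_lessThan[OF right_part_subset] by (simp add: finite_K)
  moreover have "finite ?U" using finite_star_blobs fin by blast
  moreover have "skeleton = K {v} right_part \<union> ?U"
    unfolding skeleton_def right_part_def by (auto simp: K_def)
  ultimately show ?thesis using card_Un_disjoint[OF _ _ disjoint] card_U by (simp add: card_K)
qed

lemma rank_closure_skeleton_le:
  assumes P: "closure skeleton \<subseteq> P" and two: "2 \<le> card star_blobs"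
  shows "rank (closure skeleton) + 5 \<le> 2 * (card left_part + card right_part)"
proof -
  have "star_blobs \<noteq> {}" using two by auto
  then obtain p where p: "p \<in> star_blobs" by blast
  have finite_right_part: "finite right_part"
    using right_part_subset by (rule finite_if_subset_lessThan)
  have "snd p \<subseteq> right_part" using p by (auto simp: right_part_def)
  then have card_right_part: "3 \<le> card right_part"
    using blobD(3)[OF star_blobD[OF p]] card_mono[OF finite_right_part] by (meson order_trans)
  have "rank (closure skeleton) \<noteq> rank (K left_part right_part)"
  proof
    assume "rank (closure skeleton) = rank (K left_part right_part)"
    then have "closure skeleton = K left_part right_part"
      using flat_eqI_rank[OF flat_closure[OF skeleton_subset_E] closure_skeleton_subset]
        K_subset_E[OF left_part_subset right_part_subset] by simp
    then have whole: "biclique (closure skeleton) left_part right_part"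
      using left_part_subset right_part_subset by (simp add: biclique_def)
    have "3 \<le> card left_part" using card_left_part two by simp
    then obtain C D where CD: "(C, D) \<in> blobs (closure skeleton)" "left_part \<subseteq> C" "right_part \<subseteq> D"
      using biclique_extends_to_blob[OF whole _ card_right_part] by blast
    then obtain q where "q \<in> star_blobs" "C = triple q" using closure_blob_sides[OF P] by blast
    then have "card left_part \<le> 3" using CD(2) card_triple[of q] card_mono[of C left_part] by simp
    then show False using card_left_part two by simp
  qed
  moreover have "rank (closure skeleton) \<le> rank (K left_part right_part)"
    using closure_skeleton_subset by (rule rank_mono)
  moreover have "rank (K left_part right_part) + 4 = 2 * (card left_part + card right_part)"
    using rank_K[OF left_part_subset _ right_part_subset] card_left_part card_right_part two by simp
  ultimately show ?thesis by linarith
qed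

lemma sparse_star_if_nullity_formula:
  assumes P: "closure skeleton \<subseteq> P" and two: "2 \<le> card star_blobs"
    and formula: "nullity_formula (closure skeleton)"
  shows "sparse_star (blobs P) v"
proof -
  define excess where "excess = (\<Sum>p\<in>star_blobs. card (snd p) - 2)"
  have "(\<Sum>p\<in>star_blobs. card (snd p)) = (\<Sum>p\<in>star_blobs. (card (snd p) - 2) + 2)"
    using blobD(3)[OF star_blobD] by (intro sum.cong) fastforce+
  then have "(\<Sum>p\<in>star_blobs. card (snd p)) = excess + 2 * card star_blobs"
    unfolding sum.distrib excess_def by simp
  moreover have "card skeleton \<le> card (closure skeleton)"
    using finite_closure subset_closure[OF skeleton_subset_E] by (rule card_mono)
  moreover have "rank (closure skeleton) + weight (closure skeleton) = card (closure skeleton)"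
    using rank_plus_nullity[OF finite_closure[of skeleton]] formula
    by (simp add: nullity_formula_def)
  ultimately have "excess + 3 \<le> card right_part"
    using weight_closure_skeleton_le[OF P, folded excess_def] rank_closure_skeleton_le[OF P two]
      card_left_part card_skeleton by simp
  then show ?thesis by (simp add: sparse_star_def right_part_def excess_def)
qed

lemma spanning_star_meets_blob:
  assumes F: "saturated F" "P \<subseteq> F" "closure skeleton \<subseteq> F" and span: "P \<subseteq> closure skeleton"
    and CD: "(C, D) \<in> blobs F" and trace: "blobs (P \<inter> K C D) \<noteq> {}"
  shows "v \<in> C"
proof -
  obtain A B where AB: "(A, B) \<in> blobs (P \<inter> K C D)" using trace by auto
  have AB_closure: "biclique (closure skeleton) A B"
    using blobD(1)[OF AB] by (rule biclique_mono) (use span in auto)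
  have card: "2 \<le> card A" "2 \<le> card B" using blobD(2,3)[OF AB] by simp_all
  obtain p where p: "p \<in> star_blobs" "x p \<in> A \<or> x' p \<in> A"
    using biclique_closure_meets_twins[OF AB_closure card(1) blob_sidesD(7)[OF AB]] by blast
  have absorbed: "biclique F (A \<union> {x p, x' p}) B"
    using biclique_absorbs_twins[OF F(1,3) AB_closure blobD(2)[OF AB] card(2) p] .
  have "card A \<le> card (C \<inter> (A \<union> {x p, x' p}))"
    using blob_trace_subset(1)[OF AB] blob_sidesD(4)[OF CD] by (intro card_mono) auto
  then have "2 \<le> card (C \<inter> (A \<union> {x p, x' p}))" using card(1) by linarith
  then have "A \<union> {x p, x' p} \<subseteq> C"
    by (rule blob_absorbs_biclique(1)[OF F(1) CD absorbed card(2)])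
  then have "2 \<le> card (C \<inter> fst p)"
    using twins[OF p(1)] blob_sidesD(4)[OF CD] by (intro card_ge_2I[of _ "x p" "x' p"]) auto
  moreover have "biclique F (fst p) (snd p)"
    using blobD(1)[OF star_blobD[OF p(1)]] F(2) by (rule biclique_mono)
  ultimately have "fst p \<subseteq> C"
    using blob_absorbs_biclique(1)[OF F(1) CD] blobD(3)[OF star_blobD[OF p(1)]] by simp
  then show ?thesis using p(1) by auto
qed

lemma blob_nullity_le_if_spanning:
  assumes F: "saturated F" "P \<subseteq> F" "closure skeleton \<subseteq> F" and span: "P \<subseteq> closure skeleton"
    and trace: "\<And>C D. (C, D) \<in> blobs F \<Longrightarrow> 0 < nullity (P \<inter> K C D) \<Longrightarrow> blobs (P \<inter> K C D) \<noteq> {}"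
  shows "blob_nullity F P \<le> nullity P"
proof -
  let ?\<B> = "{p \<in> blobs F. 0 < nullity (P \<inter> K (fst p) (snd p))}"
  have v: "v \<in> fst p" if "p \<in> ?\<B>" for p
    using spanning_star_meets_blob[OF F span, of "fst p" "snd p"] trace[of "fst p" "snd p"] that
    by simp
  have "blob_nullity F P = (\<Sum>p\<in>?\<B>. nullity (P \<inter> K (fst p) (snd p)))"
    unfolding blob_nullity_def
    using finite_blobs by (intro sum.mono_neutral_right) auto
  also have "\<dots> \<le> nullity P"
  proof (rule sum_nullity_traces_le[OF v_less saturated_subset_E[OF saturated_P]])
    show "finite ?\<B>" using finite_blobs by simp
    show "snd p \<subseteq> {..<n}" if "p \<in> ?\<B>" for p
      using that blob_sidesD(2)[of "fst p" "snd p" F] by simp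
    show "fst p \<inter> fst q \<subseteq> {v}" if "p \<in> ?\<B>" "q \<in> ?\<B>" "p \<noteq> q" for p q
      using blob_eqI[OF F(1), of p q _ v] v[OF that(1)] v[OF that(2)] that by blast
  qed
  finally show ?thesis .
qed

end

lemma (in greatest_K33_matroid) star_system_exists:
  assumes P: "saturated P" and nonempty: "star (blobs P) v \<noteq> {}"
  shows "\<exists>x x'. star_system edge m n M P v x x'"
proof -
  have "\<exists>a b. p \<in> star (blobs P) v \<longrightarrow> a \<in> fst p - {v} \<and> b \<in> fst p - {v} \<and> a \<noteq> b" for p
  proof (cases "p \<in> star (blobs P) v")
    case True
    then have "(fst p, snd p) \<in> blobs P" "v \<in> fst p" by simp_all
    then have "2 \<le> card (fst p - {v})" using blobD(2)[of "fst p" "snd p" P] by simp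
    then obtain a b where "a \<in> fst p - {v}" "b \<in> fst p - {v}" "a \<noteq> b" by (rule card_ge_2E)
    then show ?thesis by blast
  qed blast
  then obtain x x' where "\<And>p. p \<in> star (blobs P) v \<longrightarrow>
      x p \<in> fst p - {v} \<and> x' p \<in> fst p - {v} \<and> x p \<noteq> x' p"
    by metis
  moreover obtain p where "p \<in> star (blobs P) v" using nonempty by blast
  then have "v < m" using blob_sidesD(1)[of "fst p" "snd p" P] by auto
  ultimately have "star_system edge m n M P v x x'" using P by unfold_locales auto
  then show ?thesis by blast
qed

section \<open>Peeling off a vertex that lies in one blob\<close>

context greatest_K33_matroid
begin

definition peeling :: "'e set \<Rightarrow> 'e set \<Rightarrow> 'e set list \<Rightarrow> bool" where
  "peeling P V S \<longleftrightarrow> flat V \<and>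
     weight P + nullity (P \<inter> V) \<le> weight (P \<inter> V) + nullity P \<and>
     card (P \<inter> V) + weight P + 2 \<le> card P + weight (P \<inter> V) \<and>
     set S \<subseteq> K33s \<and> \<Union>(set S) \<subseteq> P \<and> proper_over V S \<and>
     weight P \<le> weight (P \<inter> V) + length S"

lemma proper_over_star_K33s:
  assumes "distinct zs" "y \<notin> set zs" "y' \<notin> set zs" "\<And>z. z \<in> set zs \<Longrightarrow> edge v z \<notin> V"
  shows "proper_over V (map (\<lambda>z. K {v, a, a'} {y, y', z}) zs)"
  using assms
proof (induction zs arbitrary: V)
  case (Cons z zs)
  have "\<not> K {v, a, a'} {y, y', z} \<subseteq> V"
    using Cons.prems(4)[of z] K_subsetD[of "{v, a, a'}" "{y, y', z}" V v z] by auto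
  moreover have "edge v w \<notin> K {v, a, a'} {y, y', z}" if "w \<in> set zs" for w
    using that Cons.prems(1-3) by auto
  ultimately show ?case using Cons by auto
qed simp

lemma proper_star_sequence_exists:
  assumes AB: "biclique P A B" "3 \<le> card A" "2 \<le> card B" and v: "v \<in> A"
    and V: "V \<inter> K {v} {..<n} = {}"
  shows "\<exists>S. set S \<subseteq> K33s \<and> \<Union>(set S) \<subseteq> P \<and> proper_over V S \<and> length S = card B - 2"
proof -
  note sides = bicliqueD[OF AB(1)]
  have "2 \<le> card (A - {v})" using AB(2) v by simp
  then obtain a a' where a: "a \<in> A - {v}" "a' \<in> A - {v}" "a \<noteq> a'" by (rule card_ge_2E)
  obtain y y' where y: "y \<in> B" "y' \<in> B" "y \<noteq> y'" by (rule card_ge_2E[OF AB(3)])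
  obtain zs where zs: "set zs = B - {y, y'}" "distinct zs"
    using finite_distinct_list[of "B - {y, y'}"] sides(5) by auto
  define X where "X z = K {v, a, a'} {y, y', z}" for z
  have "X z \<in> K33s \<and> X z \<subseteq> P" if "z \<in> set zs" for z
  proof
    have z: "z \<in> B" "z \<noteq> y" "z \<noteq> y'" using that zs(1) by auto
    show "X z \<in> K33s" unfolding X_def using a y z v sides(1,2) by (intro K33sI) auto
    have "X z \<subseteq> K A B" unfolding X_def using a y z v by (intro K_mono) auto
    then show "X z \<subseteq> P" using sides(3) by blast
  qed
  then have "set (map X zs) \<subseteq> K33s" "\<Union>(set (map X zs)) \<subseteq> P" by auto
  moreover have "edge v z \<notin> V" if "z \<in> set zs" for z
  proof -
    have "edge v z \<in> K {v} {..<n}" using that zs(1) sides(2) by auto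
    then show ?thesis using V by blast
  qed
  then have "proper_over V (map X zs)"
    unfolding X_def using zs by (intro proper_over_star_K33s) auto
  moreover have "length (map X zs) = card B - 2"
    using distinct_card[OF zs(2)] zs(1) y sides(5) by (simp add: card_Diff_subset)
  ultimately show ?thesis by blast
qed

lemma rank_remove_vertex:
  assumes P: "P \<subseteq> E" and AB: "biclique P A B" "3 \<le> card A" and v: "v \<in> A"
  shows "rank P + card B \<le> rank (P - K {v} {..<n}) + 2 + card (P \<inter> K {v} {..<n})"
proof -
  let ?Q = "P - K {v} {..<n}" and ?D = "P \<inter> K {v} {..<n}"
  have fin: "finite P" using P by (rule finite_subset_ground)
  have sub: "K {v} B \<subseteq> ?D" using bicliqueD(2,3)[OF AB(1)] v by (auto simp: K_def)
  have "biclique ?Q (A - {v}) B" using AB(1) by (auto simp: biclique_def K_def)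
  moreover have "2 \<le> card (A - {v})" "v < m" using AB(2) v bicliqueD(1)[OF AB(1)] by auto
  ultimately have "rank (?Q \<union> K {v} B) \<le> rank ?Q + 2" using P by (intro rank_Un_star_le) auto
  moreover have "rank P \<le> rank (?Q \<union> K {v} B) + card (?D - K {v} B)"
  proof -
    have "rank P \<le> rank ((?Q \<union> K {v} B) \<union> (?D - K {v} B))" by (rule rank_mono) blast
    also have "\<dots> \<le> rank (?Q \<union> K {v} B) + card (?D - K {v} B)" using fin by (intro rank_Un_le) simp
    finally show ?thesis .
  qed
  moreover have "card (?D - K {v} B) + card B = card ?D"
    using card_Diff_subset[OF finite_subset[OF sub] sub] card_mono[OF _ sub] fin
    by (simp add: card_K)
  ultimately show ?thesis by linarith
qed

lemma peeling_exists_left: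
  assumes P: "saturated P" and star: "star (blobs P) v = {(A, B)}"
  shows "\<exists>V S. peeling P V S"
proof -
  have only: "p = (A, B)" if "p \<in> blobs P" "v \<in> fst p" for p
  proof -
    have "p \<in> star (blobs P) v" using that by simp
    then show ?thesis unfolding star by simp
  qed
  have "(A, B) \<in> star (blobs P) v" by (simp add: star)
  then have AB: "(A, B) \<in> blobs P" "v \<in> A" by simp_all
  let ?V = "K ({..<m} - {v}) {..<n}" and ?D = "P \<inter> K {v} {..<n}"
  have PE: "P \<subseteq> E" using P by (rule saturated_subset_E)
  then have fin: "finite P" by (rule finite_subset_ground)
  have PV: "P \<inter> ?V = P - K {v} {..<n}" using PE by (auto simp: K_def E_def)
  have weight: "weight P \<le> weight (P \<inter> ?V) + (card B - 2)"
    unfolding PV by (rule weight_remove_vertex[OF P AB only])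
  have rank: "rank P + card B \<le> rank (P \<inter> ?V) + 2 + card ?D"
    unfolding PV by (rule rank_remove_vertex[OF PE blobD(1,2)[OF AB(1)] AB(2)])
  have card: "card P = card (P \<inter> ?V) + card ?D"
    unfolding PV using fin card_Un_disjoint[of "P - K {v} {..<n}" ?D]
    by (simp add: Un_Diff_Int Diff_Int_distrib2)
  have "K {v} B \<subseteq> ?D" using blob_sidesD(2,3)[OF AB(1)] AB(2) by (auto simp: K_def)
  then have "card B \<le> card ?D" using card_mono[of ?D "K {v} B"] fin by (simp add: card_K)
  have "?V \<inter> K {v} {..<n} = {}" "2 \<le> card B" using blobD(3)[OF AB(1)] by (simp_all add: K_Int)
  then obtain S where "set S \<subseteq> K33s" "\<Union>(set S) \<subseteq> P" "proper_over ?V S" "length S = card B - 2"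
    using proper_star_sequence_exists[OF blobD(1,2)[OF AB(1)] _ AB(2)] by blast
  moreover have "flat ?V" by (rule flat_K) auto
  moreover have "weight P + nullity (P \<inter> ?V) \<le> weight (P \<inter> ?V) + nullity P"
    using weight rank card blobD(3)[OF AB(1)] rank_plus_nullity[OF fin]
      rank_plus_nullity[of "P \<inter> ?V"] fin by simp
  moreover have "card (P \<inter> ?V) + weight P + 2 \<le> card P + weight (P \<inter> ?V)"
    using weight card \<open>card B \<le> card ?D\<close> blobD(3)[OF AB(1)] by simp
  ultimately have "peeling P ?V S" using weight by (simp add: peeling_def)
  then show ?thesis by blast
qed

end

context greatest_K33_matroid
begin

interpretation flip: greatest_K33_matroid "\<lambda>i j. edge j i" n m M
  by (rule greatest_K33_matroid_flip)

lemma flip_peeling: "flip.peeling P V S \<longleftrightarrow> peeling P V S"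
  by (simp add: flip.peeling_def peeling_def flip_weight flip_K33s flip_E)

lemma peeling_exists:
  assumes P: "saturated P"
    and v: "private_vertex (blobs P) v"
  shows "\<exists>V S. peeling P V S"
  using v unfolding private_vertex_def
proof
  assume "card (star (blobs P) v) = 1"
  then obtain A B where "star (blobs P) v = {(A, B)}" by (metis card_1_singletonE surj_pair)
  then show ?thesis by (rule peeling_exists_left[OF P])
next
  assume "card (star (prod.swap ` blobs P) v) = 1"
  then obtain A B where "star (flip.blobs P) v = {(A, B)}"
    unfolding flip_blobs by (metis card_1_singletonE surj_pair)
  then show ?thesis
    using flip.peeling_exists_left[of P] P by (simp add: flip_saturated flip_peeling)
qed

lemma card_blob_pairs_le:
  assumes P: "P \<subseteq> E" "blobs P \<noteq> {}"
  shows "card (\<Union>p\<in>blobs P. fst p \<times> snd p) + 4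
    \<le> nullity P + 2 * (card (\<Union>p\<in>blobs P. fst p) + card (\<Union>p\<in>blobs P. snd p))"
proof -
  define V W T where "V = (\<Union>p\<in>blobs P. fst p)" and "W = (\<Union>p\<in>blobs P. snd p)"
    and "T = (\<Union>p\<in>blobs P. fst p \<times> snd p)"
  define Q where "Q = case_prod edge ` T"
  have "fst p \<subseteq> {..<m} \<and> snd p \<subseteq> {..<n}" if "p \<in> blobs P" for p
    using blob_sidesD(1,2)[of "fst p" "snd p" P] that by simp
  then have "V \<subseteq> {..<m}" "W \<subseteq> {..<n}" unfolding V_def W_def by blast+
  obtain p where p: "p \<in> blobs P" using P(2) by blast
  have "fst p \<subseteq> V" "snd p \<subseteq> W" using p by (auto simp: V_def W_def)
  then have "card (fst p) \<le> card V" "card (snd p) \<le> card W"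
    using \<open>V \<subseteq> {..<m}\<close>[THEN finite_if_subset_lessThan] \<open>W \<subseteq> {..<n}\<close>[THEN finite_if_subset_lessThan]
    by (simp_all add: card_mono)
  then have "2 \<le> card V" "2 \<le> card W" using blobD(2,3)[of "fst p" "snd p" P] p by simp_all
  then have rank: "rank (K V W) + 4 = 2 * (card V + card W)"
    using rank_K \<open>V \<subseteq> {..<m}\<close> \<open>W \<subseteq> {..<n}\<close> by simp
  have Q: "Q = (\<Union>p\<in>blobs P. K (fst p) (snd p))"
    unfolding Q_def T_def K_eq_image by (simp add: image_UN)
  have "Q \<subseteq> K V W" unfolding Q V_def W_def by (intro UN_least K_mono) blast+
  then have "rank Q \<le> rank (K V W)" by (rule rank_mono)
  moreover have "Q \<subseteq> P" unfolding Q
  proof (rule UN_least)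
    show "K (fst p) (snd p) \<subseteq> P" if "p \<in> blobs P" for p
      using blob_sidesD(3)[of "fst p" "snd p" P] that by simp
  qed
  then have "nullity Q \<le> nullity P" using finite_subset_ground[OF P(1)] by (intro nullity_mono)
  moreover have "card Q = card T" unfolding Q_def by (rule card_image) (auto simp: inj_on_def)
  moreover have "rank Q + nullity Q = card Q"
    using finite_subset_ground[OF order_trans[OF \<open>Q \<subseteq> P\<close> P(1)]] by (rule rank_plus_nullity)
  ultimately have "card T + 4 \<le> nullity P + 2 * (card V + card W)" using rank by simp
  then show ?thesis by (simp add: V_def W_def T_def)
qed

text \<open>Otherwise all stars are sparse, and the double count contradicts the rank of the
  complete bipartite graph spanned by the blobs.\<close>

lemma private_vertex_exists:
  assumes P: "P \<subseteq> E" "blobs P \<noteq> {}" and null: "nullity P \<le> weight P"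
    and left: "\<And>v. 2 \<le> card (star (blobs P) v) \<Longrightarrow> sparse_star (blobs P) v"
    and right: "\<And>v. 2 \<le> card (star (prod.swap ` blobs P) v) \<Longrightarrow> sparse_star (prod.swap ` blobs P) v"
  shows "\<exists>v. private_vertex (blobs P) v"
proof (rule ccontr)
  assume "\<not> ?thesis"
  then have none: "card (star (blobs P) v) \<noteq> 1" "card (star (prod.swap ` blobs P) v) \<noteq> 1" for v
    by (simp_all add: private_vertex_def)
  have two: "2 \<le> card (star \<B> v)"
    if "finite \<B>" "p \<in> \<B>" "v \<in> fst p" "card (star \<B> v) \<noteq> 1" for \<B> v and p :: "nat set \<times> nat set"
  proof -
    have "p \<in> star \<B> v" using that(2,3) by simp
    then have "card (star \<B> v) \<noteq> 0" using finite_star[OF that(1)] by (metis card_eq_0_iff empty_iff)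
    then show ?thesis using that(4) by simp
  qed
  have "(\<Sum>p\<in>blobs P. rect_weight p)
      + 2 * (card (\<Union>p\<in>blobs P. fst p) + card (\<Union>p\<in>blobs P. snd p))
      < card (\<Union>p\<in>blobs P. fst p \<times> snd p) + 4"
  proof (rule sparse_stars_cover_large[OF finite_blobs])
    show "finite (fst p) \<and> finite (snd p) \<and> 3 \<le> card (fst p) \<and> 3 \<le> card (snd p)"
      if "p \<in> blobs P" for p
      using blobD[of "fst p" "snd p" P] blob_sidesD[of "fst p" "snd p" P] that by simp
    show "sparse_star (blobs P) v" if v: "v \<in> (\<Union>p\<in>blobs P. fst p)" for v
      using v none two[OF finite_blobs] left by blast
    show "sparse_star (prod.swap ` blobs P) v" if v: "v \<in> (\<Union>p\<in>blobs P. snd p)" for v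
    proof -
      obtain p where "p \<in> blobs P" "v \<in> snd p" using v by blast
      then have "2 \<le> card (star (prod.swap ` blobs P) v)"
        using none two[of "prod.swap ` blobs P" "prod.swap p" v] finite_blobs by auto
      then show ?thesis by (rule right)
    qed
  qed
  then show False
    using card_blob_pairs_le[OF P] null unfolding weight_def by linarith
qed

end

section \<open>The nullity formula for flats\<close>

locale critical_flat = greatest_K33_matroid edge m n M
  for edge :: "nat \<Rightarrow> nat \<Rightarrow> 'e" and m n M +
  fixes F :: "'e set"
  assumes flat_F: "flat F"
    and formula_smaller: "flat G \<Longrightarrow> rank G < rank F \<Longrightarrow> nullity_formula G"

definition (in greatest_K33_matroid) excess :: "'e set \<Rightarrow> 'e set \<Rightarrow> int" where
  "excess F P = int (blob_nullity F P) - int (nullity P)"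

text \<open>Choosing a violating set of least rank, then of largest excess and then of largest size
  makes it closed under taking closures of subsets of smaller rank.\<close>

locale maximal_violation = critical_flat edge m n M F
  for edge :: "nat \<Rightarrow> nat \<Rightarrow> 'e" and m n M F +
  fixes P :: "'e set"
  assumes P_subset: "P \<subseteq> F" and excess_pos: "0 < excess F P"
    and rank_minimal: "Q \<subseteq> F \<Longrightarrow> rank Q < rank P \<Longrightarrow> excess F Q \<le> 0"
    and excess_maximal: "Q \<subseteq> F \<Longrightarrow> rank Q = rank P \<Longrightarrow> excess F Q \<le> excess F P"
    and card_maximal: "Q \<subseteq> F \<Longrightarrow> rank Q = rank P \<Longrightarrow> excess F Q = excess F P \<Longrightarrow> card Q \<le> card P"
begin

interpretation flip: greatest_K33_matroid "\<lambda>i j. edge j i" n m M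
  by (rule greatest_K33_matroid_flip)

lemma maximal_violation_flip: "maximal_violation (\<lambda>i j. edge j i) n m M F P"
proof -
  have excess: "flip.excess F Q = excess F Q" for Q
    by (simp add: flip.excess_def excess_def flip_blob_nullity)
  show ?thesis
    by unfold_locales
      (use flat_F formula_smaller P_subset excess_pos rank_minimal excess_maximal card_maximal in
        \<open>simp_all add: excess flip_E flip_nullity_formula\<close>)
qed

lemma saturated_F: "saturated F"
  using flat_F by (rule saturated_flat)

lemma P_subset_E: "P \<subseteq> E"
  using P_subset flat_subset_ground[OF flat_F] by (rule order_trans)

lemma finite_P: "finite P"
  using P_subset_E by (rule finite_subset_ground)

lemma formula_less_rank: "flat G \<Longrightarrow> rank G < rank P \<Longrightarrow> nullity_formula G"
  using formula_smaller rank_mono[OF P_subset] by simp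

lemma closure_subset_P:
  assumes Y: "Y \<subseteq> P" "rank Y < rank P"
  shows "closure Y \<subseteq> P"
proof -
  let ?Q = "closure Y"
  have YE: "Y \<subseteq> E" using Y(1) P_subset_E by blast
  have Q: "flat ?Q" "?Q \<subseteq> F" "rank ?Q = rank Y"
    using flat_closure[OF YE] closure_subset_flat[OF flat_F] Y(1) P_subset rank_closure[OF YE]
    by auto
  have fin: "finite ?Q" by (rule finite_closure)
  have excess_Q: "excess F ?Q = 0"
    using blob_nullity_flat[OF flat_F formula_less_rank Q(1,2)] Q(3) Y(2) by (simp add: excess_def)
  have "Y \<subseteq> P \<inter> ?Q" using Y(1) subset_closure[OF YE] by blast
  then have rank_Int: "rank (P \<inter> ?Q) = rank Y"
    using rank_mono[of Y "P \<inter> ?Q"] rank_mono[of "P \<inter> ?Q" ?Q] Q(3) by simp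
  then have "excess F (P \<inter> ?Q) \<le> 0" using rank_minimal[of "P \<inter> ?Q"] P_subset Y(2) by auto
  moreover have rank_Un: "rank (P \<union> ?Q) = rank P"
    using rank_Un_subset_closure closure_mono[OF Y(1)] by blast
  have "excess F P + excess F ?Q \<le> excess F (P \<union> ?Q) + excess F (P \<inter> ?Q)"
    using blob_nullity_supermodular[OF finite_P fin, of F] card_Un_Int[OF finite_P fin]
      rank_plus_nullity[OF finite_P] rank_plus_nullity[OF fin]
      rank_plus_nullity[OF finite_UnI[OF finite_P fin]]
      rank_plus_nullity[OF finite_Int[OF disjI1[OF finite_P]], of ?Q]
      rank_Int rank_Un Q(3) unfolding excess_def by linarith
  ultimately have "excess F P \<le> excess F (P \<union> ?Q)" using excess_Q by simp
  moreover have U: "P \<union> ?Q \<subseteq> F" using P_subset Q(2) by blast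
  ultimately have "card (P \<union> ?Q) \<le> card P"
    using card_maximal[OF U rank_Un] excess_maximal[OF U rank_Un] by simp
  then have "P = P \<union> ?Q" using finite_P fin by (intro card_seteq) auto
  then show ?thesis by blast
qed

lemma trace_other_blob_indep:
  assumes CD: "(C, D) \<in> blobs F" "P \<subseteq> K C D" and p: "p \<in> blobs F" "p \<noteq> (C, D)"
  shows "P \<inter> K (fst p) (snd p) \<in> M"
proof -
  have "\<exists>u<m. C \<inter> fst p \<subseteq> {u}"
  proof (cases "C \<inter> fst p = {}")
    case True
    then show ?thesis using three_le_m by (intro exI[of _ 0]) auto
  next
    case False
    then obtain u where u: "u \<in> C \<inter> fst p" by blast
    then have "C \<inter> fst p \<subseteq> {u}" using blob_eqI[OF saturated_F p(1) CD(1), of u] p(2) by auto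
    moreover have "u < m" using u blob_sidesD(1)[OF CD(1)] by auto
    ultimately show ?thesis by blast
  qed
  then obtain u where u: "u < m" "C \<inter> fst p \<subseteq> {u}" by blast
  have "P \<inter> K (fst p) (snd p) \<subseteq> K (C \<inter> fst p) (D \<inter> snd p)"
    using CD(2) unfolding K_Int[symmetric] by blast
  also have "\<dots> \<subseteq> K {u} {..<n}" using u(2) blob_sidesD(2)[OF CD(1)] by (intro K_mono) auto
  finally show ?thesis by (rule indep_subset[OF star_indep[OF u(1) subset_refl]])
qed

lemma rank_trace_less:
  assumes CD: "(C, D) \<in> blobs F"
  shows "rank (P \<inter> K C D) < rank P"
proof (rule ccontr)
  assume "\<not> ?thesis"
  then have "P \<subseteq> closure (P \<inter> K C D)" using P_subset_E by (intro subset_closure_if_rank_le) auto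
  also have "\<dots> \<subseteq> K C D" using flat_K[OF blob_sidesD(1,2)[OF CD]] by (rule closure_subset_flat) simp
  finally have PK: "P \<subseteq> K C D" .
  have "nullity (P \<inter> K (fst p) (snd p)) = 0" if "p \<in> blobs F" "p \<noteq> (C, D)" for p
    by (rule nullity_indep[OF trace_other_blob_indep[OF CD PK that]])
  then have "blob_nullity F P = (\<Sum>p\<in>{(C, D)}. nullity (P \<inter> K (fst p) (snd p)))"
    unfolding blob_nullity_def
    using CD by (intro sum.mono_neutral_right finite_blobs) auto
  also have "\<dots> = nullity P" using PK by (simp add: Int_absorb2)
  finally show False using excess_pos by (simp add: excess_def)
qed

lemma flat_trace:
  assumes CD: "(C, D) \<in> blobs F"
  shows "flat (P \<inter> K C D)"
proof -
  have "closure (P \<inter> K C D) \<subseteq> K C D"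
    using flat_K[OF blob_sidesD(1,2)[OF CD]] by (rule closure_subset_flat) simp
  moreover have "closure (P \<inter> K C D) \<subseteq> P"
    by (rule closure_subset_P[OF Int_lower1 rank_trace_less[OF CD]])
  ultimately show ?thesis using P_subset_E unfolding flat_def by blast
qed

lemma formula_trace_Int:
  assumes "(C, D) \<in> blobs F" "flat V"
  shows "nullity_formula (P \<inter> V \<inter> K C D)"
proof -
  have "flat (P \<inter> K C D \<inter> V)" using flat_Int[OF flat_trace[OF assms(1)] assms(2)] .
  moreover have "rank (P \<inter> K C D \<inter> V) < rank P"
    by (rule order_le_less_trans[OF rank_mono rank_trace_less[OF assms(1)]]) blast
  ultimately show ?thesis using formula_less_rank by (simp add: Int_ac)
qed

lemma excess_Int_flat:
  assumes "flat V"
  shows "excess F (P \<inter> V) = int (weight (P \<inter> V)) - int (nullity (P \<inter> V))"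
  unfolding excess_def
  using blob_nullity_eq_weight[OF saturated_F, of "P \<inter> V"] formula_trace_Int[OF _ assms] P_subset
  by auto

lemma excess_P: "excess F P = int (weight P) - int (nullity P)"
proof -
  have "flat E" using closure_subset_ground by (simp add: flat_def)
  then show ?thesis using excess_Int_flat[of E] P_subset_E by (simp add: Int_absorb2)
qed

lemma weight_pos: "0 < weight P"
  using excess_pos excess_P by simp

lemma blobs_P_nonempty: "blobs P \<noteq> {}"
  using weight_pos by (auto simp: weight_def)

lemma rank_P_gt_8: "8 < rank P"
proof -
  have "\<exists>p\<in>blobs F. nullity (P \<inter> K (fst p) (snd p)) \<noteq> 0"
  proof (rule ccontr)
    assume "\<not> ?thesis"
    then have "blob_nullity F P = 0" by (simp add: blob_nullity_def)
    then show False using excess_pos by (simp add: excess_def)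
  qed
  then obtain C D where CD: "(C, D) \<in> blobs F" "nullity (P \<inter> K C D) \<noteq> 0" by auto
  then have "8 \<le> rank (P \<inter> K C D)"
    using P_subset_E nullity_indep by (intro rank_dependent_ge) auto
  then show ?thesis using rank_trace_less[OF CD(1)] by simp
qed

lemma saturated_P: "saturated P"
  unfolding saturated_def
proof (intro conjI ballI allI impI)
  fix X e assume X: "X \<in> K33s" "X - {e} \<subseteq> P"
  have "e \<in> P" if "e \<in> X"
  proof -
    have "rank (X - {e}) < rank P"
      using rank_circuit_Diff[OF circuit_K33[OF X(1)] that] card_K33[OF X(1)] rank_P_gt_8 by simp
    then have "closure (X - {e}) \<subseteq> P" by (rule closure_subset_P[OF X(2)])
    then show ?thesis using circuit_in_closure[OF circuit_K33[OF X(1)] that subset_refl] by blast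
  qed
  then show "X \<subseteq> P" using X(2) by blast
qed (rule P_subset_E)

lemma sparse_star_P:
  assumes two: "2 \<le> card (star (blobs P) v)"
  shows "sparse_star (blobs P) v"
proof -
  have "star (blobs P) v \<noteq> {}" using two by auto
  then obtain x x' where "star_system edge m n M P v x x'"
    using star_system_exists[OF saturated_P] by blast
  then interpret star_system edge m n M P v x x' .
  have "rank skeleton < rank P"
  proof (rule ccontr)
    assume "\<not> ?thesis"
    then have "P \<subseteq> closure skeleton"
      using skeleton_subset P_subset_E by (intro subset_closure_if_rank_le) auto
    moreover have "closure skeleton \<subseteq> F"
      using closure_subset_flat[OF flat_F] skeleton_subset P_subset by blast
    moreover have "blobs (P \<inter> K C D) \<noteq> {}" if "(C, D) \<in> blobs F" "0 < nullity (P \<inter> K C D)" for C D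
      using that formula_less_rank[OF flat_trace rank_trace_less]
      by (auto simp: nullity_formula_def weight_def)
    ultimately have "blob_nullity F P \<le> nullity P"
      using blob_nullity_le_if_spanning[OF saturated_F P_subset] by blast
    then show False using excess_pos by (simp add: excess_def)
  qed
  then have "closure skeleton \<subseteq> P" "rank (closure skeleton) < rank P"
    using closure_subset_P[OF skeleton_subset] rank_closure[OF skeleton_subset_E] by simp_all
  then show ?thesis
    using formula_less_rank[OF flat_closure[OF skeleton_subset_E]]
    by (intro sparse_star_if_nullity_formula two)
qed

lemma sparse_star_P_right:
  assumes "2 \<le> card (star (prod.swap ` blobs P) v)"
  shows "sparse_star (prod.swap ` blobs P) v"
proof -
  interpret flip: maximal_violation "\<lambda>i j. edge j i" n m M F P by (rule maximal_violation_flip)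
  show ?thesis using flip.sparse_star_P[of v] assms by (simp add: flip_blobs)
qed

lemma no_maximal_violation: False
proof -
  have "nullity P \<le> weight P" using excess_pos excess_P by simp
  then obtain v where "private_vertex (blobs P) v"
    using private_vertex_exists[OF P_subset_E blobs_P_nonempty _ sparse_star_P sparse_star_P_right]
    by blast
  then obtain V S where "peeling P V S" using peeling_exists[OF saturated_P] by blast
  then have V: "flat V" "weight P + nullity (P \<inter> V) \<le> weight (P \<inter> V) + nullity P"
    "card (P \<inter> V) + weight P + 2 \<le> card P + weight (P \<inter> V)"
    by (simp_all add: peeling_def)
  have excess: "excess F (P \<inter> V) = int (weight (P \<inter> V)) - int (nullity (P \<inter> V))"
    by (rule excess_Int_flat[OF V(1)])
  have sub: "P \<inter> V \<subseteq> F" using P_subset by blast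
  have "0 < excess F (P \<inter> V)" using excess excess_P excess_pos V(2) by simp
  then have "\<not> rank (P \<inter> V) < rank P" using rank_minimal[OF sub] by auto
  then have rank: "rank (P \<inter> V) = rank P" using rank_mono[of "P \<inter> V" P] by simp
  then have "nullity (P \<inter> V) + weight P + 2 \<le> nullity P + weight (P \<inter> V)"
    using V(3) rank_plus_nullity[OF finite_P] rank_plus_nullity[of "P \<inter> V"] finite_P by simp
  then show False using excess_maximal[OF sub rank] excess excess_P by simp
qed

end

context critical_flat
begin

lemma maximal_violation_exists:
  assumes "P \<subseteq> F" "0 < excess F P"
  shows "\<exists>Q. maximal_violation edge m n M F Q"
proof -
  let ?gap = "\<lambda>Q. nat (int (blob_nullity F F) - excess F Q)"
  let ?R = "measures [rank, ?gap, \<lambda>Q. card F - card Q]"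
  let ?bad = "{Q. Q \<subseteq> F \<and> 0 < excess F Q}"
  obtain Q where Q: "Q \<in> ?bad" and minimal: "\<And>R. (R, Q) \<in> ?R \<Longrightarrow> R \<notin> ?bad"
    using wfE_min[OF wf_measures, of P ?bad] assms by blast
  have bound: "excess F R \<le> int (blob_nullity F F)" if "R \<subseteq> F" for R
    using blob_nullity_mono[OF that finite_flat[OF flat_F], of F] by (simp add: excess_def)
  have "maximal_violation edge m n M F Q"
  proof unfold_locales
    show "Q \<subseteq> F" "0 < excess F Q" using Q by simp_all
    show "excess F R \<le> 0" if "R \<subseteq> F" "rank R < rank Q" for R
      using minimal[of R] that by auto
    show le: "excess F R \<le> excess F Q" if "R \<subseteq> F" "rank R = rank Q" for R
    proof (rule ccontr)
      assume "\<not> ?thesis"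
      then have "(R, Q) \<in> ?R" "R \<in> ?bad" using that Q bound[OF that(1)] by auto
      then show False using minimal by blast
    qed
    show "card R \<le> card Q" if "R \<subseteq> F" "rank R = rank Q" "excess F R = excess F Q" for R
    proof (rule ccontr)
      assume "\<not> ?thesis"
      moreover have "card R \<le> card F" using finite_flat[OF flat_F] that(1) by (rule card_mono)
      ultimately have "(R, Q) \<in> ?R" "R \<in> ?bad" using that Q by auto
      then show False using minimal by blast
    qed
  qed
  then show ?thesis by blast
qed

lemma blob_nullity_le_nullity:
  assumes "P \<subseteq> F"
  shows "blob_nullity F P \<le> nullity P"
proof (rule ccontr)
  assume "\<not> ?thesis"
  then obtain Q where "maximal_violation edge m n M F Q"
    using maximal_violation_exists[OF assms] by (auto simp: excess_def)
  then show False by (rule maximal_violation.no_maximal_violation)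
qed

sublocale erection E M F "blob_nullity F"
proof
  show "blob_nullity F A \<le> blob_nullity F B" if "A \<subseteq> B" "B \<subseteq> F" for A B
    using that finite_flat[OF flat_F] by (intro blob_nullity_mono) (auto intro: finite_subset)
  show "blob_nullity F A + blob_nullity F B \<le> blob_nullity F (A \<union> B) + blob_nullity F (A \<inter> B)"
    if "A \<subseteq> F" "B \<subseteq> F" for A B
    using that finite_flat[OF flat_F]
    by (intro blob_nullity_supermodular) (auto intro: finite_subset)
  show "blob_nullity F G = nullity G" if "flat G" "G \<subseteq> F" "rank G < rank F" for G
    using blob_nullity_flat[OF flat_F formula_smaller that] .
qed (rule flat_F blob_nullity_le_nullity; assumption)+

lemma blob_nullity_K33_pos:
  assumes X: "X \<in> K33s" "X \<subseteq> F"
  shows "0 < blob_nullity F X"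
proof -
  obtain A B where AB: "X = K A B" "A \<subseteq> {..<m}" "B \<subseteq> {..<n}" "card A = 3" "card B = 3"
    by (rule K33sE[OF X(1)])
  then have "biclique F A B" using X(2) by (simp add: biclique_def)
  then obtain C D where CD: "(C, D) \<in> blobs F" "A \<subseteq> C" "B \<subseteq> D"
    using biclique_extends_to_blob[of F A B] AB(4,5) by auto
  then have "X \<inter> K C D = X" using K_mono[OF CD(2,3)] AB(1) by blast
  then have "0 < nullity (X \<inter> K C D)" using nullity_circuit[OF circuit_K33[OF X(1)]] by simp
  also have "\<dots> \<le> blob_nullity F X"
    unfolding blob_nullity_def
    using member_le_sum[OF CD(1), of "\<lambda>p. nullity (X \<inter> K (fst p) (snd p))"] finite_blobs by simp
  finally show ?thesis .
qed

theorem nullity_formula_F: "nullity_formula F"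
proof (rule ccontr)
  assume "\<not> ?thesis"
  then have less: "blob_nullity F F < nullity F"
    using blob_nullity_le_nullity[of F] by (simp add: nullity_formula_def blob_nullity_self)
  have FE: "F \<subseteq> E" using flat_F by (rule flat_subset_ground)
  have "F \<notin> M" using less nullity_indep[of F] by auto
  then have "8 \<le> rank F" by (rule rank_dependent_ge[OF FE])
  then have "circuit E erected.indep_sets X" if "X \<in> K33s" for X
    using circuit_erected[OF circuit_K33[OF that]] card_K33[OF that] blob_nullity_K33_pos[OF that]
    by simp
  then have "erected.indep_sets \<subseteq> M"
    using with_K33_circuits_subset erected.matroid_on_indep_sets
    by (simp add: matroid_with_circuits_def)
  moreover obtain I where "I \<in> erected.indep_sets" "I \<subseteq> F" "card I = Suc (rank F)"
    using erected.induced.basis_exists[of F] erected.rank_induced[OF FE] erected_rank_F[OF less]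
    by auto
  ultimately show False using card_indep_le_rank[of I F] by auto
qed

end

section \<open>The greatest matroid has rank function val\<close>

context greatest_K33_matroid
begin

theorem nullity_formula_flat: "flat F \<Longrightarrow> nullity_formula F"
proof (induction "rank F" arbitrary: F rule: less_induct)
  case less
  interpret critical_flat edge m n M F
  proof unfold_locales
    show "nullity_formula G" if "flat G" "rank G < rank F" for G
      using less.hyps[OF that(2,1)] .
  qed (rule less.prems)
  show ?case by (rule nullity_formula_F)
qed

lemma sparse_star_flat:
  assumes F: "flat F" and two: "2 \<le> card (star (blobs F) v)"
  shows "sparse_star (blobs F) v"
proof -
  have "star (blobs F) v \<noteq> {}" using two by auto
  then obtain x x' where "star_system edge m n M F v x x'"
    using star_system_exists[OF saturated_flat[OF F]] by blast
  then interpret star_system edge m n M F v x x' .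
  show ?thesis
    using sparse_star_if_nullity_formula[OF closure_subset_flat[OF F skeleton_subset] two]
      nullity_formula_flat[OF flat_closure[OF skeleton_subset_E]] .
qed

lemma sparse_star_flat_right:
  assumes "flat F" "2 \<le> card (star (prod.swap ` blobs F) v)"
  shows "sparse_star (prod.swap ` blobs F) v"
proof -
  interpret flip: greatest_K33_matroid "\<lambda>i j. edge j i" n m M by (rule greatest_K33_matroid_flip)
  show ?thesis using flip.sparse_star_flat[of F v] assms by (simp add: flip_blobs flip_E)
qed

lemma proper_sequence_in_flat:
  assumes "flat F"
  shows "\<exists>S. set S \<subseteq> K33s \<and> \<Union>(set S) \<subseteq> F \<and> proper_over {} S \<and> nullity F \<le> length S"
  using assms
proof (induction "card F" arbitrary: F rule: less_induct)
  case less
  note F = \<open>flat F\<close>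
  have FE: "F \<subseteq> E" and fin: "finite F"
    using flat_subset_ground[OF F] finite_subset_ground by blast+
  have formula: "nullity F = weight F"
    using nullity_formula_flat[OF F] by (simp add: nullity_formula_def)
  show ?case
  proof (cases "blobs F = {}")
    case True
    then have "nullity F = 0" using formula by (simp add: weight_def)
    then show ?thesis by (intro exI[of _ "[]"]) simp
  next
    case False
    then obtain v where "private_vertex (blobs F) v"
      using formula
        private_vertex_exists[OF FE _ _ sparse_star_flat[OF F] sparse_star_flat_right[OF F]]
      by auto
    then obtain V T where "peeling F V T" using peeling_exists[OF saturated_flat[OF F]] by blast
    then have V: "flat V" "card (F \<inter> V) + weight F + 2 \<le> card F + weight (F \<inter> V)"
      and T: "set T \<subseteq> K33s" "\<Union>(set T) \<subseteq> F" "proper_over V T" "weight F \<le> weight (F \<inter> V) + length T"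
      by (simp_all add: peeling_def)
    have flat: "flat (F \<inter> V)" using F V(1) by (rule flat_Int)
    then have formula': "nullity (F \<inter> V) = weight (F \<inter> V)"
      using nullity_formula_flat by (simp add: nullity_formula_def)
    have "nullity (F \<inter> V) \<le> nullity F" using fin by (intro nullity_mono) auto
    then have "card (F \<inter> V) < card F" using V(2) formula formula' by simp
    then obtain S where S: "set S \<subseteq> K33s" "\<Union>(set S) \<subseteq> F \<inter> V" "proper_over {} S"
      "nullity (F \<inter> V) \<le> length S"
      using less.hyps[OF _ flat] by blast
    have "proper_over {} (S @ T)"
      using S(2,3) proper_over_antimono[OF _ T(3)] by (simp add: proper_over_append)
    moreover have "nullity F \<le> length (S @ T)" using T(4) S(4) formula formula' by simp
    moreover have "set (S @ T) \<subseteq> K33s" "\<Union>(set (S @ T)) \<subseteq> F" using S(1,2) T(1,2) by auto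
    ultimately show ?thesis by blast
  qed
qed

theorem val_min_eq_rank:
  assumes A: "A \<subseteq> E"
  shows "val_min K33s A = int (rank A)"
proof (rule order_antisym)
  show "int (rank A) \<le> val_min K33s A" by (rule rank_le_val_min[OF with_K33_circuits A])
  obtain S where S: "set S \<subseteq> K33s" "\<Union>(set S) \<subseteq> closure A" "proper_over {} S"
    "nullity (closure A) \<le> length S"
    using proper_sequence_in_flat[OF flat_closure[OF A]] by blast
  have "card (A \<union> \<Union>(set S)) \<le> card (closure A)"
    using S(2) subset_closure[OF A] by (intro card_mono finite_closure) auto
  also have "\<dots> = rank A + nullity (closure A)"
    using rank_plus_nullity[OF finite_closure[of A]] rank_closure[OF A] by simp
  finally have "val_seq A S \<le> int (rank A)" using S(4) by (simp add: val_seq_def)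
  moreover have "proper_seq K33s S" using S(1,3) by (simp add: proper_seq_iff[OF with_K33_circuits])
  ultimately show "val_min K33s A \<le> int (rank A)"
    using val_min_le_val_seq[OF with_K33_circuits A] by fastforce
qed

lemma submodular_val_min: "submodular_on E (val_min K33s)"
  unfolding submodular_on_def
proof (intro allI impI)
  fix A B assume "A \<subseteq> E \<and> B \<subseteq> E"
  then have "A \<subseteq> E" "B \<subseteq> E" "A \<union> B \<subseteq> E" "A \<inter> B \<subseteq> E" by auto
  then show "val_min K33s (A \<union> B) + val_min K33s (A \<inter> B) \<le> val_min K33s A + val_min K33s B"
    using rank_submodular[of A B] by (simp add: val_min_eq_rank)
qed

end

theorem (in edge_grid) greatest_exists_iff_submodular:
  "(\<exists>M. greatest_matroid_with_circuits E K33s M) \<longleftrightarrow> submodular_on E (val_min K33s)"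
proof
  assume "\<exists>M. greatest_matroid_with_circuits E K33s M"
  then obtain M where "greatest_matroid_with_circuits E K33s M" ..
  then interpret greatest_K33_matroid edge m n M by unfold_locales
  show "submodular_on E (val_min K33s)" by (rule submodular_val_min)
qed (rule greatest_matroid_if_submodular[OF uniform_with_K33_circuits])

section \<open>Copies of complete bipartite graphs\<close>

definition joins :: "'v set \<Rightarrow> 'v set \<Rightarrow> 'v set set" where
  "joins S T = {{u, w} | u w. u \<in> S \<and> w \<in> T}"

lemma joins_commute: "joins S T = joins T S"
  by (auto simp: joins_def insert_commute)

lemma doubleton_in_joins:
  "{u, w} \<in> joins S T \<longleftrightarrow> (u \<in> S \<and> w \<in> T) \<or> (u \<in> T \<and> w \<in> S)"
  by (auto simp: joins_def doubleton_eq_iff)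

lemma complete_bipartite_eq:
  "complete_bipartite a b = (Inl ` {..<a} \<union> Inr ` {..<b}, joins (Inl ` {..<a}) (Inr ` {..<b}))"
  by (auto simp: complete_bipartite_def joins_def)

lemma graph_iso_complete_bipartiteE:
  assumes H: "simple_graph H" and iso: "graph_iso H (complete_bipartite a b)"
  obtains S T where "verts H = S \<union> T" "S \<inter> T = {}" "card S = a" "card T = b" "edges H = joins S T"
proof -
  obtain f where f: "bij_betw f (verts H) (Inl ` {..<a} \<union> Inr ` {..<b})"
    and adjacent: "\<And>u w. u \<in> verts H \<Longrightarrow> w \<in> verts H \<Longrightarrow>
      {u, w} \<in> edges H \<longleftrightarrow> {f u, f w} \<in> joins (Inl ` {..<a}) (Inr ` {..<b})"
    using iso by (auto simp: graph_iso_def complete_bipartite_eq)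
  define S where "S = {u \<in> verts H. f u \<in> Inl ` {..<a}}"
  define T where "T = {u \<in> verts H. f u \<in> Inr ` {..<b}}"
  have image: "f ` verts H = Inl ` {..<a} \<union> Inr ` {..<b}" and inj: "inj_on f (verts H)"
    using f by (simp_all add: bij_betw_def)
  have "card {u \<in> verts H. f u \<in> Z} = card Z" if "Z \<subseteq> f ` verts H" for Z
  proof -
    have "f ` {u \<in> verts H. f u \<in> Z} = Z" using that by auto
    moreover have "inj_on f {u \<in> verts H. f u \<in> Z}" using inj by (rule inj_on_subset) auto
    ultimately show ?thesis using card_image by metis
  qed
  from this[of "Inl ` {..<a}"] this[of "Inr ` {..<b}"] have "card S = a" "card T = b"
    by (simp_all add: S_def T_def image card_image)
  moreover have ST: "verts H = S \<union> T" "S \<inter> T = {}" using image by (auto simp: S_def T_def)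
  moreover have doubleton: "{u, w} \<in> edges H \<longleftrightarrow> {u, w} \<in> joins S T"
    if "u \<in> verts H" "w \<in> verts H" for u w
    using adjacent[OF that] that by (simp add: doubleton_in_joins S_def T_def)
  have "edges H = joins S T"
  proof (intro equalityI subsetI)
    fix e assume e: "e \<in> edges H"
    then have "e \<subseteq> verts H" "card e = 2" using H by (auto simp: simple_graph_def)
    then obtain u w where "e = {u, w}" "u \<in> verts H" "w \<in> verts H" by (auto simp: card_2_iff)
    then show "e \<in> joins S T" using doubleton e by simp
  next
    fix e assume e: "e \<in> joins S T"
    then obtain u w where "e = {u, w}" "u \<in> S" "w \<in> T" by (auto simp: joins_def)
    then show "e \<in> edges H" using doubleton e ST(1) by auto
  qed
  ultimately show ?thesis using that by blast
qed

lemma graph_iso_complete_bipartiteI: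
  assumes fin: "finite S" "finite T" and disjoint: "S \<inter> T = {}"
  shows "graph_iso (S \<union> T, joins S T) (complete_bipartite (card S) (card T))"
proof -
  obtain g where g: "bij_betw g S {..<card S}"
    using finite_same_card_bij[OF fin(1), of "{..<card S}"] by auto
  obtain h where h: "bij_betw h T {..<card T}"
    using finite_same_card_bij[OF fin(2), of "{..<card T}"] by auto
  define f where "f u = (if u \<in> S then Inl (g u) else Inr (h u))" for u
  have f: "f u = Inl (g u)" "u \<in> S \<Longrightarrow> g u < card S" if "u \<in> S" for u
    using that bij_betw_apply[OF g] by (auto simp: f_def)
  have f': "f u = Inr (h u)" "h u < card T" if "u \<in> T" for u
    using that disjoint bij_betw_apply[OF h] by (auto simp: f_def)
  have "bij_betw f (S \<union> T) (Inl ` {..<card S} \<union> Inr ` {..<card T})"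
  proof (rule bij_betw_combine)
    show "bij_betw f S (Inl ` {..<card S})"
      using bij_betw_trans[OF g, of Inl] f(1) by (auto simp: bij_betw_def inj_on_def)
    show "bij_betw f T (Inr ` {..<card T})"
      using bij_betw_trans[OF h, of Inr] f'(1) by (auto simp: bij_betw_def inj_on_def)
  qed auto
  moreover have "{u, w} \<in> joins S T \<longleftrightarrow> {f u, f w} \<in> joins (Inl ` {..<card S}) (Inr ` {..<card T})"
    if "u \<in> S \<union> T" "w \<in> S \<union> T" for u w
    using that disjoint f f' by (auto simp: doubleton_in_joins)
  ultimately show ?thesis by (auto simp: graph_iso_def complete_bipartite_eq)
qed

lemma K33_copies_eq:
  "K33_copies G = {joins S T | S T. S \<union> T \<subseteq> verts G \<and> S \<inter> T = {} \<and> card S = 3 \<and> card T = 3 \<and>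
     joins S T \<subseteq> edges G}" (is "_ = ?J")
proof (intro equalityI subsetI)
  fix X assume "X \<in> K33_copies G"
  then obtain H where H: "X = edges H" "subgraph H G" "graph_iso H (complete_bipartite 3 3)"
    by (auto simp: K33_copies_def)
  then have "simple_graph H" "verts H \<subseteq> verts G" "edges H \<subseteq> edges G" by (simp_all add: subgraph_def)
  moreover obtain S T where "verts H = S \<union> T" "S \<inter> T = {}" "card S = 3" "card T = 3"
    "edges H = joins S T"
    by (rule graph_iso_complete_bipartiteE[OF \<open>simple_graph H\<close> H(3)])
  ultimately show "X \<in> ?J"
    unfolding H(1) by (intro CollectI exI[of _ S] exI[of _ T]) simp
next
  fix X assume "X \<in> ?J"
  then obtain S T where ST: "X = joins S T" "S \<union> T \<subseteq> verts G" "S \<inter> T = {}" "card S = 3" "card T = 3"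
    "joins S T \<subseteq> edges G" by blast
  have "simple_graph (S \<union> T, joins S T)"
    using ST(3) by (auto simp: simple_graph_def joins_def card_insert_if disjoint_iff)
  then have "subgraph (S \<union> T, joins S T) G" using ST(2,6) by (simp add: subgraph_def)
  moreover have "finite S" "finite T" using ST(4,5) by (simp_all add: card_ge_0_finite)
  then have "graph_iso (S \<union> T, joins S T) (complete_bipartite 3 3)"
    using graph_iso_complete_bipartiteI[OF _ _ ST(3)] ST(4,5) by simp
  ultimately show "X \<in> K33_copies G" unfolding K33_copies_def ST(1) by force
qed

lemma joins_subset_complete_bipartite_sides:
  assumes sub: "joins S T \<subseteq> edges (complete_bipartite m n)" and ne: "S \<noteq> {}" "T \<noteq> {}"
  shows "S \<subseteq> Inl ` {..<m} \<and> T \<subseteq> Inr ` {..<n} \<or> S \<subseteq> Inr ` {..<n} \<and> T \<subseteq> Inl ` {..<m}"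
proof -
  have cross: "u \<in> Inl ` {..<m} \<and> w \<in> Inr ` {..<n} \<or> u \<in> Inr ` {..<n} \<and> w \<in> Inl ` {..<m}"
    if "u \<in> S" "w \<in> T" for u w
  proof -
    have "{u, w} \<in> joins S T" using that by (simp add: doubleton_in_joins)
    then have "{u, w} \<in> joins (Inl ` {..<m}) (Inr ` {..<n})"
      using sub unfolding complete_bipartite_eq snd_conv by blast
    then show ?thesis by (simp add: doubleton_in_joins)
  qed
  obtain u w where uw: "u \<in> S" "w \<in> T" using ne by blast
  show ?thesis
  proof (cases "u \<in> Inl ` {..<m}")
    case True
    then have "T \<subseteq> Inr ` {..<n}" using cross[OF uw(1)] by fastforce
    then have "S \<subseteq> Inl ` {..<m}" using cross[OF _ uw(2)] uw(2) by fastforce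
    then show ?thesis using \<open>T \<subseteq> Inr ` {..<n}\<close> by blast
  next
    case False
    then have "T \<subseteq> Inl ` {..<m}" using cross[OF uw(1)] by blast
    then have "S \<subseteq> Inr ` {..<n}" using cross[OF _ uw(2)] uw(2) by fastforce
    then show ?thesis using \<open>T \<subseteq> Inl ` {..<m}\<close> by blast
  qed
qed

abbreviation inter_edge :: "nat \<Rightarrow> nat \<Rightarrow> (nat + nat) set" where
  "inter_edge i j \<equiv> {Inl i, Inr j}"

lemma edge_grid_inter_edge: "m \<ge> 3 \<Longrightarrow> n \<ge> 3 \<Longrightarrow> edge_grid inter_edge m n"
  by unfold_locales (auto simp: doubleton_eq_iff)

lemma K_inter_edge:
  assumes "edge_grid inter_edge m n"
  shows "edge_grid.K inter_edge A B = joins (Inl ` A) (Inr ` B)"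
proof -
  interpret edge_grid inter_edge m n by (rule assms)
  show ?thesis by (auto simp: K_def joins_def)
qed

lemma edges_complete_bipartite:
  assumes "edge_grid inter_edge m n"
  shows "edges (complete_bipartite m n) = edge_grid.E inter_edge m n"
proof -
  interpret edge_grid inter_edge m n by (rule assms)
  show ?thesis by (simp add: E_def K_inter_edge[OF assms] complete_bipartite_eq)
qed

lemma K33_copies_complete_bipartite:
  assumes grid: "edge_grid inter_edge m n"
  shows "K33_copies (complete_bipartite m n) = edge_grid.K33s inter_edge m n"
proof -
  interpret edge_grid inter_edge m n by (rule grid)
  have sides: "joins S T \<in> K33s"
    if ST: "S \<subseteq> Inl ` {..<m}" "T \<subseteq> Inr ` {..<n}" "card S = 3" "card T = 3"
    for S T :: "(nat + nat) set"
  proof -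
    obtain A where A: "A \<subseteq> {..<m}" "S = Inl ` A" by (rule subset_imageE[OF ST(1)])
    obtain B where B: "B \<subseteq> {..<n}" "T = Inr ` B" by (rule subset_imageE[OF ST(2)])
    have "card A = 3" "card B = 3" using ST(3,4) A(2) B(2) by (simp_all add: card_image)
    then show ?thesis using K33sI[OF A(1) B(1)] A(2) B(2) by (simp add: K_inter_edge[OF grid])
  qed
  show ?thesis
  proof (intro equalityI subsetI)
    fix X assume "X \<in> K33_copies (complete_bipartite m n)"
    then obtain S T where ST: "X = joins S T" "card S = 3" "card T = 3"
      "joins S T \<subseteq> edges (complete_bipartite m n)" by (auto simp: K33_copies_eq)
    then have "S \<noteq> {}" "T \<noteq> {}" by auto
    then show "X \<in> K33s"
      using joins_subset_complete_bipartite_sides[OF ST(4)] sides[of S T] sides[of T S] ST(1-3)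
      by (auto simp: joins_commute[of S T])
  next
    fix X assume "X \<in> K33s"
    then obtain A B where X: "X = K A B" "A \<subseteq> {..<m}" "B \<subseteq> {..<n}" "card A = 3" "card B = 3"
      by (rule K33sE)
    have "K A B \<subseteq> edges (complete_bipartite m n)"
      using K_subset_E[OF X(2,3)] by (simp add: edges_complete_bipartite[OF grid])
    then show "X \<in> K33_copies (complete_bipartite m n)"
      using X unfolding K33_copies_eq K_inter_edge[OF grid]
      by (intro CollectI exI[of _ "Inl ` A"] exI[of _ "Inr ` B"])
        (auto simp: complete_bipartite_eq card_image)
  qed
qed

theorem theorem6p5:
  fixes m n :: nat
  assumes "m \<ge> 3" and "n \<ge> 3"
  shows "(\<exists>!M. maximal_K33_matroid (complete_bipartite m n) M) \<longleftrightarrow>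
    submodular_on (edges (complete_bipartite m n)) (val_K33 (complete_bipartite m n))"
proof -
  have grid: "edge_grid inter_edge m n" using assms by (rule edge_grid_inter_edge)
  interpret edge_grid inter_edge m n by (rule grid)
  let ?G = "complete_bipartite m n"
  have E: "edges ?G = E" using grid by (rule edges_complete_bipartite)
  have K33s: "K33_copies ?G = K33s" using grid by (rule K33_copies_complete_bipartite)
  have "maximal_K33_matroid ?G M \<longleftrightarrow> matroid_with_circuits E K33s M \<and>
      (\<forall>N. matroid_with_circuits E K33s N \<and> M \<subseteq> N \<longrightarrow> N = M)" for M
    unfolding maximal_K33_matroid_def K33_matroid_def weak_le_def E K33s
      matroid_with_circuits_def subset_iff ..
  then have "(\<exists>!M. maximal_K33_matroid ?G M) \<longleftrightarrow> (\<exists>M. greatest_matroid_with_circuits E K33s M)"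
    using unique_maximal_matroid_iff_greatest[OF finite_E] by simp
  also have "\<dots> \<longleftrightarrow> submodular_on E (val_min K33s)" by (rule greatest_exists_iff_submodular)
  also have "val_min K33s = val_K33 ?G" by (rule ext) (simp add: val_K33_def K33s)
  finally show ?thesis unfolding E .
qed

end
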